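(* Let $n,d\in\mathbb N$, $D>0$, $U\subset\mathbb R^d$ open, let $h_0:U\to\mathrm{SL}_{n+1}(\mathbb R)$ be a map every entry of which is a real analytic function, and let $\mu$ be a locally finite Borel measure which is absolutely decaying and $D$-Federer on $U$. Then for any $x_0\in\operatorname{supp}\mu\cap U$ there exist a ball $B(x_0)\subset U$ centred at $x_0$ and constants $C_0,\alpha_0>0$ such that for any ball $B\subset B(x_0)$, any diagonal matrix $g\in\mathrm{SL}_{n+1}(\mathbb R)$ and any $0<\rho\le1$, at least one of the following holds for $h(x)=gh_0(x)$: (1) for all $\varepsilon>0$, $\mu(\{x\in B:h(x)\mathbb Z^{n+1}\notin K_\varepsilon\})\le C_0(\varepsilon/\rho)^{\alpha_0}\mu(3B)$; (2) there exists a primitive collection $\mathbf v_1,\dots,\mathbf v_r\in\mathbb Z^{n+1}$ with $1\le r\le n$ such that $\sup_{x\in B}\|h(x)\mathbf v_1\wedge\cdots\wedge h(x)\mathbf v_r\|<\rho$.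
   Context: For a ball $B=B(x,r)$, $3B=B(x,3r)$. $\mu$ is $D$-Federer on $U$ if $\mu(B(x,3r))<D\mu(B(x,r))$ for all $x\in\operatorname{supp}\mu\cap U$, $r>0$ with $B(x,3r)\subset U$. $\mu$ is absolutely $(C,\alpha)$-decaying on $U$ if for every non-empty open ball $B\subset U$ of radius $r_B>0$ centred in $\operatorname{supp}\mu$, every affine hyperplane $\mathcal H\subset\mathbb R^d$ and every $\varepsilon>0$, $\mu(B\cap\{x:\operatorname{dist}(x,\mathcal H)<\varepsilon\})\le C(\varepsilon/r_B)^\alpha\mu(B)$; it is absolutely decaying if this holds for some $C,\alpha>0$. A collection $\mathbf v_1,\dots,\mathbf v_r\in\mathbb Z^{n+1}$ is primitive if it is linearly independent and $\mathrm{Span}_{\mathbb Z}(\mathbf v_1,\dots,\mathbf v_r)=\mathbb Z^{n+1}\cap\mathrm{Span}_{\mathbb R}(\mathbf v_1,\dots,\mathbf v_r)$. $K_\varepsilon$ is the set of unimodular lattices in $\mathbb R^{n+1}$ with no nonzero vector of Euclidean norm $<\varepsilon$. Norms on $\bigwedge^r(\mathbb R^{n+1})$ are Euclidean w.r.t. the standard basis $\mathbf e_{j_1}\wedge\cdots\wedge\mathbf e_{j_r}$. *)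

theory Defs
  imports "HOL-Analysis.Analysis"
begin

text \<open>Real analyticity in several variables: near every point of the open set \<open>U\<close> the function is
  the sum of an (absolutely convergent) power series indexed by multi-indices \<open>k :: 'd \<Rightarrow> nat\<close>.\<close>

definition real_analytic_on :: "(real^'d \<Rightarrow> real) \<Rightarrow> (real^'d) set \<Rightarrow> bool" where
  "real_analytic_on f U \<longleftrightarrow>
     (\<forall>a\<in>U. \<exists>r>0. \<exists>c :: ('d \<Rightarrow> nat) \<Rightarrow> real. \<forall>x\<in>ball a r.
        ((\<lambda>k. c k * (\<Prod>i\<in>UNIV. (x$i - a$i) ^ k i)) has_sum f x) UNIV)"

definition locally_finite_measure :: "'a::metric_space measure \<Rightarrow> bool" where
  "locally_finite_measure \<mu> \<longleftrightarrow> (\<forall>x. \<exists>r>0. emeasure \<mu> (ball x r) < \<infinity>)"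

definition supp :: "'a::metric_space measure \<Rightarrow> 'a set" where
  "supp \<mu> = {x. \<forall>r>0. emeasure \<mu> (ball x r) > 0}"

definition federer_on :: "real \<Rightarrow> 'a::metric_space measure \<Rightarrow> 'a set \<Rightarrow> bool" where
  "federer_on D \<mu> U \<longleftrightarrow>
     (\<forall>x\<in>supp \<mu> \<inter> U. \<forall>r>0. ball x (3*r) \<subseteq> U \<longrightarrow>
        emeasure \<mu> (ball x (3*r)) < ennreal D * emeasure \<mu> (ball x r))"

definition decaying_on ::
    "real \<Rightarrow> real \<Rightarrow> 'a::euclidean_space measure \<Rightarrow> 'a set \<Rightarrow> bool" where
  "decaying_on C \<alpha> \<mu> U \<longleftrightarrow>
     (\<forall>x\<in>supp \<mu>. \<forall>r>0. ball x r \<subseteq> U \<longrightarrow>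
        (\<forall>a b. a \<noteq> 0 \<longrightarrow> (\<forall>\<epsilon>>0.
           emeasure \<mu> (ball x r \<inter> {y. infdist y {z. a \<bullet> z = b} < \<epsilon>})
             \<le> ennreal (C * (\<epsilon> / r) powr \<alpha>) * emeasure \<mu> (ball x r))))"

definition absolutely_decaying_on :: "'a::euclidean_space measure \<Rightarrow> 'a set \<Rightarrow> bool" where
  "absolutely_decaying_on \<mu> U \<longleftrightarrow> (\<exists>C>0. \<exists>\<alpha>>0. decaying_on C \<alpha> \<mu> U)"

definition diagonal_matrix :: "'a::zero^'m^'m \<Rightarrow> bool" where
  "diagonal_matrix A \<longleftrightarrow> (\<forall>i j. i \<noteq> j \<longrightarrow> A$i$j = 0)"

definition int_lattice :: "(real^'m) set" where
  "int_lattice = {v. \<forall>i. v$i \<in> \<int>}"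

definition unimodular_lattices :: "(real^'m) set set" where
  "unimodular_lattices = {L. \<exists>A :: real^'m^'m. \<bar>det A\<bar> = 1 \<and> L = (*v) A ` int_lattice}"

definition K_set :: "real \<Rightarrow> (real^'m) set set" where
  "K_set \<epsilon> = {L \<in> unimodular_lattices. \<not> (\<exists>v\<in>L. v \<noteq> 0 \<and> norm v < \<epsilon>)}"

definition int_span :: "(real^'m) list \<Rightarrow> (real^'m) set" where
  "int_span vs = {(\<Sum>k<length vs. of_int (c k) *\<^sub>R vs!k) | c :: nat \<Rightarrow> int. True}"

definition primitive :: "(real^'m) list \<Rightarrow> bool" where
  "primitive vs \<longleftrightarrow>
     set vs \<subseteq> int_lattice \<and> distinct vs \<and> independent (set vs) \<and>
     int_span vs = int_lattice \<inter> span (set vs)"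

text \<open>The exterior algebra of \<open>real^'m\<close>, in coordinates: \<open>w$J\<close> is the coefficient of
  \<open>e\<^sub>J = e\<^bsub>j1\<^esub> \<and> \<dots> \<and> e\<^bsub>jr\<^esub>\<close> where \<open>J = {j1 < \<dots> < jr}\<close>. The degree \<open>r\<close> part consists of the
  \<open>w\<close> supported on sets of cardinality \<open>r\<close>, and the norm of \<open>real^('m set)\<close> is the Euclidean norm
  with respect to the basis of the \<open>e\<^sub>J\<close>. For disjoint \<open>I\<close>, \<open>J\<close>, the product of \<open>e\<^sub>I\<close> and \<open>e\<^sub>J\<close> is
  \<open>e\<^bsub>I \<union> J\<^esub>\<close> up to the sign of the permutation sorting \<open>I\<close> followed by \<open>J\<close>.\<close>

type_synonym 'm ext = "real^('m set)"

definition shuffle_sign :: "'m::linorder set \<Rightarrow> 'm set \<Rightarrow> real" where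
  "shuffle_sign I J = (-1) ^ card {(i, j). i \<in> I \<and> j \<in> J \<and> j < i}"

definition wedge :: "('m::{finite,linorder}) ext \<Rightarrow> 'm ext \<Rightarrow> 'm ext" where
  "wedge a b = (\<chi> K. \<Sum>I\<in>Pow K. shuffle_sign I (K - I) * a$I * b$(K - I))"

definition ext_of_vec :: "real^('m::{finite,linorder}) \<Rightarrow> 'm ext" where
  "ext_of_vec v = (\<Sum>i\<in>UNIV. axis {i} (v$i))"

definition wedge_list :: "(real^('m::{finite,linorder})) list \<Rightarrow> 'm ext" where
  "wedge_list vs = foldr (\<lambda>v w. wedge (ext_of_vec v) w) vs (axis {} 1)"

lemma ext_of_vec_nth: "ext_of_vec v $ J = (\<Sum>i\<in>UNIV. if J = {i} then v$i else 0)"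
  by (auto simp: ext_of_vec_def axis_def intro!: sum.cong)

lemma wedge_axis:
  assumes "I \<inter> J = {}"
  shows "wedge (axis I s) (axis J t) = axis (I \<union> J) (shuffle_sign I J * s * t)"
proof (rule vec_eq_iff[THEN iffD2], rule allI)
  fix K
  have "wedge (axis I s) (axis J t) $ K
      = (\<Sum>L\<in>Pow K. if L = I then (if K - I = J then shuffle_sign I J * s * t else 0) else 0)"
    unfolding wedge_def vec_lambda_beta by (rule sum.cong) (auto simp: axis_def)
  also have "\<dots> = (if I \<subseteq> K then (if K - I = J then shuffle_sign I J * s * t else 0) else 0)"
    by (simp add: sum.delta)
  also have "\<dots> = axis (I \<union> J) (shuffle_sign I J * s * t) $ K"
    using assms by (auto simp: axis_def)
  finally show "wedge (axis I s) (axis J t) $ K = axis (I \<union> J) (shuffle_sign I J * s * t) $ K" .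
qed

lemma ext_of_vec_axis: "ext_of_vec (axis i 1) = axis {i} 1"
proof -
  have "ext_of_vec (axis i 1) = (\<Sum>j\<in>UNIV. if j = i then axis {i} 1 else 0)"
    unfolding ext_of_vec_def by (rule sum.cong) (auto simp: axis_def vec_eq_iff)
  then show ?thesis by simp
qed

lemma wedge_list_standard_basis:
  assumes "sorted_wrt (<) js"
  shows "wedge_list (map (\<lambda>j. axis j 1) js) = axis (set js) 1"
  using assms
proof (induction js)
  case Nil
  then show ?case by (simp add: wedge_list_def)
next
  case (Cons j js)
  have empty: "{(i, k). i \<in> {j} \<and> k \<in> set js \<and> k < i} = {}"
    using Cons.prems by auto
  have "shuffle_sign {j} (set js) = 1"
    unfolding shuffle_sign_def empty by simp
  moreover have "j \<notin> set js" using Cons.prems by auto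
  ultimately show ?case
    using Cons by (simp add: wedge_list_def ext_of_vec_axis wedge_axis)
qed

lemma wedge_ext_of_vec_self: "wedge (ext_of_vec v) (ext_of_vec v) = 0"
proof (rule vec_eq_iff[THEN iffD2], rule allI)
  fix K :: "'a set"
  let ?f = "\<lambda>I. shuffle_sign I (K - I) * ext_of_vec v $ I * ext_of_vec v $ (K - I)"
  have neg: "?f (K - I) = - ?f I" if "I \<subseteq> K" for I
  proof (cases "\<exists>i j. I = {i} \<and> K - I = {j}")
    case True
    then obtain i j where ij: "I = {i}" "K - I = {j}" by blast
    then have "i \<noteq> j" by auto
    have *: "{(a, b). a \<in> {p} \<and> b \<in> {q} \<and> b < a} = (if q < p then {(p, q)} else {})" for p q :: 'a
      by auto
    have "shuffle_sign {j} {i} = - shuffle_sign {i} {j}"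
      using \<open>i \<noteq> j\<close> unfolding shuffle_sign_def * by (auto simp: not_less)
    moreover have "K - {j} = {i}" using ij that by auto
    ultimately show ?thesis using ij by simp
  next
    case False
    then have "ext_of_vec v $ I * ext_of_vec v $ (K - I) = 0"
      by (auto simp: ext_of_vec_nth)
    moreover have "K - (K - I) = I" using that by auto
    ultimately show ?thesis by (auto simp: mult.assoc)
  qed
  have "(\<Sum>I\<in>Pow K. ?f I) = (\<Sum>I\<in>Pow K. ?f (K - I))"
    by (rule sum.reindex_bij_witness[of _ "\<lambda>I. K - I" "\<lambda>I. K - I"]) (auto simp: double_diff)
  also have "\<dots> = - (\<Sum>I\<in>Pow K. ?f I)"
    unfolding sum_negf[symmetric] by (rule sum.cong[OF refl]) (use neg in blast)
  finally show "wedge (ext_of_vec v) (ext_of_vec v) $ K = 0 $ K"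
    by (simp add: wedge_def)
qed

end

theory Submission
  imports Defs
begin

text \<open>The argument is quantitative nondivergence in the style of Kleinbock--Margulis and
  Kleinbock--Lindenstrauss--Weiss. Coordinates of \<open>g h\<^sub>0(x) v\<^sub>1 \<and> \<dots> \<and> g h\<^sub>0(x) v\<^sub>r\<close> lie, for all
  \<open>g\<close> and \<open>v\<^sub>i\<close>, in the span of the finitely many products of at most \<open>n + 1\<close> entries of \<open>h\<^sub>0\<close>. By
  analyticity and compactness, near \<open>x\<^sub>0\<close> every function in this span has a derivative of bounded order
  that is comparable to its norm, and hence it is \<open>(C, \<alpha>)\<close>-good for the absolutely decaying Federer
  measure \<open>\<mu>\<close>: where the function is small, some derivative is small while one of its partials is not,
  which confines the point to a thin neighbourhood of a hyperplane at a suitable scale.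
  If the second alternative fails, covolumes of all primitive sublattices become \<open>\<ge> \<rho>/2\<close> somewhere on
  the ball, and an induction on the length of flags with Vitali coverings shows that most points carry a flag of
  sublattices with covolumes in \<open>[\<epsilon>, \<rho>/2)\<close> such that all sublattices compatible with the flag and not in
  it have covolume \<open>\<ge> \<rho>/2\<close>. For such points a vector shorter than a constant times \<open>\<epsilon>\<close>, added
  to the largest member of the flag that does not contain it, would yield a compatible sublattice of
  too small covolume.\<close>

section \<open>Supports, coverings and marked points\<close>

text \<open>Several obstacles shape the proof. The given ball may be centred anywhere, whereas decay
  and the Federer condition speak only of balls centred in the support. So goodness is proved and
  used at such centres only, the complement of the support is discarded as a null set, and the
  covering of the ball spills over into its triple, which explains the measure on the right-hand
  side. Exceptional sets are bounded through measurable supersets, which the coverings produce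
  directly.

  The constants must not depend on \<open>g\<close> or on the integer vectors. Both enter only
  through a coefficient vector of unbounded size in front of finitely many fixed functions. These
  may be linearly dependent, so no lower bound can hold for all coefficient vectors. Analyticity
  repairs this: a combination whose derivatives all vanish at \<open>x0\<close> vanishes on a ball,
  and such combinations are split off orthogonally before compactness is used on a unit sphere.

  The final exponent is \<open>\<alpha> / 4 ^ l\<close>: each step between successive derivative
  orders costs a fourth root, and \<open>l\<close> orders are needed. A supremum that is at least
  \<rho> need not be attained, whence \<open>\<rho> / 2\<close>.\<close>

lemma null_complement_supp:
  fixes \<mu> :: "'a::{metric_space, second_countable_topology} measure"
  assumes "sets \<mu> = sets borel"
  shows "- supp \<mu> \<in> null_sets \<mu>"
proof -
  define F where "F = {ball x r | x r. emeasure \<mu> (ball x r) = 0}"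
  have "\<And>S. S \<in> F \<Longrightarrow> open S" by (auto simp: F_def)
  then obtain F' where F': "F' \<subseteq> F" "countable F'" "\<Union>F' = \<Union>F"
    using Lindelof by metis
  have "\<Union>F' \<in> null_sets \<mu>"
    using F' assms by (intro null_sets_UN'[where N = "\<lambda>S. S" and I = F', simplified])
      (auto simp: F_def null_sets_def)
  moreover have "\<Union>F = - supp \<mu>"
  proof (intro equalityI subsetI)
    fix z assume "z \<in> \<Union>F"
    then obtain x r where z: "z \<in> ball x r" "emeasure \<mu> (ball x r) = 0" by (auto simp: F_def)
    then obtain e where e: "e > 0" "ball z e \<subseteq> ball x r"
      by (meson open_ball open_contains_ball)
    then have "emeasure \<mu> (ball z e) = 0"
      using z emeasure_mono[OF e(2), of \<mu>] assms by auto
    then show "z \<in> - supp \<mu>" using e by (auto simp: supp_def)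
  next
    fix z assume "z \<in> - supp \<mu>"
    then obtain r where "r > 0" "emeasure \<mu> (ball z r) = 0" by (auto simp: supp_def)
    then show "z \<in> \<Union>F" unfolding F_def by (metis (mono_tags, lifting) UnionI centre_in_ball mem_Collect_eq)
  qed
  ultimately show ?thesis using F' by simp
qed

text \<open>Vitali's lemma is applied to the balls of radius \<open>t z / 10\<close>. Their
  five-fold enlargements have radius \<open>t z / 2\<close> and lie in the balls on which
  \<open>E z\<close> captures \<open>Z\<close>, while the small balls are disjoint inside
  \<open>W\<close>, so their measures add up to at most that of \<open>W\<close>. Both passages from
  a local estimate to a whole ball use this lemma.\<close>

lemma covering_bound:
  fixes \<mu> :: "'a::euclidean_space measure"
  assumes sets: "sets \<mu> = sets borel"
    and t: "\<And>z. z \<in> Z \<Longrightarrow> 0 < t z \<and> t z \<le> T"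
    and E: "\<And>z. z \<in> Z \<Longrightarrow> E z \<in> sets \<mu>" "\<And>z. z \<in> Z \<Longrightarrow> Z \<inter> ball z (t z) \<subseteq> E z"
    and le: "\<And>z. z \<in> Z \<Longrightarrow> emeasure \<mu> (E z) \<le> \<kappa> * emeasure \<mu> (cball z (t z / 10))"
    and W: "\<And>z. z \<in> Z \<Longrightarrow> cball z (t z / 10) \<subseteq> W" "W \<in> sets \<mu>"
  obtains E' where "E' \<in> sets \<mu>" "Z \<subseteq> E'" "emeasure \<mu> E' \<le> \<kappa> * emeasure \<mu> W"
proof -
  have "Z \<subseteq> (\<Union>z\<in>Z. cball z (t z / 10))" using t by force
  then obtain C where C: "countable C" "C \<subseteq> Z"
    "pairwise (\<lambda>i j. disjnt (cball i (t i / 10)) (cball j (t j / 10))) C"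
    "Z \<subseteq> (\<Union>i\<in>C. cball i (5 * (t i / 10)))"
    by (rule Vitali_covering_lemma_cballs[where a = "\<lambda>z. z" and B = "T / 10"]) (use t in auto)
  let ?E = "\<Union>i\<in>C. E i"
  have CE: "E i \<in> sets \<mu>" if "i \<in> C" for i using that C E by auto
  have "?E \<in> sets \<mu>" using C CE by (intro sets.countable_UN') auto
  moreover have "Z \<subseteq> ?E"
  proof
    fix z assume z: "z \<in> Z"
    then obtain i where i: "i \<in> C" "z \<in> cball i (5 * (t i / 10))" using C(4) by auto
    then have "z \<in> ball i (t i)" using t[of i] C(2) by auto
    then show "z \<in> ?E" using i(1) E(2)[of i] C(2) z by blast
  qed
  moreover have "emeasure \<mu> ?E \<le> \<kappa> * emeasure \<mu> W"
  proof -
    define N where "N = to_nat_on C ` C"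
    have inj: "from_nat_into C (to_nat_on C i) = i" if "i \<in> C" for i
      using that C(1) by simp
    define A where "A G n = (if n \<in> N then G (from_nat_into C n) else {})" for G :: "'a \<Rightarrow> 'a set" and n
    let ?B = "\<lambda>i. cball i (t i / 10)"
    have UN: "(\<Union>n. A G n) = (\<Union>i\<in>C. G i)" for G
      using inj by (force simp: A_def N_def)
    have meas: "range (A G) \<subseteq> sets \<mu>" if "\<And>i. i \<in> C \<Longrightarrow> G i \<in> sets \<mu>" for G
      using that inj by (auto simp: A_def N_def)
    have "emeasure \<mu> ?E \<le> (\<Sum>n. emeasure \<mu> (A E n))"
      unfolding UN[symmetric] using meas[of E] CE by (intro emeasure_subadditive_countably) auto
    also have "\<dots> \<le> (\<Sum>n. \<kappa> * emeasure \<mu> (A ?B n))"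
      using C(2) inj le by (intro suminf_le) (auto simp: A_def N_def)
    also have "\<dots> = \<kappa> * (\<Sum>n. emeasure \<mu> (A ?B n))" by simp
    also have "(\<Sum>n. emeasure \<mu> (A ?B n)) = emeasure \<mu> (\<Union>n. A ?B n)"
    proof (rule suminf_emeasure)
      show "range (A ?B) \<subseteq> sets \<mu>" using sets by (intro meas) auto
      show "disjoint_family (A ?B)"
        using C(3) inj unfolding disjoint_family_on_def A_def N_def pairwise_def disjnt_def by force
    qed
    also have "\<kappa> * \<dots> \<le> \<kappa> * emeasure \<mu> W"
      unfolding UN using W C(2) by (intro mult_left_mono emeasure_mono) auto
    finally show ?thesis .
  qed
  ultimately show ?thesis by (rule that)
qed

lemma federer_iterate:
  assumes fed: "federer_on D \<mu> U" and x: "x \<in> supp \<mu>" and "r > 0" "D > 0"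
    and "ball x (3 ^ k * r) \<subseteq> U"
  shows "emeasure \<mu> (ball x (3 ^ k * r)) \<le> ennreal (D ^ k) * emeasure \<mu> (ball x r)"
  using assms(5)
proof (induction k)
  case (Suc k)
  have "ball x (3 ^ k * r) \<subseteq> U"
    using Suc.prems \<open>r > 0\<close> by (auto intro!: order_trans[OF subset_ball, OF _ Suc.prems])
  then have IH: "emeasure \<mu> (ball x (3 ^ k * r)) \<le> ennreal (D ^ k) * emeasure \<mu> (ball x r)"
    by (rule Suc.IH)
  have "x \<in> U" using Suc.prems \<open>r > 0\<close> by (auto intro!: subsetD[OF Suc.prems])
  then have "emeasure \<mu> (ball x (3 * (3 ^ k * r))) \<le> ennreal D * emeasure \<mu> (ball x (3 ^ k * r))"
    using fed x Suc.prems \<open>r > 0\<close> unfolding federer_on_def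
    by (intro less_imp_le) (auto simp: mult.assoc)
  also have "\<dots> \<le> ennreal D * (ennreal (D ^ k) * emeasure \<mu> (ball x r))"
    using IH by (rule mult_left_mono) simp
  also have "\<dots> = ennreal (D ^ Suc k) * emeasure \<mu> (ball x r)"
    using \<open>D > 0\<close> by (simp add: ennreal_mult mult.assoc)
  finally show ?case by (simp add: mult.assoc)
qed simp

section \<open>Flags in an abstract poset and the covering induction\<close>

definition comparable :: "'p::order \<Rightarrow> 'p \<Rightarrow> bool" where
  "comparable s t \<longleftrightarrow> s \<le> t \<or> t \<le> s"

definition chain_set :: "'p::order set \<Rightarrow> bool" where
  "chain_set Q \<longleftrightarrow> (\<forall>s\<in>Q. \<forall>t\<in>Q. comparable s t)"

text \<open>\<open>Q\<close> is the flag; by the last clause, whatever could still be inserted into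
  it has a large value. If \<open>P\<close> is empty, the empty flag marks every point, which starts
  the induction.\<close>

definition marked :: "'p::order set \<Rightarrow> ('p \<Rightarrow> 'a \<Rightarrow> real) \<Rightarrow> real \<Rightarrow> real \<Rightarrow> 'a \<Rightarrow> bool" where
  "marked P \<psi> \<epsilon> \<rho> z \<longleftrightarrow> (\<exists>Q\<subseteq>P. chain_set Q \<and> (\<forall>s\<in>Q. \<epsilon> \<le> \<psi> s z \<and> \<psi> s z < \<rho>) \<and>
     (\<forall>s\<in>P - Q. (\<forall>t\<in>Q. comparable s t) \<longrightarrow> \<rho> \<le> \<psi> s z))"

text \<open>Anything outside \<open>insert s Q\<close> that is comparable to all of it is comparable
  to \<open>s\<close>, hence lies in the smaller poset, where it is known to be large. So nothing is
  lost by passing to the elements comparable to \<open>s\<close>.\<close>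

lemma marked_insert:
  assumes "marked {t \<in> P. t \<noteq> s \<and> comparable t s} \<psi> \<epsilon> \<rho> z" "s \<in> P" "\<epsilon> \<le> \<psi> s z" "\<psi> s z < \<rho>"
  shows "marked P \<psi> \<epsilon> \<rho> z"
proof -
  obtain Q where Q: "Q \<subseteq> {t \<in> P. t \<noteq> s \<and> comparable t s}" "chain_set Q"
    "\<forall>s\<in>Q. \<epsilon> \<le> \<psi> s z \<and> \<psi> s z < \<rho>"
    "\<forall>t\<in>{t \<in> P. t \<noteq> s \<and> comparable t s} - Q. (\<forall>u\<in>Q. comparable t u) \<longrightarrow> \<rho> \<le> \<psi> t z"
    using assms(1) unfolding marked_def by blast
  have "chain_set (insert s Q)"
    using Q(1,2) by (auto simp: chain_set_def comparable_def)
  then show ?thesis unfolding marked_def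
    using Q assms(2-4) by (intro exI[of _ "insert s Q"]) auto
qed

text \<open>Each level adds the share \<open>C\<close> of one good function to the previous bound,
  both on a ball of radius \<open>6 * t\<close>. Four applications of the Federer condition shrink
  this ball below the Vitali radius, since \<open>6 / 81 < 1 / 10\<close>.\<close>

primrec nd_const :: "real \<Rightarrow> real \<Rightarrow> nat \<Rightarrow> real" where
  "nd_const D C 0 = 0"
| "nd_const D C (Suc k) = (nd_const D C k + C) * D ^ 4"

text \<open>The next level works on balls of radius below \<open>4 * r\<close> whose centres are
  within \<open>r\<close> of the old one, which \<open>4 * nd_scale k + 3\<close> accommodates.
  Values of at least 3 ensure \<open>6 * t \<le> 2 * nd_scale k * t\<close>, the room that the
  goodness hypothesis asks for.\<close>

primrec nd_scale :: "nat \<Rightarrow> real" where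
  "nd_scale 0 = 3"
| "nd_scale (Suc k) = 4 * nd_scale k + 3"

lemma nd_scale_ge: "nd_scale k \<ge> 3"
  by (induction k) auto

lemma nd_const_nonneg: "D > 0 \<Longrightarrow> C \<ge> 0 \<Longrightarrow> nd_const D C k \<ge> 0"
  by (induction k) auto

text \<open>Among the radii on which some element stays below \<rho>, a nearly maximal one is
  chosen. A member above half of their supremum cannot be doubled, so at radius \<open>2 * t\<close>
  every element has reached \<rho>; continuity makes the set of radii non-empty.\<close>

lemma exceptional_radius:
  fixes y :: "'a::metric_space" and \<psi> :: "'p \<Rightarrow> 'a \<Rightarrow> real"
  assumes "s \<in> P" "\<psi> s y < \<rho>" "continuous (at y) (\<psi> s)"
    and big: "\<And>s. s \<in> P \<Longrightarrow> \<exists>x\<in>ball y R. \<psi> s x \<ge> \<rho>"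
  obtains s' t where "s' \<in> P" "0 < t" "t < R" "\<forall>x\<in>ball y t. \<psi> s' x < \<rho>"
    "\<forall>s\<in>P. \<exists>x\<in>ball y (2 * t). \<psi> s x \<ge> \<rho>"
proof -
  define T where "T = {t. 0 < t \<and> (\<exists>s\<in>P. \<forall>x\<in>ball y t. \<psi> s x < \<rho>)}"
  have T: "t < R" if "t \<in> T" for t
  proof (rule ccontr)
    assume "\<not> t < R"
    then have "ball y R \<subseteq> ball y t" by (intro subset_ball) auto
    then show False using that big unfolding T_def by fastforce
  qed
  have "\<exists>d>0. \<forall>x. dist x y < d \<longrightarrow> \<psi> s x < \<rho>"
    using order_tendstoD(2)[OF assms(3)[unfolded continuous_at] assms(2)]
    using assms(2) unfolding eventually_at by (metis UNIV_I)
  then obtain d where "d > 0" "\<forall>x. dist x y < d \<longrightarrow> \<psi> s x < \<rho>" by blast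
  then have "d \<in> T" using assms(1) unfolding T_def by (auto simp: dist_commute intro!: bexI[of _ s])
  then have ne: "T \<noteq> {}" by blast
  have bdd: "bdd_above T" using T by (intro bdd_aboveI[of _ R]) (auto intro: less_imp_le)
  obtain t1 where "t1 \<in> T" using ne by blast
  then have "Sup T > 0" using cSup_upper[OF _ bdd, of t1] by (auto simp: T_def)
  then obtain t where t: "t \<in> T" "Sup T / 2 < t"
    using less_cSup_iff[OF ne bdd, of "Sup T / 2"] by auto
  then have "2 * t \<notin> T" using cSup_upper[OF _ bdd, of "2 * t"] by auto
  moreover have "t > 0" using t by (simp add: T_def)
  ultimately have "\<forall>s\<in>P. \<exists>x\<in>ball y (2 * t). \<psi> s x \<ge> \<rho>" unfolding T_def by force
  then show ?thesis using that t T[OF t(1)] unfolding T_def by blast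
qed

text \<open>Induction on the length of chains. Around an unmarked \<open>z\<close> there is an
  exceptional radius \<open>t\<close> with an element \<open>s\<close> below \<rho>. A nearby
  unmarked point either makes \<open>s\<close> smaller than \<epsilon>, which goodness of
  \<open>s\<close> controls, or is unmarked for the elements comparable to \<open>s\<close>, whose
  chains are shorter by one.\<close>

lemma nondivergence_poset:
  fixes \<mu> :: "'a::euclidean_space measure" and \<psi> :: "'p::order \<Rightarrow> 'a \<Rightarrow> real"
  assumes sets: "sets \<mu> = sets borel" and fed: "federer_on D \<mu> U" and D: "D > 0" and C: "C \<ge> 0"
    and V: "V \<subseteq> U" and cont: "\<And>s x. s \<in> P \<Longrightarrow> x \<in> V \<Longrightarrow> continuous (at x) (\<psi> s)"
    and good: "\<And>s y r. s \<in> P \<Longrightarrow> y \<in> supp \<mu> \<Longrightarrow> r > 0 \<Longrightarrow> ball y (3 * r) \<subseteq> V \<Longrightarrow>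
      \<exists>x\<in>ball y r. \<psi> s x \<ge> \<rho> \<Longrightarrow> \<exists>E\<in>sets \<mu>. {x \<in> ball y r. \<psi> s x < \<epsilon>} \<subseteq> E \<and>
        emeasure \<mu> E \<le> ennreal (C * q) * emeasure \<mu> (ball y r)"
    and q: "q \<ge> 0"
    and len: "\<And>Q. Q \<subseteq> P \<Longrightarrow> chain_set Q \<Longrightarrow> finite Q \<and> card Q \<le> k"
    and B: "r > 0" "ball x (nd_scale k * r) \<subseteq> V" "\<And>s. s \<in> P \<Longrightarrow> \<exists>x'\<in>ball x r. \<psi> s x' \<ge> \<rho>"
  shows "\<exists>E\<in>sets \<mu>. {z \<in> ball x r \<inter> supp \<mu>. \<not> marked P \<psi> \<epsilon> \<rho> z} \<subseteq> E \<and>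
      emeasure \<mu> E \<le> ennreal (nd_const D C k * q) * emeasure \<mu> (ball x (3 * r))"
  using cont good len B
proof (induction k arbitrary: P x r)
  case 0
  have "{s} \<subseteq> P \<Longrightarrow> card {s} \<le> 0" for s
    using "0.prems"(3)[of "{s}"] by (auto simp: chain_set_def comparable_def)
  then have "P = {}" by auto
  then have "{z \<in> ball x r \<inter> supp \<mu>. \<not> marked P \<psi> \<epsilon> \<rho> z} = {}"
    by (auto simp: marked_def chain_set_def)
  then show ?case by (intro bexI[of _ "{}"]) auto
next
  case (Suc k)
  note cont = Suc.prems(1) and good = Suc.prems(2) and len = Suc.prems(3)
    and r = Suc.prems(4) and Vx = Suc.prems(5) and big = Suc.prems(6)
  define Z where "Z = {z \<in> ball x r \<inter> supp \<mu>. \<not> marked P \<psi> \<epsilon> \<rho> z}"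
  let ?M = "nd_const D C k" and ?\<kappa> = "nd_scale k"
  have \<kappa>3: "?\<kappa> \<ge> 3" by (rule nd_scale_ge)
  have "\<exists>t E. 0 < t \<and> t \<le> 2 * r \<and> E \<in> sets \<mu> \<and> Z \<inter> ball z t \<subseteq> E \<and>
      emeasure \<mu> E \<le> ennreal ((?M + C) * D ^ 4 * q) * emeasure \<mu> (cball z (t / 10))"
    if z: "z \<in> Z" for z
  proof -
    have zB: "z \<in> ball x r" and zs: "z \<in> supp \<mu>" and nm: "\<not> marked P \<psi> \<epsilon> \<rho> z"
      using z by (auto simp: Z_def)
    \<comment> \<open>Otherwise the empty flag would mark \<open>z\<close>.\<close>
    have "\<exists>s\<in>P. \<psi> s z < \<rho>"
      using nm unfolding marked_def by (metis Diff_empty chain_set_def empty_iff empty_subsetI not_less)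
    then obtain s0 where s0: "s0 \<in> P" "\<psi> s0 z < \<rho>" by blast
    have zV: "ball z (\<kappa>' * t) \<subseteq> V" if "\<kappa>' \<le> 2 * ?\<kappa>" "0 < t" "t < 2 * r" "\<kappa>' \<ge> 0" for \<kappa>' t
    proof (rule order_trans[OF _ Vx], rule)
      fix w assume w: "w \<in> ball z (\<kappa>' * t)"
      have "\<kappa>' * t \<le> 2 * ?\<kappa> * (2 * r)" using that r by (intro mult_mono) auto
      then have "dist x w < r + 4 * ?\<kappa> * r"
        using zB w dist_triangle[of x w z] by auto
      also have "\<dots> \<le> nd_scale (Suc k) * r" using r by (simp add: algebra_simps)
      finally show "w \<in> ball x (nd_scale (Suc k) * r)" by simp
    qed
    have "z \<in> V" using zV[of 1 r] r \<kappa>3 by auto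
    \<comment> \<open>This recentres the hypothesis on \<open>ball x r\<close> at the support point
      \<open>z\<close>, at the price of doubling the radius.\<close>
    have sub: "ball x r \<subseteq> ball z (2 * r)"
    proof
      fix w assume "w \<in> ball x r"
      then show "w \<in> ball z (2 * r)"
        using zB dist_triangle[of z w x] by (auto simp: dist_commute)
    qed
    obtain s t where st: "s \<in> P" "0 < t" "t < 2 * r" "\<forall>x\<in>ball z t. \<psi> s x < \<rho>"
      "\<forall>s\<in>P. \<exists>x\<in>ball z (2 * t). \<psi> s x \<ge> \<rho>"
      using exceptional_radius[of s0 P \<psi> z \<rho> "2 * r"] s0 cont[OF s0(1) \<open>z \<in> V\<close>] big sub by blast
    define P' where "P' = {u \<in> P. u \<noteq> s \<and> comparable u s}"
    have P'P: "P' \<subseteq> P" by (auto simp: P'_def)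
    have len': "finite Q \<and> card Q \<le> k" if "Q \<subseteq> P'" "chain_set Q" for Q
    proof -
      have "s \<notin> Q" using that by (auto simp: P'_def)
      moreover have "finite (insert s Q) \<and> card (insert s Q) \<le> Suc k"
        using that st(1) by (intro len) (auto simp: P'_def chain_set_def comparable_def)
      ultimately show ?thesis by auto
    qed
    \<comment> \<open>The radius is \<open>2 * t\<close>, at which all elements have reached \<rho>;
      points are claimed only within \<open>t\<close>, where \<open>s\<close> is still below
      \<rho>.\<close>
    have "\<exists>E\<in>sets \<mu>. {w \<in> ball z (2 * t) \<inter> supp \<mu>. \<not> marked P' \<psi> \<epsilon> \<rho> w} \<subseteq> E \<and>
      emeasure \<mu> E \<le> ennreal (nd_const D C k * q) * emeasure \<mu> (ball z (3 * (2 * t)))"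
    proof (rule Suc.IH)
      show "ball z (nd_scale k * (2 * t)) \<subseteq> V"
        using st zV[of "2 * ?\<kappa>" t] \<kappa>3 by (simp add: mult_ac)
      show "\<exists>E\<in>sets \<mu>. {x \<in> ball y r. \<psi> s x < \<epsilon>} \<subseteq> E \<and>
          emeasure \<mu> E \<le> ennreal (C * q) * emeasure \<mu> (ball y r)"
        if "s \<in> P'" "y \<in> supp \<mu>" "0 < r" "ball y (3 * r) \<subseteq> V" "\<exists>x\<in>ball y r. \<rho> \<le> \<psi> s x" for s y r
        using that P'P by (intro good) auto
    qed (use cont P'P len' st in auto)
    then obtain E1 where E1: "E1 \<in> sets \<mu>"
      "{w \<in> ball z (2 * t) \<inter> supp \<mu>. \<not> marked P' \<psi> \<epsilon> \<rho> w} \<subseteq> E1"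
      "emeasure \<mu> E1 \<le> ennreal (?M * q) * emeasure \<mu> (ball z (6 * t))" by auto
    have "ball z (3 * (2 * t)) \<subseteq> V" using zV[of 6 t] st \<kappa>3 by auto
    then have "\<exists>E\<in>sets \<mu>. {w \<in> ball z (2 * t). \<psi> s w < \<epsilon>} \<subseteq> E \<and>
        emeasure \<mu> E \<le> ennreal (C * q) * emeasure \<mu> (ball z (2 * t))"
      using st zs by (intro good) auto
    then obtain E2 where E2: "E2 \<in> sets \<mu>" "{w \<in> ball z (2 * t). \<psi> s w < \<epsilon>} \<subseteq> E2"
        "emeasure \<mu> E2 \<le> ennreal (C * q) * emeasure \<mu> (ball z (2 * t))" by auto
    have "Z \<inter> ball z t \<subseteq> E1 \<union> E2"
    proof
      fix w assume w: "w \<in> Z \<inter> ball z t"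
      then have w': "w \<in> ball z (2 * t)" "w \<in> supp \<mu>" "\<psi> s w < \<rho>" "\<not> marked P \<psi> \<epsilon> \<rho> w"
        using st by (auto simp: Z_def)
      show "w \<in> E1 \<union> E2"
      proof (cases "\<psi> s w < \<epsilon>")
        case False
        then have "\<not> marked P' \<psi> \<epsilon> \<rho> w"
          using w' marked_insert[of P s \<psi> \<epsilon> \<rho> w] st(1) unfolding P'_def by auto
        then show ?thesis using w' E1(2) by auto
      qed (use w' E2(2) in auto)
    qed
    moreover have "emeasure \<mu> (E1 \<union> E2)
        \<le> ennreal ((?M + C) * D ^ 4 * q) * emeasure \<mu> (cball z (t / 10))"
    proof -
      have Mq: "0 \<le> ?M * q" "0 \<le> C * q" using nd_const_nonneg[OF D C] q C by auto
      have "emeasure \<mu> (E1 \<union> E2) \<le> emeasure \<mu> E1 + emeasure \<mu> E2"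
        using E1 E2 by (intro emeasure_subadditive) auto
      also have "\<dots> \<le> ennreal (?M * q) * emeasure \<mu> (ball z (6 * t))
          + ennreal (C * q) * emeasure \<mu> (ball z (6 * t))"
        using E1(3) st(2) sets
        by (intro add_mono order_trans[OF E2(3)] mult_left_mono emeasure_mono subset_ball) auto
      also have "\<dots> = ennreal ((?M + C) * q) * emeasure \<mu> (ball z (6 * t))"
        using Mq by (simp add: distrib_right)
      also have "emeasure \<mu> (ball z (6 * t)) = emeasure \<mu> (ball z (3 ^ 4 * (6 * t / 81)))" by simp
      also have "\<dots> \<le> ennreal (D ^ 4) * emeasure \<mu> (ball z (6 * t / 81))"
        using st(2) zs D V zV[of 6 t] st \<kappa>3 by (intro federer_iterate[OF fed]) auto
      also have "emeasure \<mu> (ball z (6 * t / 81)) \<le> emeasure \<mu> (cball z (t / 10))"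
        using st(2) sets by (intro emeasure_mono) auto
      finally have "emeasure \<mu> (E1 \<union> E2) \<le> ennreal ((?M + C) * q) * (ennreal (D ^ 4) * emeasure \<mu> (cball z (t / 10)))"
        by (simp add: mult_left_mono)
      also have "\<dots> = ennreal ((?M + C) * D ^ 4 * q) * emeasure \<mu> (cball z (t / 10))"
      proof -
        have "0 \<le> (?M + C) * q" using nd_const_nonneg[OF D C] q C by simp
        then have "ennreal ((?M + C) * D ^ 4 * q) = ennreal ((?M + C) * q) * ennreal (D ^ 4)"
          using Mq D by (subst ennreal_mult[symmetric]) (auto simp: mult_ac)
        then show ?thesis by (simp add: mult.assoc)
      qed
      finally show ?thesis .
    qed
    ultimately show ?thesis using st E1 E2 by (intro exI[of _ t] exI[of _ "E1 \<union> E2"]) auto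
  qed
  then obtain t E where tE: "\<And>z. z \<in> Z \<Longrightarrow> 0 < t z \<and> t z \<le> 2 * r" "\<And>z. z \<in> Z \<Longrightarrow> E z \<in> sets \<mu>"
    "\<And>z. z \<in> Z \<Longrightarrow> Z \<inter> ball z (t z) \<subseteq> E z"
    "\<And>z. z \<in> Z \<Longrightarrow> emeasure \<mu> (E z) \<le> ennreal ((?M + C) * D ^ 4 * q) * emeasure \<mu> (cball z (t z / 10))"
    by metis
  have "cball z (t z / 10) \<subseteq> ball x (3 * r)" if "z \<in> Z" for z
  proof
    fix w assume "w \<in> cball z (t z / 10)"
    moreover have "z \<in> ball x r" using that by (auto simp: Z_def)
    ultimately show "w \<in> ball x (3 * r)"
      using tE(1)[OF that] r dist_triangle[of x w z] by auto
  qed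
  then obtain E' where "E' \<in> sets \<mu>" "Z \<subseteq> E'"
    "emeasure \<mu> E' \<le> ennreal ((?M + C) * D ^ 4 * q) * emeasure \<mu> (ball x (3 * r))"
    using covering_bound[OF sets tE, of "ball x (3 * r)"] sets by auto
  then show ?case unfolding Z_def[symmetric] by (intro bexI[of _ E']) auto
qed

section \<open>Exterior products and primitive bases\<close>

text \<open>Left multiplication by one vector. As \<open>wedge_list\<close> iterates it, its
  linearity, anticommutation and explicit coordinates carry the exterior algebra below.\<close>

definition wedge_vec :: "real^('m::{finite,linorder}) \<Rightarrow> 'm ext \<Rightarrow> 'm ext" where
  "wedge_vec x w = wedge (ext_of_vec x) w"

definition ins_sign :: "'m::{finite,linorder} \<Rightarrow> 'm set \<Rightarrow> real" where
  "ins_sign i K = (-1) ^ card {b \<in> K. b < i}"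

lemma wedge_vec_nth: "wedge_vec x w $ K = (\<Sum>i\<in>K. ins_sign i K * x $ i * w $ (K - {i}))"
proof -
  let ?f = "\<lambda>I. shuffle_sign I (K - I) * ext_of_vec x $ I * w $ (K - I)"
  have sing: "ext_of_vec x $ {i} = x $ i" for i
    by (simp add: ext_of_vec_nth)
  have z: "ext_of_vec x $ I = 0" if "\<forall>i. I \<noteq> {i}" for I
    using that by (simp add: ext_of_vec_nth)
  have sg: "shuffle_sign {i} (K - {i}) = ins_sign i K" for i
  proof -
    have "{(a, b). a \<in> {i} \<and> b \<in> K - {i} \<and> b < a} = Pair i ` {b \<in> K. b < i}" by auto
    then show ?thesis unfolding shuffle_sign_def ins_sign_def
      by (simp add: card_image inj_on_def)
  qed
  have "wedge_vec x w $ K = (\<Sum>I\<in>Pow K. ?f I)"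
    by (simp add: wedge_vec_def wedge_def)
  also have "\<dots> = (\<Sum>I\<in>(\<lambda>i. {i}) ` K. ?f I)"
    by (rule sum.mono_neutral_right) (use z in auto)
  also have "\<dots> = (\<Sum>i\<in>K. ?f {i})"
    by (subst sum.reindex) auto
  finally show ?thesis by (simp add: sing sg)
qed

lemma linear_wedge_vec_left: "linear (\<lambda>x. wedge_vec x w)"
  by (rule linearI)
    (simp_all add: vec_eq_iff wedge_vec_nth algebra_simps sum.distrib sum_distrib_left)

lemma linear_wedge_vec_right: "linear (wedge_vec x)"
  by (rule linearI)
    (simp_all add: vec_eq_iff wedge_vec_nth algebra_simps sum.distrib sum_distrib_left)

text \<open>Deleting the smaller of two indices lowers the position of the larger by one, while
  deleting the larger leaves the smaller in place. So exactly one sign flips.\<close>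

lemma ins_sign_swap:
  assumes "i \<in> K" "j \<in> K" "i \<noteq> j"
  shows "ins_sign i K * ins_sign j (K - {i}) = - (ins_sign j K * ins_sign i (K - {j}))"
proof -
  have *: "ins_sign i K * ins_sign j (K - {i}) = - (ins_sign j K * ins_sign i (K - {j}))"
    if "i < j" "i \<in> K" "j \<in> K" for i j
  proof -
    have 1: "{b \<in> K - {j}. b < i} = {b \<in> K. b < i}" using that by auto
    have "{b \<in> K. b < j} = insert i {b \<in> K - {i}. b < j}" using that by auto
    then have 2: "card {b \<in> K. b < j} = Suc (card {b \<in> K - {i}. b < j})" by simp
    show ?thesis unfolding ins_sign_def 1 2 by simp
  qed
  show ?thesis
    using *[of i j] *[of j i] assms by (cases "i < j") auto
qed

lemma wedge_vec_twice: "wedge_vec x (wedge_vec x w) = 0"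
proof (rule vec_eq_iff[THEN iffD2], rule allI)
  fix K :: "'a set"
  let ?S = "SIGMA i:K. K - {i}"
  let ?g = "\<lambda>(i, j). ins_sign i K * ins_sign j (K - {i}) * (x $ i * x $ j) * w $ (K - {i} - {j})"
  have "wedge_vec x (wedge_vec x w) $ K = (\<Sum>i\<in>K. \<Sum>j\<in>K - {i}. ?g (i, j))"
    by (simp add: wedge_vec_nth sum_distrib_left mult_ac)
  also have "\<dots> = (\<Sum>p\<in>?S. ?g p)" by (subst sum.Sigma) auto
  finally have eq: "wedge_vec x (wedge_vec x w) $ K = (\<Sum>p\<in>?S. ?g p)" .
  have "(\<Sum>p\<in>?S. ?g p) = (\<Sum>p\<in>?S. ?g (prod.swap p))"
    by (rule sum.reindex_bij_witness[of _ prod.swap prod.swap]) auto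
  also have "\<dots> = (\<Sum>p\<in>?S. - ?g p)"
  proof (rule sum.cong[OF refl])
    fix p assume p: "p \<in> ?S"
    obtain i j where ij: "p = (i, j)" by (cases p)
    have e: "K - {j} - {i} = K - {i} - {j}" by auto
    have "ins_sign j K * ins_sign i (K - {j}) = - (ins_sign i K * ins_sign j (K - {i}))"
      using ins_sign_swap[of i K j] p unfolding ij by auto
    then show "?g (prod.swap p) = - ?g p"
      unfolding ij prod.swap_def prod.case fst_conv snd_conv e by (simp add: mult.commute[of "x $ j"])
  qed
  also have "\<dots> = - (\<Sum>p\<in>?S. ?g p)" by (simp add: sum_negf)
  finally show "wedge_vec x (wedge_vec x w) $ K = 0 $ K" unfolding eq by simp
qed

lemma wedge_vec_anticommute: "wedge_vec x (wedge_vec y w) = - wedge_vec y (wedge_vec x w)"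
proof -
  have "0 = wedge_vec (x + y) (wedge_vec (x + y) w)" by (simp add: wedge_vec_twice)
  also have "\<dots> = wedge_vec x (wedge_vec y w) + wedge_vec y (wedge_vec x w)"
    by (simp add: linear_add[OF linear_wedge_vec_left] linear_add[OF linear_wedge_vec_right]
        wedge_vec_twice)
  finally show ?thesis by (simp add: eq_neg_iff_add_eq_0)
qed

lemma norm_wedge_vec_le:
  fixes x :: "real^('m::{finite,linorder})"
  shows "norm (wedge_vec x w) \<le> real (CARD('m set) * CARD('m)) * norm x * norm w"
proof -
  have "\<bar>wedge_vec x w $ K\<bar> \<le> real CARD('m) * (norm x * norm w)" for K
  proof -
    have "\<bar>wedge_vec x w $ K\<bar> \<le> (\<Sum>i\<in>K. norm x * norm w)"
      unfolding wedge_vec_nth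
    proof (rule order_trans[OF sum_abs], rule sum_mono)
      fix i
      have "\<bar>ins_sign i K * x $ i * w $ (K - {i})\<bar> = \<bar>x $ i\<bar> * \<bar>w $ (K - {i})\<bar>"
        by (simp add: ins_sign_def abs_mult power_abs)
      also have "\<dots> \<le> norm x * norm w"
        using component_le_norm_cart[of x i] component_le_norm_cart[of w "K - {i}"]
        by (intro mult_mono) auto
      finally show "\<bar>ins_sign i K * x $ i * w $ (K - {i})\<bar> \<le> norm x * norm w" .
    qed
    also have "\<dots> \<le> real CARD('m) * (norm x * norm w)"
      using card_mono[of UNIV K] by (simp add: mult_right_mono)
    finally show ?thesis .
  qed
  then have "norm (wedge_vec x w) \<le> (\<Sum>K\<in>(UNIV :: 'm set set). real CARD('m) * (norm x * norm w))"
    by (intro order_trans[OF norm_le_l1_cart] sum_mono)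
  then show ?thesis by (simp add: mult.assoc)
qed

text \<open>The free last factor \<open>w\<close> allows a vector to be moved past a segment in the
  middle of a list.\<close>

definition wedge_onto :: "(real^('m::{finite,linorder})) list \<Rightarrow> 'm ext \<Rightarrow> 'm ext" where
  "wedge_onto vs w = foldr wedge_vec vs w"

lemma wedge_onto_simps [simp]:
  "wedge_onto [] w = w"
  "wedge_onto (v # vs) w = wedge_vec v (wedge_onto vs w)"
  "wedge_onto (us @ vs) w = wedge_onto us (wedge_onto vs w)"
  by (simp_all add: wedge_onto_def)

lemma wedge_list_eq: "wedge_list vs = wedge_onto vs (axis {} 1)"
  unfolding wedge_list_def wedge_onto_def
  by (rule arg_cong[where f = "\<lambda>f. foldr f vs _"]) (simp add: fun_eq_iff wedge_vec_def)

lemma wedge_list_Cons: "wedge_list (v # vs) = wedge_vec v (wedge_list vs)"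
  by (simp add: wedge_list_eq)

lemma linear_wedge_onto: "linear (wedge_onto vs)"
proof (induction vs)
  case (Cons v vs)
  have "linear (wedge_vec v \<circ> wedge_onto vs)"
    by (rule linear_compose[OF Cons linear_wedge_vec_right])
  then show ?case by (simp add: o_def wedge_onto_def)
qed (simp add: wedge_onto_def linear_iff)

lemma linear_wedge_slot: "linear (\<lambda>u. wedge_list (us @ u # vs))"
proof -
  have "linear (wedge_onto us \<circ> (\<lambda>u. wedge_vec u (wedge_list vs)))"
    by (rule linear_compose[OF linear_wedge_vec_left linear_wedge_onto])
  then show ?thesis by (simp add: o_def wedge_list_eq)
qed

lemma wedge_vec_onto: "wedge_vec x (wedge_onto vs w) = (-1) ^ length vs *\<^sub>R wedge_onto vs (wedge_vec x w)"
proof (induction vs)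
  case (Cons v vs)
  have "wedge_vec x (wedge_onto (v # vs) w) = - wedge_vec v (wedge_vec x (wedge_onto vs w))"
    by (simp add: wedge_vec_anticommute[of x v])
  then show ?case
    by (simp add: Cons linear_scale[OF linear_wedge_vec_right])
qed simp

lemma wedge_onto_zero [simp]: "wedge_onto vs 0 = 0"
  by (rule linear_0[OF linear_wedge_onto])

lemma wedge_onto_not_distinct:
  assumes "\<not> distinct vs"
  shows "wedge_onto vs w = 0"
proof -
  obtain xs ys zs y where vs: "vs = xs @ [y] @ ys @ [y] @ zs"
    using not_distinct_decomp[OF assms] by blast
  show ?thesis unfolding vs
    by (simp add: wedge_vec_onto[of y ys] wedge_vec_twice)
qed

lemma wedge_onto_perm:
  fixes us vs :: "'a list" and w :: "('m::{finite,linorder}) ext"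
  assumes "mset us = mset vs"
  shows "\<exists>s\<in>{1, -1}. \<forall>f. wedge_onto (map f us) w = s *\<^sub>R wedge_onto (map f vs) w"
  using assms
proof (induction vs arbitrary: us)
  case (Cons v vs)
  then have "v \<in> set us" by (metis list.set_intros(1) set_mset_mset)
  then obtain a b where us: "us = a @ v # b" by (metis split_list)
  then have "mset (a @ b) = mset vs" using Cons.prems by simp
  then obtain s where s: "s \<in> {1, -1 :: real}"
    "\<And>f :: 'a \<Rightarrow> (real, 'm) vec. wedge_onto (map f (a @ b)) w = s *\<^sub>R wedge_onto (map f vs) w"
    using Cons.IH by meson
  have "wedge_onto (map f us) w = ((-1) ^ length a * s) *\<^sub>R wedge_onto (map f (v # vs)) w"
    for f :: "'a \<Rightarrow> (real, 'm) vec"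
  proof -
    have "wedge_onto (map f us) w = (-1) ^ length a *\<^sub>R ((-1) ^ length a *\<^sub>R
        wedge_onto (map f a) (wedge_vec (f v) (wedge_onto (map f b) w)))"
      by (simp add: us power_mult_distrib[symmetric])
    also have "\<dots> = (-1) ^ length a *\<^sub>R wedge_vec (f v) (wedge_onto (map f (a @ b)) w)"
      using wedge_vec_onto[of "f v" "map f a"] by simp
    finally show ?thesis
      unfolding s(2) by (simp add: linear_scale[OF linear_wedge_vec_right])
  qed
  moreover have "(-1) ^ length a * s \<in> {1, -1 :: real}"
    using s(1) by (cases "even (length a)") auto
  ultimately show ?case by blast
qed (auto intro!: bexI[of _ 1])

text \<open>Multilinear expansion: lists drawn from \<open>vs\<close> contribute a sign if they
  permute \<open>vs\<close> and zero if they repeat an entry. \<open>R\<close> is a subring, used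
  both for all reals and for the integers. The scalar is chosen before \<open>A\<close>, so the same
  determinant serves for a matrix and for the identity.\<close>

lemma wedge_list_combination_uniform:
  fixes us vs :: "(real^('m::{finite,linorder})) list"
  assumes R: "0 \<in> R" "1 \<in> R" "\<And>a b. a \<in> R \<Longrightarrow> b \<in> R \<Longrightarrow> a + b \<in> R" "\<And>a. a \<in> R \<Longrightarrow> - a \<in> R"
      "\<And>a b. a \<in> R \<Longrightarrow> b \<in> R \<Longrightarrow> a * b \<in> R"
    and len: "length us = length vs"
    and us: "\<And>u. u \<in> set us \<Longrightarrow> \<exists>c. (\<forall>k. c k \<in> R) \<and> u = (\<Sum>k<length vs. c k *\<^sub>R vs ! k)"
  shows "\<exists>k\<in>R. \<forall>A :: (real, 'm) vec \<Rightarrow> (real, 'm) vec. linear A \<longrightarrow>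
    wedge_list (map A us) = k *\<^sub>R wedge_list (map A vs)"
proof -
  define scales where "scales ws k \<longleftrightarrow> (\<forall>A :: (real, 'm) vec \<Rightarrow> (real, 'm) vec. linear A \<longrightarrow>
    wedge_list (map A ws) = k *\<^sub>R wedge_list (map A vs))" for ws k
  have sub: "\<exists>k\<in>R. scales ws k"
    if ws: "set ws \<subseteq> set vs" "length ws = length vs" for ws
  proof (cases "distinct ws")
    case True
    have "card (set ws) = length vs" using ws True distinct_card by metis
    then have "set ws = set vs" "distinct vs"
      using ws card_length[of vs] card_subset_eq[OF _ ws(1)] card_mono[OF _ ws(1)]
      by (auto intro!: card_distinct)
    then have "mset ws = mset vs" using True by (simp add: set_eq_iff_mset_eq_distinct)
    then obtain s where "s \<in> {1, -1 :: real}" "scales ws s"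
      using wedge_onto_perm unfolding wedge_list_eq scales_def by metis
    then show ?thesis using R by blast
  next
    case False
    then have "\<not> distinct (map A ws)" for A :: "(real, 'm) vec \<Rightarrow> (real, 'm) vec"
      by (simp add: distinct_map)
    then have "scales ws 0"
      by (simp add: wedge_list_eq wedge_onto_not_distinct scales_def)
    then show ?thesis using R by blast
  qed
  \<comment> \<open>\<open>ws\<close> holds the entries already replaced by members of
    \<open>vs\<close>; the vectors of \<open>us\<close> are expanded one at a time.\<close>
  have "\<exists>k\<in>R. scales (ws @ us) k"
    if "set ws \<subseteq> set vs" "length (ws @ us) = length vs"
      "\<And>u. u \<in> set us \<Longrightarrow> \<exists>c. (\<forall>k. c k \<in> R) \<and> u = (\<Sum>k<length vs. c k *\<^sub>R vs ! k)" for ws us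
    using that
  proof (induction us arbitrary: ws)
    case Nil
    then show ?case using sub[of ws] by simp
  next
    case (Cons u us)
    have "\<exists>c. (\<forall>k. c k \<in> R) \<and> u = (\<Sum>k<length vs. c k *\<^sub>R vs ! k)"
      using Cons.prems(3) by simp
    then obtain c where c: "\<And>k. c k \<in> R" "u = (\<Sum>k<length vs. c k *\<^sub>R vs ! k)" by blast
    have "\<exists>d\<in>R. scales (ws @ vs ! k # us) d" if "k < length vs" for k
      using Cons.IH[of "ws @ [vs ! k]"] Cons.prems that by auto
    then obtain d where d: "\<And>k. k < length vs \<Longrightarrow> d k \<in> R"
      "\<And>k. k < length vs \<Longrightarrow> scales (ws @ vs ! k # us) (d k)" by metis
    have "scales (ws @ u # us) (\<Sum>k<length vs. c k * d k)"
      unfolding scales_def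
    proof (intro allI impI)
      fix A :: "(real, 'm) vec \<Rightarrow> (real, 'm) vec" assume A: "linear A"
      have Au: "A u = (\<Sum>k<length vs. c k *\<^sub>R A (vs ! k))"
        unfolding c(2) by (simp add: linear_sum[OF A] linear_scale[OF A])
      have "wedge_list (map A (ws @ u # us)) = (\<Sum>k<length vs. c k *\<^sub>R wedge_list (map A (ws @ vs ! k # us)))"
        by (simp add: Au linear_sum[OF linear_wedge_slot] linear_scale[OF linear_wedge_slot])
      also have "\<dots> = (\<Sum>k<length vs. c k * d k) *\<^sub>R wedge_list (map A vs)"
        using d(2) A unfolding scales_def scaleR_sum_left by (intro sum.cong) auto
      finally show "wedge_list (map A (ws @ u # us)) = (\<Sum>k<length vs. c k * d k) *\<^sub>R wedge_list (map A vs)" .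
    qed
    moreover have "(\<Sum>k\<in>A. c k * d k) \<in> R" if "finite A" "A \<subseteq> {..<length vs}" for A
      using that by (induction A rule: finite_induct) (auto intro!: R c d)
    ultimately show ?case by blast
  qed
  from this[of "[]" us] show ?thesis using len us unfolding scales_def by simp
qed

lemma wedge_list_combination:
  fixes us vs :: "(real^('m::{finite,linorder})) list"
  assumes "0 \<in> R" "1 \<in> R" "\<And>a b. a \<in> R \<Longrightarrow> b \<in> R \<Longrightarrow> a + b \<in> R" "\<And>a. a \<in> R \<Longrightarrow> - a \<in> R"
      "\<And>a b. a \<in> R \<Longrightarrow> b \<in> R \<Longrightarrow> a * b \<in> R"
    and "length us = length vs"
    and "\<And>u. u \<in> set us \<Longrightarrow> \<exists>c. (\<forall>k. c k \<in> R) \<and> u = (\<Sum>k<length vs. c k *\<^sub>R vs ! k)"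
  shows "\<exists>k\<in>R. wedge_list us = k *\<^sub>R wedge_list vs"
  using wedge_list_combination_uniform[OF assms] linear_id by fastforce

lemma span_set_list:
  fixes vs :: "'a::euclidean_space list"
  assumes "distinct vs"
  shows "x \<in> span (set vs) \<longleftrightarrow> (\<exists>c. x = (\<Sum>k<length vs. c k *\<^sub>R vs ! k))"
proof
  assume "x \<in> span (set vs)"
  then obtain u where "x = (\<Sum>v\<in>set vs. u v *\<^sub>R v)" by (auto simp: span_finite)
  also have "\<dots> = (\<Sum>k<length vs. u (vs ! k) *\<^sub>R vs ! k)"
    by (rule sum.reindex_bij_betw[symmetric, OF bij_betw_nth]) (use assms in auto)
  finally show "\<exists>c. x = (\<Sum>k<length vs. c k *\<^sub>R vs ! k)"
    by (intro exI[of _ "\<lambda>k. u (vs ! k)"])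
next
  assume "\<exists>c. x = (\<Sum>k<length vs. c k *\<^sub>R vs ! k)"
  then obtain c where "x = (\<Sum>k<length vs. c k *\<^sub>R vs ! k)" by blast
  then show "x \<in> span (set vs)" by (auto intro!: span_sum span_scale[OF span_base])
qed

text \<open>If the wedge vanished, so would that of a basis with \<open>us\<close> as its tail, and
  hence that of the standard basis, which is a multiple of it. But the latter is the unit vector
  \<open>axis UNIV 1\<close>.\<close>

lemma wedge_list_nonzero:
  assumes "distinct us" "independent (set us)"
  shows "wedge_list us \<noteq> 0"
proof
  assume z: "wedge_list us = 0"
  obtain B where B: "set us \<subseteq> B" "independent B" "UNIV \<subseteq> span B"
    by (rule maximal_independent_subset_extend[OF subset_UNIV assms(2)]) blast
  have spB: "span B = span UNIV" using B(3) by (simp add: top.extremum_unique)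
  have finB: "finite B" using independent_bound[OF B(2)] by blast
  have "card B = dim (UNIV :: (real, 'a) vec set)" by (rule dim_eq_card[OF spB B(2), symmetric])
  then have cardB: "card B = CARD('a)" by (simp add: dim_UNIV)
  obtain rest where rest: "set rest = B - set us" "distinct rest"
    using finite_distinct_list[of "B - set us"] finB by auto
  define bs where "bs = rest @ us"
  have bs: "distinct bs" "set bs = B" using rest assms(1) B(1) by (auto simp: bs_def)
  define js where "js = sorted_list_of_set (UNIV :: 'a set)"
  have js: "sorted_wrt (<) js" "set js = UNIV" "length js = CARD('a)"
    by (auto simp: js_def)
  have "\<exists>k\<in>UNIV. wedge_list (map (\<lambda>j. axis j 1) js) = k *\<^sub>R wedge_list bs"
  proof (rule wedge_list_combination)
    show "length (map (\<lambda>j. axis j (1::real)) js) = length bs"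
      using bs cardB js distinct_card[OF bs(1)] by simp
    show "\<exists>c. (\<forall>k. c k \<in> UNIV) \<and> u = (\<Sum>k<length bs. c k *\<^sub>R bs ! k)" for u
      using span_set_list[OF bs(1), of u] bs(2) spB by simp
  qed auto
  moreover have "wedge_list bs = 0" using z by (simp add: bs_def wedge_list_eq)
  ultimately have "axis UNIV (1::real) = (0 :: 'a ext)"
    using wedge_list_standard_basis[OF js(1)] js(2) by simp
  then show False by (simp add: axis_eq_0_iff)
qed

lemma wedge_list_zero_slot:
  assumes "distinct vs" "k < length vs" "x \<in> span (set vs - {vs ! k})"
  shows "wedge_list (take k vs @ x # drop (Suc k) vs) = 0"
proof (rule linear_eq_0_on_span[OF linear_wedge_slot _ assms(3)])
  fix u assume u: "u \<in> set vs - {vs ! k}"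
  have "set vs = set (take k vs) \<union> {vs ! k} \<union> set (drop (Suc k) vs)"
    using arg_cong[OF id_take_nth_drop[OF assms(2)], of set] by simp
  then have "\<not> distinct (take k vs @ u # drop (Suc k) vs)" using u by auto
  then show "wedge_list (take k vs @ u # drop (Suc k) vs) = 0"
    unfolding wedge_list_eq by (rule wedge_onto_not_distinct)
qed

lemma wedge_list_nonzero_imp:
  assumes "wedge_list vs \<noteq> 0"
  shows "distinct vs \<and> independent (set vs)"
proof
  show d: "distinct vs"
    using assms wedge_onto_not_distinct unfolding wedge_list_eq by blast
  show "independent (set vs)"
  proof
    assume "dependent (set vs)"
    then obtain a where a: "a \<in> set vs" "a \<in> span (set vs - {a})" by (auto simp: dependent_def)
    then obtain k where k: "k < length vs" "a = vs ! k" by (metis in_set_conv_nth)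
    then show False
      using wedge_list_zero_slot[OF d k(1), of a] a id_take_nth_drop[OF k(1), symmetric] assms by simp
  qed
qed

section \<open>Integer vectors, primitive bases and minimal covolume\<close>

lemma int_span_subset_span: "int_span vs \<subseteq> span (set vs)"
  by (auto simp: int_span_def intro!: span_sum span_scale[OF span_base])

lemma int_lattice_diff: "x \<in> int_lattice \<Longrightarrow> y \<in> int_lattice \<Longrightarrow> x - y \<in> int_lattice"
  by (auto simp: int_lattice_def)

lemma int_span_subset_int_lattice:
  assumes "set vs \<subseteq> int_lattice"
  shows "int_span vs \<subseteq> int_lattice"
  using assms by (force simp: int_span_def int_lattice_def sum_component intro!: Ints_sum Ints_mult)

lemma wedge_list_integral:
  assumes "set vs \<subseteq> int_lattice"
  shows "wedge_list vs $ K \<in> \<int>"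
  using assms
proof (induction vs arbitrary: K)
  case (Cons v vs)
  then show ?case
    by (auto simp: wedge_list_Cons wedge_vec_nth ins_sign_def int_lattice_def
        intro!: Ints_sum Ints_mult Ints_power)
qed (auto simp: wedge_list_eq axis_def)

lemma norm_wedge_list_sq_integral:
  assumes "set vs \<subseteq> int_lattice"
  shows "(norm (wedge_list vs))\<^sup>2 \<in> \<nat>"
proof -
  have "(norm (wedge_list vs))\<^sup>2 = (\<Sum>K\<in>UNIV. wedge_list vs $ K * wedge_list vs $ K)"
    by (simp add: power2_norm_eq_inner inner_vec_def)
  also have "\<dots> \<in> \<int>" using wedge_list_integral[OF assms] by (intro Ints_sum Ints_mult)
  finally show ?thesis by (simp add: Nats_altdef2)
qed

text \<open>Among independent integer lists in the span, one minimises the squared norm of the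
  wedge, a natural number. If it were not primitive, some integer point would have a fractional
  coordinate; its fractional part \<open>y\<close>, put in place of that basis vector, multiplies
  the wedge by a number strictly between 0 and 1.\<close>

lemma primitive_basis_exists:
  fixes us :: "(real^('m::{finite,linorder})) list"
  assumes us: "set us \<subseteq> int_lattice" "distinct us" "independent (set us)"
  obtains vs where "primitive vs" "length vs = length us" "span (set vs) = span (set us)"
proof -
  define cand where "cand vs \<longleftrightarrow> set vs \<subseteq> int_lattice \<inter> span (set us) \<and> wedge_list vs \<noteq> 0
      \<and> length vs = length us" for vs :: "(real, 'm) vec list"
  define N where "N vs = nat \<lfloor>(norm (wedge_list vs))\<^sup>2\<rfloor>" for vs :: "(real, 'm) vec list"
  have "cand us" using us wedge_list_nonzero[OF us(2,3)] by (auto simp: cand_def span_base)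
  then obtain vs where vs: "cand vs" "\<And>ws. cand ws \<Longrightarrow> N vs \<le> N ws"
    using ex_has_least_nat[of cand us N] by blast
  have N: "real (N ws) = (norm (wedge_list ws))\<^sup>2" if "cand ws" for ws
  proof -
    have "(norm (wedge_list ws))\<^sup>2 \<in> \<nat>"
      using that by (intro norm_wedge_list_sq_integral) (auto simp: cand_def)
    then obtain n where "(norm (wedge_list ws))\<^sup>2 = real n" by (rule Nats_cases)
    then show ?thesis unfolding N_def by simp
  qed
  have v: "distinct vs" "independent (set vs)" "set vs \<subseteq> int_lattice" "set vs \<subseteq> span (set us)"
      "length vs = length us"
    using vs(1) wedge_list_nonzero_imp[of vs] by (auto simp: cand_def)
  have "card (set vs) = card (set us)" using v us distinct_card by metis
  then have cards: "card (set vs) = card (set us)" .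
  have sp: "span (set vs) = span (set us)"
  proof
    show "span (set vs) \<subseteq> span (set us)"
      by (rule span_minimal[OF v(4) subspace_span])
    have "dim (span (set us)) \<le> card (set vs)"
      using us(3) cards by (simp add: dim_span dim_eq_card_independent)
    then show "span (set us) \<subseteq> span (set vs)"
      by (rule card_ge_dim_independent[OF v(4,2)])
  qed
  have "x \<in> int_span vs" if x: "x \<in> int_lattice" "x \<in> span (set vs)" for x
  proof -
    obtain c where c: "x = (\<Sum>k<length vs. c k *\<^sub>R vs ! k)"
      using x(2) span_set_list[OF v(1)] by blast
    define y where "y = (\<Sum>k<length vs. frac (c k) *\<^sub>R vs ! k)"
    have fl: "(\<Sum>k<length vs. of_int \<lfloor>c k\<rfloor> *\<^sub>R vs ! k) \<in> int_span vs"
      unfolding int_span_def by (intro CollectI exI[of _ "\<lambda>k. \<lfloor>c k\<rfloor>"]) simp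
    then have "(\<Sum>k<length vs. of_int \<lfloor>c k\<rfloor> *\<^sub>R vs ! k) \<in> int_lattice"
      using int_span_subset_int_lattice[OF v(3)] by blast
    moreover have y_eq: "y = x - (\<Sum>k<length vs. of_int \<lfloor>c k\<rfloor> *\<^sub>R vs ! k)"
      by (simp add: y_def c frac_def scaleR_diff_left sum_subtractf)
    ultimately have y: "y \<in> int_lattice" using x(1) by (simp add: int_lattice_diff)
    have ysp: "y \<in> span (set us)"
      unfolding y_def sp[symmetric] by (intro span_sum span_scale[OF span_base]) auto
    have "frac (c k) = 0" if k: "k < length vs" for k
    proof (rule ccontr)
      assume nz: "frac (c k) \<noteq> 0"
      define ws where "ws = take k vs @ y # drop (Suc k) vs"
      define rest where "rest = (\<Sum>j\<in>{..<length vs} - {k}. frac (c j) *\<^sub>R vs ! j)"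
      have "y = frac (c k) *\<^sub>R vs ! k + rest"
        unfolding y_def rest_def using k by (subst sum.remove[of _ k]) auto
      moreover have "rest \<in> span (set vs - {vs ! k})"
        unfolding rest_def using v(1) k
        by (intro span_sum span_scale[OF span_base]) (auto simp: nth_eq_iff_index_eq)
      ultimately have "wedge_list ws = frac (c k) *\<^sub>R wedge_list (take k vs @ vs ! k # drop (Suc k) vs)"
        using wedge_list_zero_slot[OF v(1) k]
        by (simp add: ws_def linear_add[OF linear_wedge_slot] linear_scale[OF linear_wedge_slot])
      then have w: "wedge_list ws = frac (c k) *\<^sub>R wedge_list vs"
        using id_take_nth_drop[OF k, symmetric] by simp
      have "cand ws" unfolding cand_def
      proof (intro conjI)
        show "set ws \<subseteq> int_lattice \<inter> span (set us)"
          using y ysp v(3,4) set_take_subset[of k vs] set_drop_subset[of "Suc k" vs]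
          by (auto simp: ws_def)
        show "wedge_list ws \<noteq> 0" using w nz vs(1) by (simp add: cand_def)
        show "length ws = length us" using k v(5) by (simp add: ws_def)
      qed
      then have "(norm (wedge_list vs))\<^sup>2 \<le> (norm (wedge_list ws))\<^sup>2"
        using vs N[of ws] N[of vs] by (metis of_nat_le_iff)
      then have "norm (wedge_list vs) \<le> \<bar>frac (c k)\<bar> * norm (wedge_list vs)"
        using w by (simp add: power2_le_iff_abs_le)
      moreover have "norm (wedge_list vs) > 0" using vs(1) by (simp add: cand_def)
      moreover have "\<bar>frac (c k)\<bar> < 1" using frac_lt_1[of "c k"] frac_ge_0[of "c k"] by simp
      ultimately show False
        using mult_strict_right_mono[of "\<bar>frac (c k)\<bar>" 1 "norm (wedge_list vs)"] by simp
    qed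
    then have "y = 0" unfolding y_def by (intro sum.neutral) simp
    then show ?thesis using y_eq fl by simp
  qed
  then have "int_span vs = int_lattice \<inter> span (set vs)"
    using int_span_subset_int_lattice[OF v(3)] int_span_subset_span[of vs] by blast
  then have "primitive vs" using v by (simp add: primitive_def)
  then show ?thesis using that v sp by blast
qed

text \<open>The two wedges differ by a non-zero integer, up to sign the index of one lattice in the
  other, and applying \<open>A\<close> keeps this factor.\<close>

lemma primitive_minimal_norm:
  fixes A :: "real^('m::{finite,linorder}) \<Rightarrow> real^('m::{finite,linorder})"
  assumes vs: "primitive vs" and us: "set us \<subseteq> int_lattice \<inter> span (set vs)" "distinct us"
      "independent (set us)" "length us = length vs"
    and A: "linear A" "inj A"
  shows "norm (wedge_list (map A vs)) \<le> norm (wedge_list (map A us))"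
proof -
  have "\<exists>k\<in>\<int>. wedge_list (map A us) = k *\<^sub>R wedge_list (map A vs)"
  proof (rule wedge_list_combination)
    fix u assume "u \<in> set (map A us)"
    then obtain u' where u': "u' \<in> set us" "u = A u'" by auto
    then have "u' \<in> int_span vs" using vs us(1) by (auto simp: primitive_def)
    then obtain c where "u' = (\<Sum>k<length vs. of_int (c k) *\<^sub>R vs ! k)"
      by (auto simp: int_span_def)
    then have "u = (\<Sum>k<length (map A vs). of_int (c k) *\<^sub>R map A vs ! k)"
      using u'(2) by (simp add: linear_sum[OF A(1)] linear_scale[OF A(1)])
    then show "\<exists>c. (\<forall>k. c k \<in> \<int>) \<and> u = (\<Sum>k<length (map A vs). c k *\<^sub>R map A vs ! k)"
      by (intro exI[of _ "\<lambda>k. of_int (c k)"]) auto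
  qed (use us in auto)
  then obtain k where k: "k \<in> \<int>" "wedge_list (map A us) = k *\<^sub>R wedge_list (map A vs)" by blast
  have "wedge_list (map A us) \<noteq> 0"
    using us A by (intro wedge_list_nonzero)
      (auto simp: distinct_map inj_on_subset[OF A(2)] linear_independent_injective_image
        intro: inj_on_subset)
  then have "k \<noteq> 0" using k(2) by auto
  then have "\<bar>k\<bar> \<ge> 1" using k(1) Ints_nonzero_abs_ge1 by blast
  then show ?thesis unfolding k(2) by (simp add: mult_le_cancel_right1)
qed

section \<open>Power series and iterated derivatives\<close>

lemma has_sum_diff_real:
  fixes f g :: "'a \<Rightarrow> real"
  assumes "(f has_sum a) A" "(g has_sum b) A"
  shows "((\<lambda>k. f k - g k) has_sum (a - b)) A"
  using has_sum_add[OF assms(1) has_sum_uminusI[OF assms(2)]] by simp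

lemma has_sum_finite_sum:
  fixes f :: "'i \<Rightarrow> 'a \<Rightarrow> real"
  assumes "finite I" "\<And>i. i \<in> I \<Longrightarrow> (f i has_sum s i) A"
  shows "((\<lambda>k. \<Sum>i\<in>I. f i k) has_sum (\<Sum>i\<in>I. s i)) A"
  using assms by (induction I rule: finite_induct) (auto intro!: has_sum_add)

definition mdeg :: "('d::finite \<Rightarrow> nat) \<Rightarrow> nat" where
  "mdeg k = (\<Sum>i\<in>UNIV. k i)"

definition mon :: "('d::finite \<Rightarrow> nat) \<Rightarrow> real^'d \<Rightarrow> real" where
  "mon k x = (\<Prod>i\<in>UNIV. (x $ i) ^ k i)"

lemma abs_mon_le:
  assumes "norm x \<le> T"
  shows "\<bar>mon k x\<bar> \<le> T ^ mdeg k"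
proof -
  have "\<bar>mon k x\<bar> = (\<Prod>i\<in>UNIV. \<bar>x $ i\<bar> ^ k i)"
    by (simp add: mon_def abs_prod power_abs)
  also have "\<dots> \<le> (\<Prod>i\<in>UNIV. T ^ k i)"
    using component_le_norm_cart[of x] assms
    by (intro prod_mono conjI power_mono order_trans[OF component_le_norm_cart assms]) auto
  finally show ?thesis by (simp add: mdeg_def power_sum)
qed

text \<open>Besides convergence to \<open>f\<close>, absolute summability with
  \<open>T ^ mdeg k\<close> is recorded for all smaller radii; differentiation term by term and
  products rest on it.\<close>

definition pow_series :: "real^'d \<Rightarrow> real \<Rightarrow> (('d::finite \<Rightarrow> nat) \<Rightarrow> real) \<Rightarrow> (real^'d \<Rightarrow> real) \<Rightarrow> bool" where
  "pow_series a R c f \<longleftrightarrow> (\<forall>T. 0 < T \<and> T < R \<longrightarrow> (\<lambda>k. \<bar>c k\<bar> * T ^ mdeg k) summable_on UNIV) \<and>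
     (\<forall>x\<in>ball a R. ((\<lambda>k. c k * mon k (x - a)) has_sum f x) UNIV)"

lemma pow_series_summable:
  assumes "pow_series a R c f" "0 < T" "T < R"
  shows "(\<lambda>k. \<bar>c k\<bar> * T ^ mdeg k) summable_on UNIV"
  using assms unfolding pow_series_def by blast

lemma pow_series_mono:
  assumes "pow_series a R c f" "R' \<le> R"
  shows "pow_series a R' c f"
  using assms unfolding pow_series_def by (auto intro: less_le_trans)

lemma real_analytic_pow_series:
  fixes f :: "real^'d \<Rightarrow> real"
  assumes "real_analytic_on f U" "a \<in> U"
  obtains R c where "R > 0" "pow_series a R c f"
proof -
  obtain r c where r: "r > 0" and c: "\<And>x. x \<in> ball a r \<Longrightarrow>
      ((\<lambda>k. c k * (\<Prod>i\<in>UNIV. (x$i - a$i) ^ k i)) has_sum f x) UNIV"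
    using assms unfolding real_analytic_on_def by blast
  define d where "d = real CARD('d)"
  have d: "d \<ge> 1" by (simp add: d_def Suc_le_eq)
  have "(\<lambda>k. \<bar>c k\<bar> * T ^ mdeg k) summable_on UNIV" if T: "0 < T" "T < r / d" for T
  proof -
    \<comment> \<open>At this diagonal point every monomial equals \<open>T ^ mdeg k\<close>, so
      convergence there, which is automatically absolute, bounds all coefficients. Its distance from
      \<open>a\<close> is at most \<open>d * T\<close>, hence the radius
      \<open>r / d\<close>.\<close>
    define x where "x = a + (\<chi> i. T)"
    have "norm (\<chi> i::'d. T) \<le> d * T"
      using norm_le_l1_cart[of "(\<chi> i. T) :: real^'d"] T by (simp add: d_def)
    also have "\<dots> < r" using T d by (simp add: field_simps)
    finally have "x \<in> ball a r" by (simp add: x_def dist_norm)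
    from c[OF this] have "(\<lambda>k. c k * T ^ mdeg k) summable_on UNIV"
      by (auto simp: x_def mdeg_def power_sum summable_on_def)
    then have "(\<lambda>k. norm (c k * T ^ mdeg k)) summable_on UNIV"
      by (rule summable_on_iff_abs_summable_on_real[THEN iffD1])
    then show ?thesis using T by (simp add: abs_mult)
  qed
  moreover have "((\<lambda>k. c k * mon k (x - a)) has_sum f x) UNIV" if "x \<in> ball a (r / d)" for x
  proof -
    have "r / d \<le> r / 1" using r d by (intro divide_left_mono) auto
    then show ?thesis using c[of x] that by (simp add: mon_def)
  qed
  ultimately have "pow_series a (r / d) c f" by (auto simp: pow_series_def)
  then show ?thesis using that r d by (metis divide_pos_pos less_le_trans zero_less_one)
qed

lemma pow_series_const:
  "pow_series a R (\<lambda>k. if k = (\<lambda>_. 0) then v else 0) (\<lambda>_. v)"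
  unfolding pow_series_def
proof (intro conjI allI impI ballI)
  fix T :: real
  show "(\<lambda>k. \<bar>if k = (\<lambda>_. 0) then v else 0\<bar> * T ^ mdeg k) summable_on UNIV"
    by (rule has_sum_imp_summable, rule has_sum_finite_neutralI[of "{\<lambda>_. 0}"]) auto
next
  fix x
  show "((\<lambda>k. (if k = (\<lambda>_. 0) then v else 0) * mon k (x - a)) has_sum v) UNIV"
    by (rule has_sum_finite_neutralI[of "{\<lambda>_. 0}"]) (auto simp: mon_def)
qed

text \<open>The coefficients of the Cauchy product in several variables.\<close>

definition mconv :: "(('d::finite \<Rightarrow> nat) \<Rightarrow> real) \<Rightarrow> (('d \<Rightarrow> nat) \<Rightarrow> real) \<Rightarrow> ('d \<Rightarrow> nat) \<Rightarrow> real" where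
  "mconv u v n = (\<Sum>k\<in>{..n}. u k * v (\<lambda>i. n i - k i))"

lemma finite_le_fun: "finite {..(n :: 'd::finite \<Rightarrow> nat)}"
proof -
  have "{..n} = PiE UNIV (\<lambda>i. {..n i})" by (auto simp: le_fun_def PiE_UNIV_domain Pi_iff)
  then show ?thesis by (simp add: finite_PiE)
qed

lemma mconv_has_sum:
  fixes u v :: "('d::finite \<Rightarrow> nat) \<Rightarrow> real"
  assumes u: "u summable_on UNIV" and v: "v summable_on UNIV"
  shows "(mconv u v has_sum (infsum u UNIV * infsum v UNIV)) UNIV"
proof -
  have abs: "(\<lambda>k. \<bar>u k\<bar>) summable_on UNIV" "(\<lambda>k. \<bar>v k\<bar>) summable_on UNIV"
    using u[THEN summable_on_iff_abs_summable_on_real[THEN iffD1]]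
      v[THEN summable_on_iff_abs_summable_on_real[THEN iffD1]] by simp_all
  have "(\<lambda>(k, l). \<bar>u k\<bar> * \<bar>v l\<bar>) summable_on (SIGMA k:UNIV. UNIV)"
    using abs by (intro summable_on_SigmaI[where g = "\<lambda>k. \<bar>u k\<bar> * infsum (\<lambda>l. \<bar>v l\<bar>) UNIV"])
      (auto intro!: has_sum_cmult_right summable_on_cmult_left)
  then have "(\<lambda>p. norm (case p of (k, l) \<Rightarrow> u k * v l)) summable_on (SIGMA k:UNIV. UNIV)"
    by (simp add: case_prod_unfold abs_mult)
  then have "(\<lambda>(k, l). u k * v l) summable_on (SIGMA k:UNIV. UNIV)"
    by (rule summable_on_iff_abs_summable_on_real[THEN iffD2])
  then have *: "((\<lambda>(k, l). u k * v l) has_sum (infsum u UNIV * infsum v UNIV)) (SIGMA k:UNIV. UNIV)"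
    using u v by (intro has_sum_SigmaI[where g = "\<lambda>k. u k * infsum v UNIV"])
      (auto intro!: has_sum_cmult_right has_sum_cmult_left)
  \<comment> \<open>A pair \<open>(k, l)\<close> is regrouped by its sum, so that the inner index
    set becomes finite.\<close>
  have bij: "bij_betw (\<lambda>(n, k). (k, \<lambda>i. n i - k i)) (SIGMA n:UNIV. {..n :: 'd \<Rightarrow> nat}) (SIGMA k:UNIV. UNIV)"
    by (rule bij_betw_byWitness[where f' = "\<lambda>(k, l). (\<lambda>i. k i + l i, k :: 'd \<Rightarrow> nat)"])
      (auto simp: le_fun_def fun_eq_iff)
  have "((\<lambda>(n, k). u k * v (\<lambda>i. n i - k i)) has_sum (infsum u UNIV * infsum v UNIV)) (SIGMA n:UNIV. {..n})"
    using has_sum_reindex_bij_betw[OF bij, of "\<lambda>(k, l). u k * v l"] * by (simp add: case_prod_unfold)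
  then show ?thesis
    by (rule has_sum_SigmaD) (auto simp: mconv_def finite_le_fun intro!: has_sum_finiteI)
qed

lemma mdeg_diff: "k \<le> n \<Longrightarrow> mdeg n = mdeg k + mdeg (\<lambda>i. n i - k i)"
  by (auto simp: mdeg_def sum.distrib[symmetric] le_fun_def intro!: sum.cong)

lemma mon_diff: "k \<le> n \<Longrightarrow> mon n x = mon k x * mon (\<lambda>i. n i - k i) x"
  by (auto simp: mon_def prod.distrib[symmetric] power_add[symmetric] le_fun_def intro!: prod.cong)

lemma pow_series_mult:
  assumes f: "pow_series a R c f" and g: "pow_series a R c' g"
  shows "pow_series a R (mconv c c') (\<lambda>x. f x * g x)"
  unfolding pow_series_def
proof (intro conjI allI impI ballI)
  fix T assume T: "0 < T \<and> T < R"
  have "mconv (\<lambda>k. \<bar>c k\<bar> * T ^ mdeg k) (\<lambda>k. \<bar>c' k\<bar> * T ^ mdeg k) summable_on UNIV"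
    using T f g by (intro has_sum_imp_summable[OF mconv_has_sum]) (auto simp: pow_series_def)
  then show "(\<lambda>k. \<bar>mconv c c' k\<bar> * T ^ mdeg k) summable_on UNIV"
  proof (rule summable_on_comparison_test)
    fix n
    have "\<bar>mconv c c' n\<bar> * T ^ mdeg n \<le> (\<Sum>k\<in>{..n}. \<bar>c k\<bar> * \<bar>c' (\<lambda>i. n i - k i)\<bar>) * T ^ mdeg n"
      unfolding mconv_def using T
      by (intro mult_right_mono order_trans[OF sum_abs]) (auto simp: abs_mult)
    also have "\<dots> = mconv (\<lambda>k. \<bar>c k\<bar> * T ^ mdeg k) (\<lambda>k. \<bar>c' k\<bar> * T ^ mdeg k) n"
      by (auto simp: mconv_def sum_distrib_right mdeg_diff power_add intro!: sum.cong)
    finally show "\<bar>mconv c c' n\<bar> * T ^ mdeg n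
        \<le> mconv (\<lambda>k. \<bar>c k\<bar> * T ^ mdeg k) (\<lambda>k. \<bar>c' k\<bar> * T ^ mdeg k) n" .
  qed (use T in auto)
next
  fix x assume x: "x \<in> ball a R"
  have s: "((\<lambda>k. c k * mon k (x - a)) has_sum f x) UNIV" "((\<lambda>k. c' k * mon k (x - a)) has_sum g x) UNIV"
    using f g x by (auto simp: pow_series_def)
  have "(mconv (\<lambda>k. c k * mon k (x - a)) (\<lambda>k. c' k * mon k (x - a)) has_sum (f x * g x)) UNIV"
    using mconv_has_sum[OF has_sum_imp_summable[OF s(1)] has_sum_imp_summable[OF s(2)]]
    by (simp add: infsumI[OF s(1)] infsumI[OF s(2)])
  moreover have "mconv (\<lambda>k. c k * mon k (x - a)) (\<lambda>k. c' k * mon k (x - a))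
      = (\<lambda>n. mconv c c' n * mon n (x - a))"
    by (auto simp: fun_eq_iff mconv_def sum_distrib_right mon_diff intro!: sum.cong)
  ultimately show "((\<lambda>n. mconv c c' n * mon n (x - a)) has_sum (f x * g x)) UNIV" by simp
qed

lemma pow_series_prod:
  assumes "finite S" "\<And>s. s \<in> S \<Longrightarrow> \<exists>c. pow_series a R c (f s)"
  shows "\<exists>c. pow_series a R c (\<lambda>x. \<Prod>s\<in>S. f s x)"
  using assms
proof (induction S rule: finite_induct)
  case empty
  then show ?case using pow_series_const[of a R 1] by auto
next
  case (insert s S)
  then show ?case using pow_series_mult[of a R _ "f s" _ "\<lambda>x. \<Prod>s\<in>S. f s x"] by (simp, blast)
qed

text \<open>Iterated partial derivatives are indexed by words: \<open>i # w\<close> is the \<open>i\<close>-th partial derivative of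
  the one indexed by \<open>w\<close>, so that no symmetry of mixed derivatives is needed.\<close>

definition word_exp :: "'d::finite list \<Rightarrow> ('d \<Rightarrow> nat) \<Rightarrow> 'd \<Rightarrow> nat" where
  "word_exp w k = (\<lambda>j. k j - count_list w j)"

text \<open>The truncated subtraction in \<open>word_exp\<close> does no harm: once an exponent is
  used up, the next derivative in that direction contributes the factor 0.\<close>

primrec word_coeff :: "'d::finite list \<Rightarrow> ('d \<Rightarrow> nat) \<Rightarrow> real" where
  "word_coeff [] k = 1"
| "word_coeff (i # w) k = word_coeff w k * real (word_exp w k i)"

definition dmon :: "'d::finite list \<Rightarrow> ('d \<Rightarrow> nat) \<Rightarrow> real^'d \<Rightarrow> real" where
  "dmon w k x = word_coeff w k * mon (word_exp w k) x"

lemma mon_has_derivative: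
  "(mon k has_derivative (\<lambda>h. \<Sum>i\<in>UNIV. h $ i * (real (k i) * mon (k(i := k i - 1)) x))) (at x)"
proof -
  have "((\<lambda>x. \<Prod>i\<in>UNIV. (x $ i) ^ k i) has_derivative
      (\<lambda>h. \<Sum>i\<in>UNIV. (real (k i) * h $ i * (x $ i) ^ (k i - 1)) * (\<Prod>j\<in>UNIV - {i}. (x $ j) ^ k j))) (at x)"
    by (rule has_derivative_prod)
      (auto intro!: derivative_eq_intros bounded_linear_imp_has_derivative bounded_linear_vec_nth)
  moreover have "mon (k(i := k i - 1)) x = (x $ i) ^ (k i - 1) * (\<Prod>j\<in>UNIV - {i}. (x $ j) ^ k j)" for i
    unfolding mon_def by (subst prod.remove[of _ i]) (auto intro!: prod.cong)
  ultimately show ?thesis unfolding mon_def[abs_def] by (simp add: mult_ac)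
qed

lemma dmon_has_derivative:
  "(dmon w k has_derivative (\<lambda>h. \<Sum>i\<in>UNIV. h $ i * dmon (i # w) k x)) (at x)"
proof -
  have "(\<lambda>j. k j - count_list (i # w) j) = (word_exp w k)(i := word_exp w k i - 1)" for i
    by (auto simp: word_exp_def)
  then have e: "word_exp (i # w) k = (word_exp w k)(i := word_exp w k i - 1)" for i
    by (simp add: word_exp_def)
  have "((\<lambda>x. word_coeff w k * mon (word_exp w k) x) has_derivative
     (\<lambda>h. word_coeff w k * (\<Sum>i\<in>UNIV. h $ i * (real (word_exp w k i) *
        mon ((word_exp w k)(i := word_exp w k i - 1)) x)))) (at x)"
    by (rule has_derivative_mult_right[OF mon_has_derivative])
  then show ?thesis
    unfolding dmon_def[abs_def] e by (simp add: sum_distrib_left mult_ac)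
qed

lemma word_coeff_nonneg: "0 \<le> word_coeff w k"
  by (induction w) auto

lemma word_coeff_nonzero:
  assumes "word_coeff w k \<noteq> 0"
  shows "\<forall>j. count_list w j \<le> k j" "mdeg (word_exp w k) + length w = mdeg k"
proof -
  show *: "\<forall>j. count_list w j \<le> k j"
    using assms
  proof (induction w)
    case (Cons i w)
    then show ?case by (auto simp: word_exp_def Suc_le_eq)
  qed simp
  have "mdeg k = mdeg (count_list w) + mdeg (word_exp w k)"
    unfolding word_exp_def using * by (intro mdeg_diff) (auto simp: le_fun_def)
  moreover have "mdeg (count_list w) = length w" for w :: "'a list"
    unfolding mdeg_def by (rule sum_count_set) auto
  ultimately show "mdeg (word_exp w k) + length w = mdeg k" by simp
qed

lemma word_coeff_le: "word_coeff w k \<le> real (mdeg k) ^ length w"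
proof (induction w)
  case (Cons i w)
  have "word_exp w k i \<le> k i" by (simp add: word_exp_def)
  also have "k i \<le> mdeg k" unfolding mdeg_def by (rule member_le_sum) auto
  finally show ?case using Cons word_coeff_nonneg[of w k]
    by (simp add: mult_mono mult.commute[of "real (mdeg k)"])
qed simp

lemma abs_dmon_le:
  assumes "norm x \<le> T" "T > 0"
  shows "\<bar>dmon w k x\<bar> \<le> real (mdeg k) ^ length w * T ^ mdeg k / T ^ length w"
proof (cases "word_coeff w k = 0")
  case False
  have "\<bar>dmon w k x\<bar> = word_coeff w k * \<bar>mon (word_exp w k) x\<bar>"
    using word_coeff_nonneg[of w k] by (simp add: dmon_def abs_mult)
  also have "\<dots> \<le> real (mdeg k) ^ length w * T ^ mdeg (word_exp w k)"
    using word_coeff_le abs_mon_le[OF assms(1)] by (intro mult_mono) auto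
  also have "T ^ mdeg (word_exp w k) = T ^ mdeg k / T ^ length w"
    unfolding word_coeff_nonzero(2)[OF False, symmetric] using assms by (simp add: power_add)
  finally show ?thesis by simp
qed (use assms in \<open>simp add: dmon_def\<close>)

text \<open>A derivative at the centre sees exactly one monomial, so the derivatives there recover
  all coefficients.\<close>

lemma dmon_at_0: "dmon w k 0 \<noteq> 0 \<longleftrightarrow> k = count_list w"
proof
  assume "dmon w k 0 \<noteq> 0"
  then have nz: "word_coeff w k \<noteq> 0" "mon (word_exp w k) 0 \<noteq> 0" by (auto simp: dmon_def)
  then have "word_exp w k i = 0" for i
    by (auto simp: mon_def power_0_left prod_zero_iff split: if_splits)
  then show "k = count_list w" using word_coeff_nonzero(1)[OF nz(1)]
    by (auto simp: word_exp_def fun_eq_iff intro: antisym)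
next
  assume k: "k = count_list w"
  \<comment> \<open>The surplus \<open>m\<close> makes the induction work: removing the head of the
    word moves one unit from the word to \<open>m\<close>.\<close>
  have "word_coeff v (\<lambda>j. count_list v j + m j) \<noteq> 0" for v :: "'a list" and m
  proof (induction v arbitrary: m)
    case (Cons i v)
    have "(\<lambda>j. count_list (i # v) j + m j) = (\<lambda>j. count_list v j + (m(i := Suc (m i))) j)"
      by auto
    then show ?case using Cons[of "m(i := Suc (m i))"]
      by (simp add: word_exp_def del: count_list.simps fun_upd_apply) (simp add: word_exp_def)
  qed simp
  from this[of w "\<lambda>_. 0"] show "dmon w k 0 \<noteq> 0"
    by (simp add: k dmon_def word_exp_def mon_def)
qed

section \<open>Mean value estimates from bounded partial derivatives\<close>

lemma linear_form_bound:
  fixes g :: "'d::finite \<Rightarrow> real"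
  assumes "\<And>i. \<bar>g i\<bar> \<le> B"
  shows "\<bar>\<Sum>i\<in>UNIV. (h :: real^'d) $ i * g i\<bar> \<le> real CARD('d) * B * norm h"
proof -
  have "\<bar>\<Sum>i\<in>UNIV. h $ i * g i\<bar> \<le> (\<Sum>i\<in>(UNIV :: 'd set). norm h * B)"
    using component_le_norm_cart[of h] assms
    by (intro order_trans[OF sum_abs] sum_mono) (auto simp: abs_mult intro!: mult_mono)
  then show ?thesis by (simp add: mult_ac)
qed

lemma partials_lipschitz:
  fixes g :: "real^'d \<Rightarrow> real"
  assumes S: "convex S" and der: "\<And>x. x \<in> S \<Longrightarrow> (g has_derivative (\<lambda>h. \<Sum>i\<in>UNIV. h $ i * g' i x)) (at x)"
    and B: "\<And>i x. x \<in> S \<Longrightarrow> \<bar>g' i x\<bar> \<le> B" and xz: "x \<in> S" "z \<in> S"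
  shows "\<bar>g z - g x\<bar> \<le> real CARD('d) * B * norm (z - x)"
proof -
  have "norm (g z - g x) \<le> (real CARD('d) * B) * norm (z - x)"
  proof (rule differentiable_bound[OF S has_derivative_at_withinI[OF der]])
    fix x assume "x \<in> S"
    then show "onorm (\<lambda>h. \<Sum>i\<in>UNIV. h $ i * g' i x) \<le> real CARD('d) * B"
      using linear_form_bound[of "\<lambda>i. g' i x" B] B by (intro onorm_le) auto
  qed (use xz in auto)
  then show ?thesis by simp
qed

text \<open>The mean value inequality is used twice: for the partials \<open>g' i\<close>, and then
  for \<phi>, that is \<open>g\<close> minus its linear part at \<open>x\<close>. On the segment all
  points are within \<open>norm (z - x)\<close> of \<open>x\<close>, which makes the bound
  quadratic.\<close>

lemma partials_second_order:
  fixes g :: "real^'d \<Rightarrow> real"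
  assumes S: "convex S" and der: "\<And>x. x \<in> S \<Longrightarrow> (g has_derivative (\<lambda>h. \<Sum>i\<in>UNIV. h $ i * g' i x)) (at x)"
    and der': "\<And>i x. x \<in> S \<Longrightarrow> (g' i has_derivative (\<lambda>h. \<Sum>j\<in>UNIV. h $ j * g'' j i x)) (at x)"
    and B: "\<And>i j x. x \<in> S \<Longrightarrow> \<bar>g'' j i x\<bar> \<le> B" and xz: "x \<in> S" "z \<in> S"
  shows "\<bar>g z - g x - (\<Sum>i\<in>UNIV. (z - x) $ i * g' i x)\<bar> \<le> (real CARD('d))\<^sup>2 * B * (norm (z - x))\<^sup>2"
proof -
  let ?d = "real CARD('d)"
  let ?L = "closed_segment x z"
  have L: "?L \<subseteq> S" using S xz by (simp add: closed_segment_subset)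
  have B0: "0 \<le> B" using B[OF xz(1)] abs_ge_zero order_trans by blast
  define \<phi> where "\<phi> y = g y - (\<Sum>i\<in>UNIV. y $ i * g' i x)" for y
  have "norm (\<phi> z - \<phi> x) \<le> (?d * (?d * B * norm (z - x))) * norm (z - x)"
  proof (rule differentiable_bound[of ?L])
    fix y assume y: "y \<in> ?L"
    have "(\<phi> has_derivative (\<lambda>h. (\<Sum>i\<in>UNIV. h $ i * g' i y) - (\<Sum>i\<in>UNIV. h $ i * g' i x))) (at y)"
      unfolding \<phi>_def[abs_def] using y L
      by (auto intro!: derivative_eq_intros der bounded_linear_imp_has_derivative bounded_linear_vec_nth)
    then have "(\<phi> has_derivative (\<lambda>h. \<Sum>i\<in>UNIV. h $ i * (g' i y - g' i x))) (at y)"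
      by (simp add: sum_subtractf right_diff_distrib)
    then show "(\<phi> has_derivative (\<lambda>h. \<Sum>i\<in>UNIV. h $ i * (g' i y - g' i x))) (at y within ?L)"
      by (rule has_derivative_at_withinI)
    have "\<bar>g' i y - g' i x\<bar> \<le> ?d * B * norm (z - x)" for i
    proof -
      have "\<bar>g' i y - g' i x\<bar> \<le> ?d * B * norm (y - x)"
        using y L xz by (intro partials_lipschitz[OF S der' B]) auto
      also have "\<dots> \<le> ?d * B * norm (z - x)"
        using segment_bound(1)[OF y] B0 by (intro mult_left_mono) auto
      finally show ?thesis .
    qed
    then show "onorm (\<lambda>h. \<Sum>i\<in>UNIV. h $ i * (g' i y - g' i x)) \<le> ?d * (?d * B * norm (z - x))"
      using linear_form_bound[of "\<lambda>i. g' i y - g' i x" "?d * B * norm (z - x)"] by (intro onorm_le) auto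
  qed auto
  moreover have "\<phi> z - \<phi> x = g z - g x - (\<Sum>i\<in>UNIV. (z - x) $ i * g' i x)"
    by (simp add: \<phi>_def sum_subtractf left_diff_distrib)
  ultimately show ?thesis by (simp add: power2_eq_square mult_ac)
qed

section \<open>Differentiation of power series term by term\<close>

lemma power_times_geometric_bounded:
  fixes q :: real
  assumes "0 \<le> q" "q < 1"
  shows "\<exists>B. \<forall>n. real n ^ p * q ^ n \<le> B"
  using assms
proof (induction p arbitrary: q)
  case 0
  then show ?case by (intro exI[of _ 1]) (simp add: power_le_one)
next
  case (Suc p)
  \<comment> \<open>The square root splits the geometric decay between \<open>n ^ p\<close> and the
    additional factor \<open>n\<close>.\<close>
  define s where "s = sqrt q"
  have s: "0 \<le> s" "s < 1" "q = s * s" using Suc.prems by (auto simp: s_def)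
  obtain B where B: "\<And>n. real n ^ p * s ^ n \<le> B" using Suc.IH[OF s(1,2)] by blast
  have "Bseq (\<lambda>n. of_nat n * s ^ n)"
    using powser_times_n_limit_0[of s] s by (intro convergent_imp_Bseq) (auto simp: convergent_def)
  then obtain K where K: "\<And>n. norm (real n * s ^ n) \<le> K" using BseqD by blast
  have "real n ^ Suc p * q ^ n \<le> B * K" for n
  proof -
    have "real n ^ Suc p * q ^ n = (real n ^ p * s ^ n) * (real n * s ^ n)"
      by (simp add: s(3) power_mult_distrib)
    also have "\<dots> \<le> B * K"
      using B[of n] K[of n] s order_trans[OF _ B[of n], of 0] by (intro mult_mono) auto
    finally show ?thesis .
  qed
  then show ?case by blast
qed

lemma pow_series_poly_summable:
  fixes f :: "real^'d \<Rightarrow> real"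
  assumes f: "pow_series a R c f" and T: "0 < T" "T < R"
  shows "(\<lambda>k. \<bar>c k\<bar> * (real (mdeg k) ^ p * T ^ mdeg k)) summable_on UNIV"
proof -
  \<comment> \<open>At a radius strictly between \<open>T\<close> and \<open>R\<close>, the powers
    of \<open>T / T'\<close> absorb the polynomial factor.\<close>
  define T' where "T' = (T + R) / 2"
  have T': "0 < T'" "T < T'" "T' < R" using T by (auto simp: T'_def)
  obtain B where B: "\<And>n. real n ^ p * (T / T') ^ n \<le> B"
    using power_times_geometric_bounded[of "T / T'" p] T T' by auto
  have "(\<lambda>k. B * (\<bar>c k\<bar> * T' ^ mdeg k)) summable_on UNIV"
    by (intro summable_on_cmult_right pow_series_summable[OF f T'(1,3)])
  then show ?thesis
  proof (rule summable_on_comparison_test)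
    fix k :: "'d \<Rightarrow> nat"
    have "real (mdeg k) ^ p * T ^ mdeg k = (real (mdeg k) ^ p * (T / T') ^ mdeg k) * T' ^ mdeg k"
      using T' by (simp add: power_divide)
    also have "\<dots> \<le> B * T' ^ mdeg k" using B T' by (intro mult_right_mono) auto
    finally have "\<bar>c k\<bar> * (real (mdeg k) ^ p * T ^ mdeg k) \<le> \<bar>c k\<bar> * (B * T' ^ mdeg k)"
      by (rule mult_left_mono) simp
    then show "\<bar>c k\<bar> * (real (mdeg k) ^ p * T ^ mdeg k) \<le> B * (\<bar>c k\<bar> * T' ^ mdeg k)"
      by (simp only: mult.left_commute)
  qed (use T in auto)
qed

definition deriv_system :: "(real^'d) set \<Rightarrow> ('d::finite list \<Rightarrow> real^'d \<Rightarrow> real) \<Rightarrow> bool" where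
  "deriv_system V F \<longleftrightarrow> (\<forall>w. (\<exists>A. \<forall>x\<in>V. \<bar>F w x\<bar> \<le> A) \<and>
     (\<forall>x\<in>V. (F w has_derivative (\<lambda>h. \<Sum>i\<in>UNIV. h $ i * F (i # w) x)) (at x)))"

lemma second_order_has_derivative:
  fixes g :: "real^'d \<Rightarrow> real"
  assumes "open S" "x \<in> S"
    and "\<And>z. z \<in> S \<Longrightarrow> \<bar>g z - g x - (\<Sum>i\<in>UNIV. (z - x) $ i * g' i)\<bar> \<le> A * (norm (z - x))\<^sup>2"
  shows "(g has_derivative (\<lambda>h. \<Sum>i\<in>UNIV. h $ i * g' i)) (at x)"
  unfolding has_derivative_at_alt
proof (intro conjI allI impI)
  show "bounded_linear (\<lambda>h. \<Sum>i\<in>UNIV. h $ i * g' i)"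
    by (intro bounded_linear_sum bounded_linear_mult_const bounded_linear_vec_nth)
  fix e :: real assume e: "e > 0"
  obtain d where d: "d > 0" "ball x d \<subseteq> S" using assms(1,2) open_contains_ball by blast
  define d' where "d' = min d (e / (\<bar>A\<bar> + 1))"
  show "\<exists>d>0. \<forall>y. norm (y - x) < d \<longrightarrow>
      norm (g y - g x - (\<Sum>i\<in>UNIV. (y - x) $ i * g' i)) \<le> e * norm (y - x)"
  proof (intro exI[of _ d'] conjI allI impI)
    show "d' > 0" using d e by (simp add: d'_def)
    fix y assume y: "norm (y - x) < d'"
    then have "y \<in> S" using d by (auto simp: d'_def dist_norm norm_minus_commute)
    then have "norm (g y - g x - (\<Sum>i\<in>UNIV. (y - x) $ i * g' i)) \<le> A * (norm (y - x))\<^sup>2"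
      using assms(3) by simp
    also have "\<dots> \<le> (\<bar>A\<bar> + 1) * norm (y - x) * norm (y - x)"
      by (simp add: power2_eq_square mult_right_mono mult.assoc)
    also have "\<dots> \<le> e * norm (y - x)"
      using y by (intro mult_right_mono) (auto simp: d'_def field_simps)
    finally show "norm (g y - g x - (\<Sum>i\<in>UNIV. (y - x) $ i * g' i)) \<le> e * norm (y - x)" .
  qed
qed

text \<open>Each monomial has a quadratic Taylor remainder with an explicit constant. Summing these
  over all monomials yields a quadratic remainder for the series, which forces differentiability
  with the expected partials.\<close>

lemma pow_series_deriv_system:
  fixes f :: "real^'d \<Rightarrow> real"
  assumes f: "pow_series a R c f" and T: "0 < T" "T < R"
  obtains F where "deriv_system (ball a T) F" "\<And>x. x \<in> ball a T \<Longrightarrow> F [] x = f x"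
    "\<And>w. F w a = c (count_list w) * dmon w (count_list w) 0"
proof -
  define F where "F w x = (\<Sum>\<^sub>\<infinity>k. c k * dmon w k (x - a))" for w x
  let ?S = "\<lambda>p k. \<bar>c k\<bar> * (real (mdeg k) ^ p * T ^ mdeg k)"
  have S: "?S p summable_on UNIV" for p by (rule pow_series_poly_summable[OF f T])
  have bd: "norm (c k * dmon w k (x - a)) \<le> (1 / T ^ length w) * ?S (length w) k" if "x \<in> ball a T" for x w k
  proof -
    have "norm (x - a) \<le> T" using that by (simp add: dist_norm norm_minus_commute)
    from mult_left_mono[OF abs_dmon_le[OF this T(1), of w k], of "\<bar>c k\<bar>"] show ?thesis
      by (simp add: abs_mult)
  qed
  have sums: "(\<lambda>k. c k * dmon w k (x - a)) summable_on UNIV" if "x \<in> ball a T" for x w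
  proof -
    have "(\<lambda>k. norm (c k * dmon w k (x - a))) summable_on UNIV"
      by (rule Infinite_Sum.abs_summable_on_comparison_test'[OF summable_on_cmult_right[OF S] bd[OF that]])
    then show ?thesis by (rule summable_on_iff_abs_summable_on_real[THEN iffD2])
  qed
  have Fs: "((\<lambda>k. c k * dmon w k (x - a)) has_sum F w x) UNIV" if "x \<in> ball a T" for x w
    unfolding F_def using sums[OF that] by (rule has_sum_infsum)
  have "deriv_system (ball a T) F" unfolding deriv_system_def
  proof (intro allI conjI ballI)
    fix w
    show "\<exists>A. \<forall>x\<in>ball a T. \<bar>F w x\<bar> \<le> A"
    proof (intro exI ballI)
      fix x assume x: "x \<in> ball a T"
      have "norm (F w x) \<le> infsum (\<lambda>k. (1 / T ^ length w) * ?S (length w) k) UNIV"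
        by (rule norm_infsum_le[OF Fs[OF x] has_sum_infsum[OF summable_on_cmult_right[OF S]] bd[OF x]])
      then show "\<bar>F w x\<bar> \<le> infsum (\<lambda>k. (1 / T ^ length w) * ?S (length w) k) UNIV" by simp
    qed
    fix x assume x: "x \<in> ball a T"
    let ?d = "real CARD('d)"
    \<comment> \<open>The remainder of the derivative along \<open>w\<close> involves two further
      derivatives.\<close>
    let ?l = "length w + 2"
    define A where "A = infsum (\<lambda>k. ?d\<^sup>2 * (1 / T ^ ?l) * ?S ?l k) UNIV"
    show "(F w has_derivative (\<lambda>h. \<Sum>i\<in>UNIV. h $ i * F (i # w) x)) (at x)"
    proof (rule second_order_has_derivative[where A = A, OF open_ball x])
      fix z assume z: "z \<in> ball a T"
      have "((\<lambda>k. c k * dmon w k (z - a) - c k * dmon w k (x - a)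
           - (\<Sum>i\<in>UNIV. (z - x) $ i * (c k * dmon (i # w) k (x - a))))
         has_sum (F w z - F w x - (\<Sum>i\<in>UNIV. (z - x) $ i * F (i # w) x))) UNIV"
        by (intro has_sum_diff_real has_sum_finite_sum has_sum_cmult_right Fs x z finite)
      moreover have "((\<lambda>k. (norm (z - x))\<^sup>2 * (?d\<^sup>2 * (1 / T ^ ?l) * ?S ?l k)) has_sum ((norm (z - x))\<^sup>2 * A)) UNIV"
        unfolding A_def by (intro has_sum_cmult_right has_sum_infsum summable_on_cmult_right S)
      ultimately have "norm (F w z - F w x - (\<Sum>i\<in>UNIV. (z - x) $ i * F (i # w) x)) \<le> (norm (z - x))\<^sup>2 * A"
      proof (rule norm_infsum_le)
        fix k
        let ?y = "x - a" and ?u = "z - a"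
        have "\<bar>dmon w k ?u - dmon w k ?y - (\<Sum>i\<in>UNIV. (?u - ?y) $ i * dmon (i # w) k ?y)\<bar>
          \<le> ?d\<^sup>2 * (real (mdeg k) ^ ?l * T ^ mdeg k / T ^ ?l) * (norm (?u - ?y))\<^sup>2"
        proof (rule partials_second_order[of "ball 0 T" _ "\<lambda>i. dmon (i # w) k" "\<lambda>j i. dmon (j # i # w) k"])
          show "\<bar>dmon (j # i # w) k x\<bar> \<le> real (mdeg k) ^ ?l * T ^ mdeg k / T ^ ?l" if "x \<in> ball 0 T" for i j x
            using abs_dmon_le[of x T "j # i # w" k] that T by simp
        qed (use x z in \<open>auto simp: dist_norm norm_minus_commute intro: dmon_has_derivative\<close>)
        then have "\<bar>c k\<bar> * \<bar>dmon w k ?u - dmon w k ?y - (\<Sum>i\<in>UNIV. (?u - ?y) $ i * dmon (i # w) k ?y)\<bar>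
          \<le> \<bar>c k\<bar> * (?d\<^sup>2 * (real (mdeg k) ^ ?l * T ^ mdeg k / T ^ ?l) * (norm (?u - ?y))\<^sup>2)"
          by (rule mult_left_mono) simp
        moreover have "c k * dmon w k ?u - c k * dmon w k ?y - (\<Sum>i\<in>UNIV. (z - x) $ i * (c k * dmon (i # w) k ?y))
          = c k * (dmon w k ?u - dmon w k ?y - (\<Sum>i\<in>UNIV. (?u - ?y) $ i * dmon (i # w) k ?y))"
          by (simp add: right_diff_distrib sum_distrib_left mult_ac)
        ultimately show "norm (c k * dmon w k ?u - c k * dmon w k ?y
             - (\<Sum>i\<in>UNIV. (z - x) $ i * (c k * dmon (i # w) k ?y)))
           \<le> (norm (z - x))\<^sup>2 * (?d\<^sup>2 * (1 / T ^ ?l) * ?S ?l k)"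
          by (simp add: abs_mult mult_ac)
      qed
      then show "\<bar>F w z - F w x - (\<Sum>i\<in>UNIV. (z - x) $ i * F (i # w) x)\<bar> \<le> A * (norm (z - x))\<^sup>2"
        by (simp add: mult.commute)
    qed
  qed
  moreover have "F [] x = f x" if "x \<in> ball a T" for x
  proof -
    have "((\<lambda>k. c k * mon k (x - a)) has_sum f x) UNIV"
      using f that T by (auto simp: pow_series_def)
    moreover have "((\<lambda>k. c k * mon k (x - a)) has_sum F [] x) UNIV"
      using Fs[OF that, of "[]"] by (simp add: dmon_def word_exp_def)
    ultimately show ?thesis using has_sum_unique by blast
  qed
  moreover have "F w a = c (count_list w) * dmon w (count_list w) 0" for w
  proof -
    have "((\<lambda>k. c k * dmon w k (a - a)) has_sum (c (count_list w) * dmon w (count_list w) 0)) UNIV"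
      using dmon_at_0[of w] by (intro has_sum_finite_neutralI[of "{count_list w}"]) auto
    then show ?thesis using Fs[of a w] T has_sum_unique by fastforce
  qed
  ultimately show ?thesis by (rule that)
qed

lemma exists_word_count: "\<exists>w. count_list w = (k :: 'd::finite \<Rightarrow> nat)"
proof -
  obtain xs :: "'d list" where xs: "set xs = UNIV" "distinct xs"
    using finite_distinct_list[OF finite_class.finite_UNIV] by blast
  have "count_list (concat (map (\<lambda>i. replicate (k i) i) ys)) j = (if j \<in> set ys then k j else 0)"
    if "distinct ys" for ys j
    using that
  proof (induction ys)
    case (Cons y ys)
    have "count_list (replicate m i) j = (if i = j then m else 0)" for m and i :: 'd
      by (induction m) auto
    then show ?case using Cons by (auto simp: count_list_append)
  qed simp
  from this[OF xs(2)] have "count_list (concat (map (\<lambda>i. replicate (k i) i) xs)) = k"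
    using xs(1) by (simp add: fun_eq_iff)
  then show ?thesis by blast
qed

text \<open>Every multi-index is the letter count of some word, so vanishing derivatives at
  \<open>a\<close> annihilate all coefficients of the combination.\<close>

lemma pow_series_unique_continuation:
  fixes f :: "'n::finite \<Rightarrow> real^'d \<Rightarrow> real"
  assumes f: "\<And>s. pow_series a R (c s) (f s)"
    and z: "\<And>w. (\<Sum>s\<in>UNIV. b s * (c s (count_list w) * dmon w (count_list w) 0)) = 0"
    and x: "x \<in> ball a R"
  shows "(\<Sum>s\<in>UNIV. b s * f s x) = 0"
proof -
  have zero: "(\<Sum>s\<in>UNIV. b s * c s k) = 0" for k
  proof -
    obtain w where w: "count_list w = k" using exists_word_count by blast
    have "(\<Sum>s\<in>UNIV. b s * c s k) * dmon w k 0 = 0"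
      using z[of w] by (simp add: w sum_distrib_right mult.assoc)
    then show ?thesis using dmon_at_0[of w k] w by auto
  qed
  have "((\<lambda>k. \<Sum>s\<in>UNIV. b s * (c s k * mon k (x - a))) has_sum (\<Sum>s\<in>UNIV. b s * f s x)) UNIV"
    using f x by (intro has_sum_finite_sum has_sum_cmult_right) (auto simp: pow_series_def)
  moreover have "(\<lambda>k. \<Sum>s\<in>UNIV. b s * (c s k * mon k (x - a))) = (\<lambda>k. (\<Sum>s\<in>UNIV. b s * c s k) * mon k (x - a))"
    by (simp add: sum_distrib_right mult.assoc)
  ultimately have "((\<lambda>_. 0) has_sum (\<Sum>s\<in>UNIV. b s * f s x)) (UNIV :: ('d \<Rightarrow> nat) set)"
    by (simp add: zero)
  then show ?thesis using has_sum_0_simp has_sum_unique by blast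
qed

section \<open>Good functions for decaying measures\<close>

lemma infdist_hyperplane_le:
  fixes b :: "'a::euclidean_space"
  assumes "b \<noteq> 0"
  shows "infdist z {v. b \<bullet> v = b \<bullet> x} \<le> \<bar>b \<bullet> (z - x)\<bar> / norm b"
proof -
  define v where "v = z - ((b \<bullet> (z - x)) / (norm b)\<^sup>2) *\<^sub>R b"
  have "b \<bullet> v = b \<bullet> x"
    using assms by (simp add: v_def inner_diff_right dot_square_norm)
  then have "infdist z {v. b \<bullet> v = b \<bullet> x} \<le> dist z v" by (intro infdist_le) simp
  also have "\<dots> = \<bar>b \<bullet> (z - x)\<bar> / norm b"
    using assms by (simp add: v_def dist_norm power2_eq_square)
  finally show ?thesis .
qed

text \<open>Where \<open>g\<close> is small but its gradient is not, \<open>{|g| < \<theta>^4}\<close> lies, at scale \<open>r * \<theta>\<^sup>2\<close>, in a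
  neighbourhood of a hyperplane that is thinner than the scale by a factor of order \<open>\<theta>\<close>.\<close>

lemma small_value_large_gradient:
  fixes \<mu> :: "(real^'d) measure" and g :: "real^'d \<Rightarrow> real"
  assumes sets: "sets \<mu> = sets borel" and fed: "federer_on D \<mu> U" and D: "D > 0"
    and dec: "decaying_on C \<alpha> \<mu> U" and C: "C > 0" "\<alpha> > 0"
    and y: "y \<in> supp \<mu>" and r: "r > 0" and U: "ball y (3 * r) \<subseteq> U"
    and \<theta>: "0 < \<theta>" "\<theta> < 1" and K: "K \<ge> 0"
    and g: "\<And>x z. x \<in> ball y (2 * r) \<Longrightarrow> z \<in> ball y (2 * r) \<Longrightarrow>
      \<bar>g z - g x - (\<Sum>i\<in>UNIV. (z - x) $ i * (g' i x / r))\<bar> \<le> K * (norm (z - x) / r)\<^sup>2"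
  obtains E where "E \<in> sets \<mu>"
    "{x \<in> ball y r \<inter> supp \<mu>. \<bar>g x\<bar> < \<theta> ^ 4 \<and> (\<exists>i. \<theta> \<le> \<bar>g' i x\<bar>)} \<subseteq> E"
    "emeasure \<mu> E \<le> ennreal (C * ((3 + K) * \<theta>) powr \<alpha> * D ^ 4) * emeasure \<mu> (ball y r)"
proof -
  define Z where "Z = {x \<in> ball y r \<inter> supp \<mu>. \<bar>g x\<bar> < \<theta> ^ 4 \<and> (\<exists>i. \<theta> \<le> \<bar>g' i x\<bar>)}"
  \<comment> \<open>At this scale the Taylor remainder is at most \<open>K * \<theta> ^ 4\<close>,
    comparable to the values of \<open>g\<close> on \<open>Z\<close>.\<close>
  define t where "t = r * \<theta>\<^sup>2"
  have t: "0 < t" "t < r" using r \<theta> by (auto simp: t_def power_less_one_iff)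
  let ?q = "C * ((3 + K) * \<theta>) powr \<alpha>"
  define b where "b x = (\<chi> i. g' i x)" for x
  \<comment> \<open>Two values below \<open>\<theta> ^ 4\<close> and the remainder bound
    \<open>b x \<bullet> (z - x)\<close> by \<open>r * (2 + K) * \<theta> ^ 4\<close>. Division by a
    gradient of norm at least \<theta> gives the half-width, with 3 in place of 2 for strictness.
    Relative to \<open>t\<close> it is \<open>(3 + K) * \<theta>\<close>.\<close>
  define E where "E x = ball x t \<inter> {z. infdist z {v. b x \<bullet> v = b x \<bullet> x} < (3 + K) * \<theta> ^ 3 * r}" for x
  have EZ: "E x \<in> sets \<mu>" for x
  proof -
    have "open {z. infdist z {v. b x \<bullet> v = b x \<bullet> x} < (3 + K) * \<theta> ^ 3 * r}"
      by (intro open_Collect_less continuous_intros)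
    then show ?thesis unfolding E_def using sets by auto
  qed
  have bx: "\<theta> \<le> norm (b x)" if x: "x \<in> Z" for x
  proof -
    obtain i where "\<theta> \<le> \<bar>g' i x\<bar>" using x unfolding Z_def by blast
    then show ?thesis using component_le_norm_cart[of "b x" i] by (simp add: b_def)
  qed
  have sub: "Z \<inter> ball x t \<subseteq> E x" if x: "x \<in> Z" for x
  proof
    fix z assume z: "z \<in> Z \<inter> ball x t"
    have "b x \<noteq> 0" using bx[OF x] \<theta> by auto
    have xz: "x \<in> ball y (2 * r)" "z \<in> ball y (2 * r)" using x z r by (auto simp: Z_def)
    have gz: "\<bar>g z\<bar> < \<theta> ^ 4" "\<bar>g x\<bar> < \<theta> ^ 4" using x z by (auto simp: Z_def)
    have "norm (z - x) / r < \<theta>\<^sup>2"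
      using z r by (auto simp: t_def dist_norm norm_minus_commute field_simps)
    then have "(norm (z - x) / r)\<^sup>2 \<le> (\<theta>\<^sup>2)\<^sup>2" using r by (intro power_mono) auto
    then have n: "(norm (z - x) / r)\<^sup>2 \<le> \<theta> ^ 4" by (simp flip: power_mult)
    let ?s = "\<Sum>i\<in>UNIV. (z - x) $ i * (g' i x / r)"
    have "\<bar>?s\<bar> \<le> \<bar>g z\<bar> + \<bar>g x\<bar> + K * (norm (z - x) / r)\<^sup>2"
      using g[OF xz] by linarith
    also have "\<dots> \<le> (2 + K) * \<theta> ^ 4"
      using gz mult_left_mono[OF n K] by (simp add: algebra_simps)
    finally have s: "\<bar>?s\<bar> \<le> (2 + K) * \<theta> ^ 4" .
    have "b x \<bullet> (z - x) = r * ?s"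
      using r by (simp add: b_def inner_vec_def sum_distrib_left mult_ac)
    then have "\<bar>b x \<bullet> (z - x)\<bar> \<le> r * ((2 + K) * \<theta> ^ 4)"
      using s r by (simp add: abs_mult)
    then have "\<bar>b x \<bullet> (z - x)\<bar> / norm (b x) \<le> r * ((2 + K) * \<theta> ^ 4) / \<theta>"
      using bx[OF x] \<theta> r K by (intro frac_le) auto
    also have "\<dots> = (2 + K) * (\<theta> ^ 3 * r)" using \<theta> by (simp add: power_numeral_reduce)
    also have "\<dots> < (3 + K) * (\<theta> ^ 3 * r)" using \<theta> r by (intro mult_strict_right_mono) auto
    finally have "infdist z {v. b x \<bullet> v = b x \<bullet> x} < (3 + K) * \<theta> ^ 3 * r"
      using infdist_hyperplane_le[of "b x" z x] \<open>b x \<noteq> 0\<close> by (simp add: mult.assoc)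
    then show "z \<in> E x" using z by (simp add: E_def)
  qed
  have bd: "emeasure \<mu> (E x) \<le> ennreal (?q * D ^ 3) * emeasure \<mu> (cball x (t / 10))" if x: "x \<in> Z" for x
  proof -
    have xs: "x \<in> supp \<mu>" and "b x \<noteq> 0" using x bx[OF x] \<theta> by (auto simp: Z_def)
    have "ball x t \<subseteq> ball y (3 * r)"
    proof
      fix z assume "z \<in> ball x t"
      then show "z \<in> ball y (3 * r)" using x t r dist_triangle[of y z x] by (auto simp: Z_def)
    qed
    then have xt: "ball x t \<subseteq> U" using U by blast
    have "0 < (3 + K) * \<theta> ^ 3 * r" using K \<theta> r by simp
    then have "emeasure \<mu> (E x) \<le> ennreal (C * ((3 + K) * \<theta> ^ 3 * r / t) powr \<alpha>) * emeasure \<mu> (ball x t)"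
      using dec xs xt t(1) \<open>b x \<noteq> 0\<close> unfolding decaying_on_def E_def by blast
    also have "(3 + K) * \<theta> ^ 3 * r / t = (3 + K) * \<theta>"
      using r \<theta> by (simp add: t_def power_numeral_reduce)
    \<comment> \<open>Three Federer steps reach radius \<open>t / 27\<close>, below the Vitali
      radius; a fourth one later brings \<open>ball y (3 * r)\<close> back to
      \<open>ball y r\<close>, hence \<open>D ^ 4\<close>.\<close>
    also have "emeasure \<mu> (ball x t) = emeasure \<mu> (ball x (3 ^ 3 * (t / 27)))" by simp
    also have "\<dots> \<le> ennreal (D ^ 3) * emeasure \<mu> (ball x (t / 27))"
      using t xt by (intro federer_iterate[OF fed xs _ D]) auto
    also have "emeasure \<mu> (ball x (t / 27)) \<le> emeasure \<mu> (cball x (t / 10))"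
      using t sets by (intro emeasure_mono) auto
    finally have "emeasure \<mu> (E x) \<le> ennreal ?q * (ennreal (D ^ 3) * emeasure \<mu> (cball x (t / 10)))"
      by (simp add: mult_left_mono)
    also have "\<dots> = ennreal (?q * D ^ 3) * emeasure \<mu> (cball x (t / 10))"
      using C D by (simp add: ennreal_mult mult.assoc)
    finally show ?thesis .
  qed
  have W: "cball x (t / 10) \<subseteq> ball y (3 * r)" if "x \<in> Z" for x
  proof
    fix z assume "z \<in> cball x (t / 10)"
    then show "z \<in> ball y (3 * r)" using that t r dist_triangle[of y z x] by (auto simp: Z_def)
  qed
  obtain E' where E': "E' \<in> sets \<mu>" "Z \<subseteq> E'"
    "emeasure \<mu> E' \<le> ennreal (?q * D ^ 3) * emeasure \<mu> (ball y (3 * r))"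
    by (rule covering_bound[OF sets, of Z "\<lambda>_. t" t E "ennreal (?q * D ^ 3)" "ball y (3 * r)"])
      (use t EZ sub bd W sets in auto)
  have "emeasure \<mu> (ball y (3 * r)) \<le> ennreal D * emeasure \<mu> (ball y r)"
    using federer_iterate[OF fed y r D, of 1] U by simp
  then have "emeasure \<mu> E' \<le> ennreal (?q * D ^ 3) * (ennreal D * emeasure \<mu> (ball y r))"
    using E'(3) by (meson mult_left_mono order_trans zero_le)
  also have "\<dots> = ennreal (?q * D ^ 4) * emeasure \<mu> (ball y r)"
  proof -
    have "ennreal (?q * D ^ 4) = ennreal (?q * D ^ 3) * ennreal D"
      using C D by (subst ennreal_mult[symmetric]) (auto simp: power_numeral_reduce)
    then show ?thesis by (simp only: mult.assoc)
  qed
  finally show ?thesis using that[of E'] E' by (simp add: Z_def)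
qed

definition words :: "nat \<Rightarrow> 'd::finite list set" where
  "words l = {w. length w \<le> l}"

lemma finite_words [simp]: "finite (words l :: 'd::finite list set)"
  using finite_lists_length_le[OF finite_class.finite_UNIV, of l] by (simp add: words_def)

lemma card_words_pos: "card (words l :: 'd::finite list set) > 0"
proof -
  have "[] \<in> (words l :: 'd list set)" by (simp add: words_def)
  then show ?thesis by (auto simp: card_gt_0_iff simp del: finite_words intro: finite_words)
qed

text \<open>Downward induction on the order. At order \<open>l + 1\<close> the bound
  \<open>A\<close> is compared with the lower bound \<open>a\<close> for some derivative of order at
  most \<open>l\<close>, using \<open>r \<le> 1\<close>. Each lower order costs a factor
  \<open>1 + 4 * d\<close> by the mean value inequality, as points of \<open>S\<close> are at most
  \<open>4 * r\<close> apart. The constant does not depend on \<open>r\<close>.\<close>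

lemma scaled_derivatives_comparable:
  fixes F :: "'d::finite list \<Rightarrow> real^'d \<Rightarrow> real"
  assumes S: "S = ball y (2 * r)" and r: "0 < r" "r \<le> 1" and a: "a > 0" and A: "A \<ge> 0"
    and der: "\<And>w x. length w \<le> l \<Longrightarrow> x \<in> S \<Longrightarrow>
      (F w has_derivative (\<lambda>h. \<Sum>i\<in>UNIV. h $ i * F (i # w) x)) (at x)"
    and bd: "\<And>w x. length w = Suc l \<Longrightarrow> x \<in> S \<Longrightarrow> \<bar>F w x\<bar> \<le> A"
    and low: "\<And>x. x \<in> S \<Longrightarrow> \<exists>w. length w \<le> l \<and> a \<le> \<bar>F w x\<bar>"
    and M: "\<And>x. M x = (\<Sum>w\<in>words l. r ^ length w * \<bar>F w x\<bar>)"
    and w: "length w \<le> Suc l" and xz: "x \<in> S" "z \<in> S"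
  shows "r ^ length w * \<bar>F w z\<bar> \<le> (1 + 4 * real CARD('d)) ^ Suc l * (1 + A / a) * M x"
proof -
  let ?d = "real CARD('d)"
  let ?c = "\<lambda>n. (1 + 4 * ?d) ^ n * (1 + A / a)"
  have c1: "?c n \<ge> 1" for n
    using mult_mono[of 1 "(1 + 4 * ?d) ^ n" 1 "1 + A / a"] a A by (simp add: one_le_power)
  have Mge: "r ^ length w * \<bar>F w x\<bar> \<le> M x" if "length w \<le> l" for w x
  proof -
    have "w \<in> words l" using that by (simp add: words_def)
    then show ?thesis unfolding M using r by (intro member_le_sum) auto
  qed
  have Ml: "r ^ l * a \<le> M x" if x: "x \<in> S" for x
  proof -
    obtain w where w: "length w \<le> l" "a \<le> \<bar>F w x\<bar>" using low[OF x] by blast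
    have "r ^ l * a \<le> r ^ length w * \<bar>F w x\<bar>"
      using w r a by (intro mult_mono power_decreasing) auto
    then show ?thesis using Mge[OF w(1)] by (rule order_trans)
  qed
  have M0: "0 \<le> M x" for x unfolding M using r by (intro sum_nonneg) auto
  have "\<forall>x\<in>S. \<forall>z\<in>S. r ^ length w * \<bar>F w z\<bar> \<le> ?c n * M x" if "length w + n = Suc l" for w n
    using that
  proof (induction n arbitrary: w)
    case 0
    show ?case
    proof (intro ballI)
      fix x z assume xz: "x \<in> S" "z \<in> S"
      have "r ^ length w * \<bar>F w z\<bar> \<le> r ^ l * A"
        using bd[of w z] 0 xz r by (intro mult_mono) (auto intro: mult_left_le_one_le)
      also have "\<dots> = (A / a) * (r ^ l * a)" using a by simp
      also have "\<dots> \<le> (1 + A / a) * M x" using a A r Ml[OF xz(1)] by (intro mult_mono) auto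
      finally show "r ^ length w * \<bar>F w z\<bar> \<le> ?c 0 * M x" by simp
    qed
  next
    case (Suc n)
    show ?case
    proof (intro ballI)
      fix x z assume xz: "x \<in> S" "z \<in> S"
      have w: "length w \<le> l" using Suc.prems by simp
      define B where "B = ?c n * M x / r ^ Suc (length w)"
      have B0: "0 \<le> B" using c1[of n] M0[of x] r by (simp add: B_def)
      have "\<bar>F (i # w) u\<bar> \<le> B" if "u \<in> S" for i u
        using Suc.IH[of "i # w"] Suc.prems xz(1) that r
        unfolding B_def by (simp add: field_simps)
      then have "\<bar>F w z - F w x\<bar> \<le> ?d * B * norm (z - x)"
        using S der w xz by (intro partials_lipschitz[of S _ "\<lambda>i. F (i # w)"]) auto
      also have "norm (z - x) \<le> 4 * r"
        using xz dist_triangle3[of z x y] unfolding S dist_norm[symmetric] by auto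
      finally have "\<bar>F w z\<bar> \<le> \<bar>F w x\<bar> + ?d * B * (4 * r)"
        using B0 by (simp add: mult_left_mono)
      then have "r ^ length w * \<bar>F w z\<bar> \<le> r ^ length w * (\<bar>F w x\<bar> + ?d * B * (4 * r))"
        using r by (intro mult_left_mono) auto
      also have "\<dots> = r ^ length w * \<bar>F w x\<bar> + 4 * ?d * (?c n * M x)"
        using r by (simp add: B_def field_simps)
      also have "\<dots> \<le> 1 * M x + 4 * ?d * (?c n * M x)" using Mge[OF w] by simp
      also have "\<dots> \<le> ?c n * M x + 4 * ?d * (?c n * M x)"
        using c1[of n] M0[of x] by (intro add_right_mono mult_right_mono) auto
      also have "\<dots> = ?c (Suc n) * M x" by (simp add: algebra_simps)
      finally show "r ^ length w * \<bar>F w z\<bar> \<le> ?c (Suc n) * M x" .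
    qed
  qed
  from this[of w "Suc l - length w"] w xz
  have "r ^ length w * \<bar>F w z\<bar> \<le> ?c (Suc l - length w) * M x" by simp
  also have "\<dots> \<le> ?c (Suc l) * M x"
    using M0 a A by (intro mult_right_mono power_increasing) auto
  finally show ?thesis .
qed

text \<open>The thresholds \<open>\<eta> powr (1/4^j)\<close> increase with the order \<open>j\<close> of the derivative and each is the
  fourth power of the next. At a point where \<open>|H []| < \<eta>\<close>, the first order at which some derivative
  exceeds its threshold provides a function to which \<open>small_value_large_gradient\<close> applies.\<close>

lemma normalized_system_good:
  fixes \<mu> :: "(real^'d) measure" and H :: "'d list \<Rightarrow> real^'d \<Rightarrow> real"
  assumes sets: "sets \<mu> = sets borel" and fed: "federer_on D \<mu> U" and D: "D > 0"
    and dec: "decaying_on C \<alpha> \<mu> U" and C: "C > 0" "\<alpha> > 0"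
    and y: "y \<in> supp \<mu>" and r: "r > 0" and U: "ball y (3 * r) \<subseteq> U"
    and K: "K \<ge> 0" and \<kappa>: "0 < \<kappa>" "\<kappa> < 1" and \<eta>: "\<eta> > 0"
    and g: "\<And>w x z. length w < l \<Longrightarrow> x \<in> ball y (2 * r) \<Longrightarrow> z \<in> ball y (2 * r) \<Longrightarrow>
      \<bar>H w z - H w x - (\<Sum>i\<in>UNIV. (z - x) $ i * (H (i # w) x / r))\<bar> \<le> K * (norm (z - x) / r)\<^sup>2"
    and low: "\<And>x. x \<in> ball y r \<Longrightarrow> \<exists>w. length w \<le> l \<and> \<kappa> \<le> \<bar>H w x\<bar>"
  shows "\<exists>E\<in>sets \<mu>. {x \<in> ball y r. \<bar>H [] x\<bar> < \<eta>} \<subseteq> E \<and> emeasure \<mu> E \<le>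
    ennreal ((real (card (words l :: 'd list set)) * C * (3 + K) powr \<alpha> * D ^ 4 + (1 / \<kappa>) powr \<alpha>)
      * \<eta> powr (\<alpha> / 4 ^ l)) * emeasure \<mu> (ball y r)"
proof -
  define q where "q = \<eta> powr (1 / 4 ^ l)"
  define N where "N = real (card (words l :: 'd list set))"
  let ?Q = "C * (3 + K) powr \<alpha> * D ^ 4"
  have q: "q > 0" using \<eta> by (simp add: q_def)
  have q\<alpha>: "\<eta> powr (\<alpha> / 4 ^ l) = q powr \<alpha>" by (simp add: q_def powr_powr)
  have Q0: "?Q \<ge> 0" "N * ?Q \<ge> 0" using C D by (auto simp: N_def)
  show ?thesis
  \<comment> \<open>\<open>q\<close> is the largest threshold, at order \<open>l\<close>. If it
    exceeds \<kappa>, the claimed bound is at least the measure of the ball, and the ball itself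
    serves as \<open>E\<close>.\<close>
  proof (cases "q \<le> \<kappa>")
    case False
    have "1 \<le> (1 / \<kappa> * q) powr \<alpha>" using False \<kappa> C by (intro ge_one_powr_ge_zero) (auto simp: field_simps)
    also have "\<dots> = (1 / \<kappa>) powr \<alpha> * q powr \<alpha>" by (rule powr_mult)
    also have "\<dots> \<le> (N * ?Q + (1 / \<kappa>) powr \<alpha>) * q powr \<alpha>"
      using Q0 by (intro mult_right_mono) auto
    finally have "1 \<le> ennreal ((N * ?Q + (1 / \<kappa>) powr \<alpha>) * q powr \<alpha>)"
      by (metis ennreal_1 ennreal_leI)
    then have "1 * emeasure \<mu> (ball y r) \<le> ennreal ((N * ?Q + (1 / \<kappa>) powr \<alpha>) * q powr \<alpha>) * emeasure \<mu> (ball y r)"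
      by (rule mult_right_mono) simp
    then show ?thesis using sets unfolding q\<alpha> by (intro bexI[of _ "ball y r"]) (auto simp: N_def mult_ac)
  next
    case True
    then have "q < 1" using \<kappa> by simp
    then have \<eta>1: "\<eta> < 1" using \<eta> unfolding q_def
      by (metis divide_pos_pos ge_one_powr_ge_zero less_le not_le zero_less_numeral zero_less_one zero_less_power)
    define e where "e j = \<eta> powr (1 / 4 ^ j)" for j :: nat
    have e0: "e 0 = \<eta>" using \<eta> by (simp add: e_def)
    have epos: "0 < e j" for j using \<eta> by (simp add: e_def)
    have e4: "e j = e (Suc j) ^ 4" for j
    proof -
      have "e (Suc j) ^ 4 = \<eta> powr (1 / 4 ^ Suc j * 4)"
        using \<eta> by (simp add: e_def powr_powr flip: powr_realpow')
      then show ?thesis by (simp add: e_def)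
    qed
    have emono: "e i \<le> e j" if "i \<le> j" for i j
      unfolding e_def using \<eta> \<eta>1 that by (intro powr_mono') (auto intro!: divide_left_mono power_increasing)
    have el: "e l = q" by (simp add: e_def q_def)
    let ?W = "{w :: 'd list. length w < l}"
    have "?W \<subseteq> words l" by (auto simp: words_def)
    then have W: "finite ?W" "real (card ?W) \<le> N"
      by (auto intro: finite_subset card_mono simp: N_def)
    define Z where "Z w = {x \<in> ball y r \<inter> supp \<mu>. \<bar>H w x\<bar> < e (Suc (length w)) ^ 4 \<and>
        (\<exists>i. e (Suc (length w)) \<le> \<bar>H (i # w) x\<bar>)}" for w
    have "\<exists>E. E \<in> sets \<mu> \<and> Z w \<subseteq> E \<and> emeasure \<mu> E \<le> ennreal (?Q * q powr \<alpha>) * emeasure \<mu> (ball y r)"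
      if w: "w \<in> ?W" for w
    proof -
      let ?\<theta> = "e (Suc (length w))"
      have \<theta>: "0 < ?\<theta>" "?\<theta> \<le> q" using epos emono[of "Suc (length w)" l] w el by auto
      obtain E where E: "E \<in> sets \<mu>" "Z w \<subseteq> E"
        "emeasure \<mu> E \<le> ennreal (C * ((3 + K) * ?\<theta>) powr \<alpha> * D ^ 4) * emeasure \<mu> (ball y r)"
        by (rule small_value_large_gradient[OF sets fed D dec C y r U \<theta>(1) _ K, of "H w" "\<lambda>i. H (i # w)"])
          (use \<theta> \<open>q < 1\<close> g[of w] w in \<open>auto simp: Z_def\<close>)
      have "C * ((3 + K) * ?\<theta>) powr \<alpha> * D ^ 4 \<le> C * ((3 + K) * q) powr \<alpha> * D ^ 4"
        using \<theta> C D K by (intro mult_right_mono mult_left_mono powr_mono2) auto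
      also have "\<dots> = ?Q * q powr \<alpha>" using K q by (simp add: powr_mult)
      finally have "ennreal (C * ((3 + K) * ?\<theta>) powr \<alpha> * D ^ 4) \<le> ennreal (?Q * q powr \<alpha>)"
        by (rule ennreal_leI)
      then show ?thesis using E by (meson mult_right_mono order_trans zero_le)
    qed
    then obtain E where E: "\<And>w. w \<in> ?W \<Longrightarrow> E w \<in> sets \<mu>" "\<And>w. w \<in> ?W \<Longrightarrow> Z w \<subseteq> E w"
      "\<And>w. w \<in> ?W \<Longrightarrow> emeasure \<mu> (E w) \<le> ennreal (?Q * q powr \<alpha>) * emeasure \<mu> (ball y r)"
      by metis
    define E' where "E' = (\<Union>w\<in>?W. E w) \<union> - supp \<mu>"
    have null: "- supp \<mu> \<in> null_sets \<mu>" by (rule null_complement_supp[OF sets])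
    have UE: "(\<Union>w\<in>?W. E w) \<in> sets \<mu>" using W E by (intro sets.finite_UN) auto
    have "x \<in> E'" if x: "x \<in> ball y r" "\<bar>H [] x\<bar> < \<eta>" for x
    proof (cases "x \<in> supp \<mu>")
      case True
      define P where "P j \<longleftrightarrow> (\<exists>w. length w = j \<and> e j \<le> \<bar>H w x\<bar>)" for j
      obtain w0 where "length w0 \<le> l" "\<kappa> \<le> \<bar>H w0 x\<bar>" using low[OF x(1)] by blast
      then have "P (length w0)" "length w0 \<le> l"
        using emono[of "length w0" l] el \<open>q \<le> \<kappa>\<close> unfolding P_def by force+
      \<comment> \<open>At the least order where a threshold is reached, the word is non-empty
        because \<open>H []\<close> is below \<open>e 0\<close>. Its tail is then below its own
        threshold, the fourth power of the one that the word reaches.\<close>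
      then have "P (LEAST j. P j)" and jl: "(LEAST j. P j) \<le> l"
        by (auto intro: LeastI Least_le[THEN order_trans])
      then obtain v where v: "length v = (LEAST j. P j)" "e (length v) \<le> \<bar>H v x\<bar>"
        unfolding P_def by metis
      have "v \<noteq> []" using v(2) x(2) e0 by auto
      then obtain i w where iw: "v = i # w" by (cases v) auto
      then have "\<not> P (length w)" using v(1) by (intro not_less_Least) simp
      then have "\<bar>H w x\<bar> < e (length w)" unfolding P_def by force
      then have "x \<in> Z w" using x True v(2) iw e4[of "length w"] by (auto simp: Z_def)
      moreover have "w \<in> ?W" using v(1) jl iw by simp
      ultimately show ?thesis using E(2) unfolding E'_def by blast
    qed (simp add: E'_def)
    then have "{x \<in> ball y r. \<bar>H [] x\<bar> < \<eta>} \<subseteq> E'" by blast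
    moreover have "E' \<in> sets \<mu>" using UE null by (auto simp: E'_def)
    moreover have "emeasure \<mu> E' \<le> ennreal ((N * ?Q + (1 / \<kappa>) powr \<alpha>) * q powr \<alpha>) * emeasure \<mu> (ball y r)"
    proof -
      have "emeasure \<mu> E' = emeasure \<mu> (\<Union>w\<in>?W. E w)"
        unfolding E'_def by (rule emeasure_Un_null_set[OF UE null])
      also have "\<dots> \<le> (\<Sum>w\<in>?W. emeasure \<mu> (E w))"
        using W E by (intro emeasure_subadditive_finite) auto
      also have "\<dots> \<le> (\<Sum>w\<in>?W. ennreal (?Q * q powr \<alpha>) * emeasure \<mu> (ball y r))"
        using E by (intro sum_mono) auto
      also have "\<dots> = ennreal (real (card ?W) * (?Q * q powr \<alpha>)) * emeasure \<mu> (ball y r)"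
      proof -
        have "ennreal (real (card ?W) * (?Q * q powr \<alpha>)) = of_nat (card ?W) * ennreal (?Q * q powr \<alpha>)"
          using Q0(1) by (subst ennreal_mult) (auto simp: ennreal_of_nat_eq_real_of_nat)
        then show ?thesis by (simp only: sum_constant mult.assoc)
      qed
      also have "\<dots> \<le> ennreal ((N * ?Q + (1 / \<kappa>) powr \<alpha>) * q powr \<alpha>) * emeasure \<mu> (ball y r)"
      proof (intro mult_right_mono ennreal_leI)
        have "real (card ?W) * (?Q * q powr \<alpha>) \<le> N * (?Q * q powr \<alpha>)"
          using W(2) Q0 by (intro mult_right_mono) auto
        also have "\<dots> \<le> (N * ?Q + (1 / \<kappa>) powr \<alpha>) * q powr \<alpha>" by (simp add: algebra_simps)
        finally show "real (card ?W) * (?Q * q powr \<alpha>) \<le> (N * ?Q + (1 / \<kappa>) powr \<alpha>) * q powr \<alpha>" .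
      qed simp
      finally show ?thesis .
    qed
    ultimately show ?thesis unfolding q\<alpha> by (intro bexI[of _ E']) (auto simp: N_def mult_ac)
  qed
qed

definition comparison_const :: "nat \<Rightarrow> nat \<Rightarrow> real \<Rightarrow> real" where
  "comparison_const d l q = (1 + 4 * real d) ^ Suc l * (1 + q)"

text \<open>At most \<open>N\<close> words contribute a strip estimate with
  \<open>K = d\<^sup>2 * c\<close>; the second summand is
  \<open>(1 / \<kappa>) powr \<alpha>\<close> from the trivial range; the last factor comes from
  replacing the normalised threshold by \<open>c * (\<epsilon> / \<rho>)\<close>.\<close>

definition good_const :: "real \<Rightarrow> real \<Rightarrow> real \<Rightarrow> nat \<Rightarrow> nat \<Rightarrow> nat \<Rightarrow> real \<Rightarrow> real" where
  "good_const C \<alpha> D d N l c = (real N * C * (3 + (real d)\<^sup>2 * c) powr \<alpha> * D ^ 4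
     + (2 * (real N)\<^sup>2 * c) powr \<alpha>) * c powr (\<alpha> / 4 ^ l)"

text \<open>Weighting a derivative of order \<open>j\<close> by \<open>r ^ j\<close> and dividing by
  \<open>M y\<close> removes both the radius and the size of \<open>F\<close>. The constants depend
  on the bounds only through \<open>A / a\<close>, so multiples of \<open>F\<close> are treated
  alike.\<close>

lemma system_good:
  fixes \<mu> :: "(real^'d) measure" and F :: "'d list \<Rightarrow> real^'d \<Rightarrow> real"
  assumes sets: "sets \<mu> = sets borel" and fed: "federer_on D \<mu> U" and D: "D > 0"
    and dec: "decaying_on C \<alpha> \<mu> U" and C: "C > 0" "\<alpha> > 0"
    and y: "y \<in> supp \<mu>" and r: "0 < r" "r \<le> 1" and U: "ball y (3 * r) \<subseteq> U"
    and a: "a > 0" and A: "A \<ge> 0"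
    and der: "\<And>w x. length w \<le> l \<Longrightarrow> x \<in> ball y (2 * r) \<Longrightarrow>
      (F w has_derivative (\<lambda>h. \<Sum>i\<in>UNIV. h $ i * F (i # w) x)) (at x)"
    and bd: "\<And>w x. length w = Suc l \<Longrightarrow> x \<in> ball y (2 * r) \<Longrightarrow> \<bar>F w x\<bar> \<le> A"
    and low: "\<And>x. x \<in> ball y (2 * r) \<Longrightarrow> \<exists>w. length w \<le> l \<and> a \<le> \<bar>F w x\<bar>"
    and \<rho>: "\<rho> > 0" and \<epsilon>: "\<epsilon> > 0" and big: "\<exists>x\<in>ball y r. \<rho> \<le> \<bar>F [] x\<bar>"
    and c: "c = comparison_const CARD('d) l (A / a)"
    and N: "N = card (words l :: 'd list set)"
  shows "\<exists>E\<in>sets \<mu>. {x \<in> ball y r. \<bar>F [] x\<bar> < \<epsilon>} \<subseteq> E \<and> emeasure \<mu> E \<le>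
    ennreal (good_const C \<alpha> D CARD('d) N l c * (\<epsilon> / \<rho>) powr (\<alpha> / 4 ^ l)) * emeasure \<mu> (ball y r)"
proof -
  let ?S = "ball y (2 * r)"
  define M where "M x = (\<Sum>w\<in>words l. r ^ length w * \<bar>F w x\<bar>)" for x
  have comp: "r ^ length w * \<bar>F w z\<bar> \<le> c * M x" if "length w \<le> Suc l" "x \<in> ?S" "z \<in> ?S" for w x z
    unfolding c comparison_const_def
    by (rule scaled_derivatives_comparable[OF refl r a A der bd low M_def that])
  have c1: "c \<ge> 1"
    using mult_mono[of 1 "(1 + 4 * real CARD('d)) ^ Suc l" 1 "1 + A / a"] a A
    unfolding c comparison_const_def by (simp add: one_le_power del: power_Suc)
  have N1: "real N \<ge> 1" using card_words_pos[of l, where 'd = 'd] by (simp add: N Suc_le_eq)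
  have yS: "y \<in> ?S" using r by simp
  have Mpos: "0 < M x" if x: "x \<in> ?S" for x
  proof -
    obtain w where w: "length w \<le> l" "a \<le> \<bar>F w x\<bar>" using low[OF x] by blast
    then have "w \<in> words l" by (simp add: words_def)
    moreover have "0 < r ^ length w * \<bar>F w x\<bar>" using r w a by simp
    ultimately show ?thesis unfolding M_def using r by (intro sum_pos2) auto
  qed
  define H where "H w x = r ^ length w * F w x / M y" for w x
  have My: "M y > 0" by (rule Mpos[OF yS])
  have Hle: "\<bar>H w x\<bar> \<le> c" if "length w \<le> Suc l" "x \<in> ?S" for w x
    using comp[OF that(1) yS that(2)] My r by (simp add: H_def abs_mult field_simps)
  \<comment> \<open>One factor \<open>N\<close> comes from \<open>M y \<le> N * c * M x\<close>, the
    other from picking the largest of the \<open>N\<close> summands of \<open>M x\<close>. The 2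
    makes \<kappa> strictly less than 1.\<close>
  define \<kappa> where "\<kappa> = 1 / (2 * (real N)\<^sup>2 * c)"
  have \<kappa>: "0 < \<kappa>" "\<kappa> < 1"
  proof -
    have "1 * 1 \<le> (real N)\<^sup>2 * c" using N1 c1 by (intro mult_mono) auto
    then show "0 < \<kappa>" "\<kappa> < 1" by (auto simp: \<kappa>_def field_simps)
  qed
  have Hlow: "\<exists>w. length w \<le> l \<and> \<kappa> \<le> \<bar>H w x\<bar>" if x: "x \<in> ball y r" for x
  proof -
    have xS: "x \<in> ?S" using x r by auto
    have "M y \<le> (\<Sum>w\<in>(words l :: 'd list set). c * M x)"
      unfolding M_def[of y] using comp[OF _ xS yS] by (intro sum_mono) (auto simp: words_def)
    then have MM: "M y \<le> N * (c * M x)" by (simp add: N)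
    have "\<exists>w\<in>words l. M x / N \<le> r ^ length w * \<bar>F w x\<bar>"
    proof (rule ccontr)
      assume "\<not> (\<exists>w\<in>words l. M x / N \<le> r ^ length w * \<bar>F w x\<bar>)"
      then have "M x < real (card (words l :: 'd list set)) * (M x / N)"
        unfolding M_def[of x] using card_words_pos[of l, where 'd = 'd]
        by (intro sum_bounded_above_strict) (auto simp: not_le M_def)
      moreover have "real (card (words l :: 'd list set)) * (M x / N) = M x"
        using N1 by (simp add: N[symmetric])
      ultimately show False by simp
    qed
    then obtain w where w: "length w \<le> l" "M x / N \<le> r ^ length w * \<bar>F w x\<bar>"
      by (auto simp: words_def)
    have "\<kappa> * M y \<le> \<kappa> * (N * (c * M x))" using MM \<kappa> by (intro mult_left_mono) auto
    also have "\<dots> = M x / N / 2" using N1 c1 by (simp add: \<kappa>_def power2_eq_square)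
    also have "\<dots> \<le> M x / N" using Mpos[OF xS] N1 by (simp add: field_simps)
    also have "\<dots> \<le> r ^ length w * \<bar>F w x\<bar>" by (rule w(2))
    finally have "\<kappa> \<le> \<bar>H w x\<bar>" using My r by (simp add: H_def abs_mult field_simps)
    then show ?thesis using w(1) by blast
  qed
  have Hder: "(H w has_derivative (\<lambda>h. \<Sum>i\<in>UNIV. h $ i * (H (i # w) x / r))) (at x)"
    if "length w \<le> l" "x \<in> ?S" for w x
  proof -
    have "((\<lambda>x. (r ^ length w / M y) * F w x) has_derivative
        (\<lambda>h. (r ^ length w / M y) * (\<Sum>i\<in>UNIV. h $ i * F (i # w) x))) (at x)"
      by (intro has_derivative_mult_right der that)
    then show ?thesis using r by (simp add: H_def[abs_def] sum_distrib_left mult_ac)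
  qed
  have second: "\<bar>H w z - H w x - (\<Sum>i\<in>UNIV. (z - x) $ i * (H (i # w) x / r))\<bar>
      \<le> (real CARD('d))\<^sup>2 * c * (norm (z - x) / r)\<^sup>2"
    if w: "length w < l" and xz: "x \<in> ?S" "z \<in> ?S" for w x z
  proof -
    have "\<bar>H w z - H w x - (\<Sum>i\<in>UNIV. (z - x) $ i * (H (i # w) x / r))\<bar>
        \<le> (real CARD('d))\<^sup>2 * (c / r\<^sup>2) * (norm (z - x))\<^sup>2"
    proof (rule partials_second_order[of ?S _ _ "\<lambda>j i x. H (j # i # w) x / r\<^sup>2"])
      fix i x assume x: "x \<in> ?S"
      have "((\<lambda>x. 1 / r * H (i # w) x) has_derivative
          (\<lambda>h. 1 / r * (\<Sum>j\<in>UNIV. h $ j * (H (j # i # w) x / r)))) (at x)"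
        using w x by (intro has_derivative_mult_right Hder) auto
      then show "((\<lambda>x. H (i # w) x / r) has_derivative
          (\<lambda>h. \<Sum>j\<in>UNIV. h $ j * (H (j # i # w) x / r\<^sup>2))) (at x)"
        by (simp add: sum_distrib_left power2_eq_square mult_ac)
      show "\<bar>H (j # i # w) x / r\<^sup>2\<bar> \<le> c / r\<^sup>2" for j
        using Hle[of "j # i # w" x] w x r by (simp add: divide_right_mono)
    qed (use w xz Hder in auto)
    then show ?thesis by (simp add: power_divide)
  qed
  obtain x1 where x1: "x1 \<in> ball y r" "\<rho> \<le> \<bar>F [] x1\<bar>" using big by blast
  \<comment> \<open>The point where the function reaches \<rho> bounds the normalising factor from
    below; this is how \<rho> enters the estimate.\<close>
  have \<rho>M: "\<rho> \<le> c * M y" using comp[of "[]" y x1] yS x1 r by auto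
  define \<eta> where "\<eta> = \<epsilon> / M y"
  have \<eta>0: "0 < \<eta>" using \<epsilon> My by (simp add: \<eta>_def)
  let ?G = "real N * C * (3 + (real CARD('d))\<^sup>2 * c) powr \<alpha> * D ^ 4 + (1 / \<kappa>) powr \<alpha>"
  have "\<exists>E\<in>sets \<mu>. {x \<in> ball y r. \<bar>H [] x\<bar> < \<eta>} \<subseteq> E \<and>
      emeasure \<mu> E \<le> ennreal (?G * \<eta> powr (\<alpha> / 4 ^ l)) * emeasure \<mu> (ball y r)"
    unfolding N using c1
    by (intro normalized_system_good[OF sets fed D dec C y r(1) U _ \<kappa> \<eta>0 second Hlow]) auto
  then obtain E where E: "E \<in> sets \<mu>" "{x \<in> ball y r. \<bar>H [] x\<bar> < \<eta>} \<subseteq> E"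
    "emeasure \<mu> E \<le> ennreal (?G * \<eta> powr (\<alpha> / 4 ^ l)) * emeasure \<mu> (ball y r)" by blast
  have "?G * \<eta> powr (\<alpha> / 4 ^ l) \<le> ?G * (c * (\<epsilon> / \<rho>)) powr (\<alpha> / 4 ^ l)"
  proof (intro mult_left_mono powr_mono2)
    show "\<eta> \<le> c * (\<epsilon> / \<rho>)"
      using \<rho>M \<rho> My \<epsilon> mult_left_mono[OF \<rho>M, of \<epsilon>] by (simp add: \<eta>_def field_simps)
  qed (use C D N1 \<eta>0 in auto)
  also have "\<dots> = good_const C \<alpha> D CARD('d) N l c * (\<epsilon> / \<rho>) powr (\<alpha> / 4 ^ l)"
    unfolding powr_mult[of c "\<epsilon> / \<rho>"] by (simp add: good_const_def \<kappa>_def)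
  finally have "ennreal (?G * \<eta> powr (\<alpha> / 4 ^ l))
      \<le> ennreal (good_const C \<alpha> D CARD('d) N l c * (\<epsilon> / \<rho>) powr (\<alpha> / 4 ^ l))" by (rule ennreal_leI)
  then have "emeasure \<mu> E \<le> ennreal (good_const C \<alpha> D CARD('d) N l c * (\<epsilon> / \<rho>) powr (\<alpha> / 4 ^ l))
      * emeasure \<mu> (ball y r)"
    using E(3) by (meson mult_right_mono order_trans zero_le)
  moreover have "{x \<in> ball y r. \<bar>F [] x\<bar> < \<epsilon>} \<subseteq> {x \<in> ball y r. \<bar>H [] x\<bar> < \<eta>}"
    using My by (auto simp: H_def \<eta>_def divide_strict_right_mono)
  ultimately show ?thesis using E(1,2) by blast
qed

text \<open>Coefficient vectors with all derivatives zero at \<open>a\<close> form a subspace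
  \<open>N\<close>, and by \<open>uc\<close> they give the zero function. Replacing \<open>b\<close>
  by its component \<open>b'\<close> orthogonal to \<open>N\<close> leaves the function unchanged.
  On the unit sphere of the complement, compactness selects finitely many words that detect every
  vector at \<open>a\<close>, and continuity spreads this to a ball.\<close>

lemma uniform_nondegeneracy:
  fixes \<Phi> :: "'n::finite \<Rightarrow> 'd::finite list \<Rightarrow> real^'d \<Rightarrow> real"
  assumes T: "T > 0" and sys: "\<And>s. deriv_system (ball a T) (\<Phi> s)"
    and uc: "\<And>b :: real^'n. (\<And>w. (\<Sum>s\<in>UNIV. b $ s * \<Phi> s w a) = 0) \<Longrightarrow>
      \<forall>x\<in>ball a T. (\<Sum>s\<in>UNIV. b $ s * \<Phi> s [] x) = 0"
  obtains l \<kappa> T' where "\<kappa> > 0" "0 < T'" "T' \<le> T"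
    "\<forall>b :: real^'n. \<exists>b' :: real^'n. (\<forall>x\<in>ball a T. (\<Sum>s\<in>UNIV. b $ s * \<Phi> s [] x) = (\<Sum>s\<in>UNIV. b' $ s * \<Phi> s [] x)) \<and>
      (\<forall>x\<in>ball a T'. \<exists>w. length w \<le> l \<and> \<kappa> * norm b' \<le> \<bar>\<Sum>s\<in>UNIV. b' $ s * \<Phi> s w x\<bar>)"
proof -
  define f where "f b w x = (\<Sum>s\<in>UNIV. (b :: real^'n) $ s * \<Phi> s w x)" for b w x
  define N where "N = {b. \<forall>w. f b w a = 0}"
  have f_lin: "f (b + b') w x = f b w x + f b' w x" "f (t *\<^sub>R b) w x = t * f b w x" for b b' t w x
    by (auto simp: f_def algebra_simps sum.distrib sum_distrib_left)
  have subN: "subspace N"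
    unfolding subspace_def N_def by (auto simp: f_lin) (auto simp: f_def)
  define Q where "Q = {m. \<forall>n\<in>N. n \<bullet> m = 0}"
  have closedQ: "closed Q"
  proof -
    have "Q = (\<Inter>n\<in>N. {m. n \<bullet> m = 0})" by (auto simp: Q_def)
    then show ?thesis by (auto intro!: closed_INT closed_hyperplane)
  qed
  define Kp where "Kp = Q \<inter> sphere 0 1"
  have compK: "compact Kp" unfolding Kp_def using closedQ by (intro closed_Int_compact) auto
  have contf: "continuous_on UNIV (\<lambda>b. f b w a)" for w
    unfolding f_def by (intro continuous_intros)
  have cover: "Kp \<subseteq> (\<Union>w\<in>UNIV. {b. f b w a \<noteq> 0})"
  proof
    fix m assume m: "m \<in> Kp"
    show "m \<in> (\<Union>w. {b. f b w a \<noteq> 0})"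
    proof (rule ccontr)
      assume "m \<notin> (\<Union>w. {b. f b w a \<noteq> 0})"
      then have "m \<in> N" by (auto simp: N_def)
      then have "m \<bullet> m = 0" using m by (auto simp: Kp_def Q_def)
      then show False using m by (auto simp: Kp_def)
    qed
  qed
  have opn: "open {b. f b w a \<noteq> 0}" for w
    using open_Collect_neq[OF contf[of w] continuous_on_const[of UNIV 0]] by simp
  obtain W where W: "finite W" "Kp \<subseteq> (\<Union>w\<in>W. {b. f b w a \<noteq> 0})"
    by (rule compactE_image[OF compK opn cover])
  define g where "g b = (\<Sum>w\<in>W. \<bar>f b w a\<bar>)" for b
  have contg: "continuous_on Kp g"
    unfolding g_def by (intro continuous_intros continuous_on_subset[OF contf]) auto
  have gpos: "g b > 0" if b: "b \<in> Kp" for b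
  proof -
    obtain w where "w \<in> W" "f b w a \<noteq> 0" using W(2) b by blast
    then show ?thesis unfolding g_def using W(1) by (intro sum_pos2[of W w]) auto
  qed
  obtain \<kappa>0 where \<kappa>0: "\<kappa>0 > 0" "\<And>b. b \<in> Kp \<Longrightarrow> \<kappa>0 \<le> g b"
  proof (cases "Kp = {}")
    case True
    then show ?thesis using that[of 1] by auto
  next
    case False
    obtain b0 where "b0 \<in> Kp" "\<And>b. b \<in> Kp \<Longrightarrow> g b0 \<le> g b"
      using continuous_attains_inf[OF compK False contg] by blast
    then show ?thesis using that[of "g b0"] gpos by blast
  qed
  \<comment> \<open>Some word then gives at least \<open>2 * \<kappa>\<close> at \<open>a\<close>,
    of which one \<kappa> may be lost on the way to a nearby point.\<close>
  define \<kappa> where "\<kappa> = \<kappa>0 / (2 * (real (card W) + 1))"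
  have \<kappa>: "\<kappa> > 0" using \<kappa>0 by (simp add: \<kappa>_def)
  have lowa: "\<exists>w\<in>W. 2 * \<kappa> \<le> \<bar>f b w a\<bar>" if b: "b \<in> Kp" for b
  proof (rule ccontr)
    assume "\<not> (\<exists>w\<in>W. 2 * \<kappa> \<le> \<bar>f b w a\<bar>)"
    then have "g b \<le> real (card W) * (2 * \<kappa>)"
      unfolding g_def by (intro sum_bounded_above) (auto simp: not_le less_imp_le)
    also have "\<dots> < \<kappa>0" using \<kappa>0 by (simp add: \<kappa>_def field_simps)
    finally show False using \<kappa>0(2)[OF b] by simp
  qed
  define \<delta> where "\<delta> = \<kappa> / real CARD('n)"
  have \<delta>: "\<delta> > 0" using \<kappa> by (simp add: \<delta>_def)
  have cont\<Phi>: "isCont (\<Phi> s w) a" for s w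
  proof -
    have "(\<Phi> s w has_derivative (\<lambda>h. \<Sum>i\<in>UNIV. h $ i * \<Phi> s (i # w) a)) (at a)"
      using sys[of s] T by (auto simp: deriv_system_def)
    then show ?thesis by (rule has_derivative_continuous)
  qed
  have "\<forall>\<^sub>F x in nhds a. \<forall>w\<in>W. \<forall>s\<in>UNIV. dist (\<Phi> s w x) (\<Phi> s w a) < \<delta>"
  proof (intro eventually_ball_finite ballI W(1))
    fix w s
    show "\<forall>\<^sub>F x in nhds a. dist (\<Phi> s w x) (\<Phi> s w a) < \<delta>"
      using tendstoD[OF cont\<Phi>[of s w, unfolded continuous_at] \<delta>] \<delta>
      by (simp add: eventually_nhds_conv_at)
  qed auto
  then obtain T1 where T1: "T1 > 0" "\<And>x w s. dist x a < T1 \<Longrightarrow> w \<in> W \<Longrightarrow> dist (\<Phi> s w x) (\<Phi> s w a) < \<delta>"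
    unfolding eventually_nhds_metric by auto
  define T' where "T' = min T T1"
  define l where "l = Max (insert 0 (length ` W))"
  have l: "length w \<le> l" if "w \<in> W" for w unfolding l_def using W(1) that by (intro Max_ge) auto
  have unit: "\<exists>w\<in>W. \<kappa> \<le> \<bar>f b w x\<bar>" if b: "b \<in> Kp" and x: "x \<in> ball a T'" for b x
  proof -
    obtain w where w: "w \<in> W" "2 * \<kappa> \<le> \<bar>f b w a\<bar>" using lowa[OF b] by blast
    have "\<bar>f b w x - f b w a\<bar> = \<bar>\<Sum>s\<in>UNIV. b $ s * (\<Phi> s w x - \<Phi> s w a)\<bar>"
      by (simp add: f_def right_diff_distrib sum_subtractf)
    also have "\<dots> \<le> real CARD('n) * \<delta> * norm b"
      using T1(2)[OF _ w(1)] x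
      by (intro linear_form_bound) (auto simp: T'_def dist_real_def dist_commute less_imp_le)
    also have "\<dots> = \<kappa>" using b by (simp add: \<delta>_def Kp_def)
    finally show ?thesis using w by (intro bexI[of _ w]) auto
  qed
  have main: "\<exists>b' :: real^'n. (\<forall>x\<in>ball a T. f b [] x = f b' [] x) \<and>
      (\<forall>x\<in>ball a T'. \<exists>w. length w \<le> l \<and> \<kappa> * norm b' \<le> \<bar>f b' w x\<bar>)" for b
  proof -
    obtain n m where nm: "n \<in> span N" "\<And>w. w \<in> span N \<Longrightarrow> orthogonal m w" "b = n + m"
      by (rule orthogonal_subspace_decomp_exists[of N b]) blast
    have spN: "span N = N" using subN by (simp add: span_eq_iff)
    have nN: "n \<in> N" using nm(1) unfolding spN .
    have mQ: "m \<in> Q" using nm(2) unfolding spN by (auto simp: Q_def orthogonal_def inner_commute)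
    have "f n [] x = 0" if "x \<in> ball a T" for x
      using uc[of n] nN that by (auto simp: N_def f_def)
    then have eq: "\<forall>x\<in>ball a T. f b [] x = f m [] x" by (simp add: nm(3) f_lin)
    have "\<exists>w. length w \<le> l \<and> \<kappa> * norm m \<le> \<bar>f m w x\<bar>" if x: "x \<in> ball a T'" for x
    proof (cases "m = 0")
      case True
      then show ?thesis by (intro exI[of _ "[]"]) auto
    next
      case False
      have "(1 / norm m) *\<^sub>R m \<in> Kp" using mQ False by (auto simp: Kp_def Q_def)
      from unit[OF this x] obtain w where w: "w \<in> W" "\<kappa> \<le> \<bar>f ((1 / norm m) *\<^sub>R m) w x\<bar>" by blast
      then have "\<kappa> * norm m \<le> \<bar>f m w x\<bar>"
        using False by (simp add: f_lin abs_mult field_simps)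
      then show ?thesis using l[OF w(1)] by blast
    qed
    then show ?thesis using eq by blast
  qed
  show ?thesis
    by (rule that[of \<kappa> T' l]) (use \<kappa> T T1 main in \<open>auto simp: T'_def f_def\<close>)
qed

text \<open>Upper and lower bounds for the derivatives are both proportional to
  \<open>norm b'\<close>, which cancels in their ratio. Therefore \<open>G\<close> and \<beta> are
  independent of \<open>b\<close>.\<close>

lemma good_family:
  fixes \<mu> :: "(real^'d) measure" and \<Phi> :: "'n::finite \<Rightarrow> 'd list \<Rightarrow> real^'d \<Rightarrow> real"
  assumes sets: "sets \<mu> = sets borel" and fed: "federer_on D \<mu> U" and D: "D > 0"
    and dec: "decaying_on C \<alpha> \<mu> U" and C: "C > 0" "\<alpha> > 0"
    and T: "T > 0" "ball a T \<subseteq> U" and sys: "\<And>s. deriv_system (ball a T) (\<Phi> s)"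
    and uc: "\<And>b :: real^'n. (\<And>w. (\<Sum>s\<in>UNIV. b $ s * \<Phi> s w a) = 0) \<Longrightarrow>
      \<forall>x\<in>ball a T. (\<Sum>s\<in>UNIV. b $ s * \<Phi> s [] x) = 0"
  obtains T' G \<beta> where "0 < T'" "T' \<le> T" "G > 0" "\<beta> > 0"
    "\<forall>(b :: real^'n) y r \<rho> \<epsilon>. y \<in> supp \<mu> \<longrightarrow> 0 < r \<longrightarrow> ball y (3 * r) \<subseteq> ball a T' \<longrightarrow>
      0 < \<rho> \<longrightarrow> 0 < \<epsilon> \<longrightarrow> (\<exists>x\<in>ball y r. \<rho> \<le> \<bar>\<Sum>s\<in>UNIV. b $ s * \<Phi> s [] x\<bar>) \<longrightarrow>
      (\<exists>E\<in>sets \<mu>. {x \<in> ball y r. \<bar>\<Sum>s\<in>UNIV. b $ s * \<Phi> s [] x\<bar> < \<epsilon>} \<subseteq> E \<and>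
        emeasure \<mu> E \<le> ennreal (G * (\<epsilon> / \<rho>) powr \<beta>) * emeasure \<mu> (ball y r))"
proof -
  obtain l \<kappa> T1 where nd: "\<kappa> > 0" "0 < T1" "T1 \<le> T"
    "\<forall>b :: real^'n. \<exists>b' :: real^'n. (\<forall>x\<in>ball a T. (\<Sum>s\<in>UNIV. b $ s * \<Phi> s [] x) = (\<Sum>s\<in>UNIV. b' $ s * \<Phi> s [] x)) \<and>
      (\<forall>x\<in>ball a T1. \<exists>w. length w \<le> l \<and> \<kappa> * norm b' \<le> \<bar>\<Sum>s\<in>UNIV. b' $ s * \<Phi> s w x\<bar>)"
    by (rule uniform_nondegeneracy[OF T(1) sys uc])
  define T' where "T' = min T1 1"
  have T': "0 < T'" "T' \<le> T" "T' \<le> T1" "T' \<le> 1" using nd by (auto simp: T'_def)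
  have "\<forall>s w. \<exists>B. \<forall>x\<in>ball a T. \<bar>\<Phi> s w x\<bar> \<le> B" using sys by (auto simp: deriv_system_def)
  then obtain B where B: "\<And>s w x. x \<in> ball a T \<Longrightarrow> \<bar>\<Phi> s w x\<bar> \<le> B s w" by metis
  have B0: "0 \<le> B s w" for s w using B[of a s w] T by (meson abs_ge_zero centre_in_ball order_trans)
  define A where "A = (\<Sum>s\<in>UNIV. \<Sum>w\<in>words (Suc l). B s w)"
  have A0: "0 \<le> A" unfolding A_def using B0 by (intro sum_nonneg) auto
  have A: "\<bar>\<Phi> s w x\<bar> \<le> A" if "length w \<le> Suc l" "x \<in> ball a T" for s w x
  proof -
    have "w \<in> words (Suc l)" using that by (simp add: words_def)
    then have "B s w \<le> (\<Sum>w\<in>words (Suc l). B s w)" using B0 by (intro member_le_sum) auto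
    also have "\<dots> \<le> A" unfolding A_def
      using B0 by (intro member_le_sum[of _ UNIV "\<lambda>s. \<Sum>w\<in>words (Suc l). B s w"]) (auto intro: sum_nonneg)
    finally show ?thesis using B[OF that(2)] order_trans by blast
  qed
  let ?A = "real CARD('n) * A"
  define c where "c = comparison_const CARD('d) l (?A / \<kappa>)"
  define N where "N = card (words l :: 'd list set)"
  have cpos: "c > 0"
  proof -
    have "0 \<le> ?A / \<kappa>" using A0 nd(1) by simp
    then show ?thesis unfolding c_def comparison_const_def
      by (intro mult_pos_pos zero_less_power add_pos_nonneg) auto
  qed
  have Npos: "N > 0" unfolding N_def by (rule card_words_pos)
  have "good_const C \<alpha> D CARD('d) N l c > 0"
  proof -
    have "0 < (2 * (real N)\<^sup>2 * c) powr \<alpha>" "0 < c powr (\<alpha> / 4 ^ l)" using cpos Npos by auto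
    moreover have "0 \<le> real N * C * (3 + (real CARD('d))\<^sup>2 * c) powr \<alpha> * D ^ 4"
      using C D by simp
    ultimately show ?thesis unfolding good_const_def by (intro mult_pos_pos add_nonneg_pos)
  qed
  moreover have "\<alpha> / 4 ^ l > 0" using C by simp
  moreover have "\<exists>E\<in>sets \<mu>. {x \<in> ball y r. \<bar>\<Sum>s\<in>UNIV. b $ s * \<Phi> s [] x\<bar> < \<epsilon>} \<subseteq> E \<and>
        emeasure \<mu> E \<le> ennreal (good_const C \<alpha> D CARD('d) N l c * (\<epsilon> / \<rho>) powr (\<alpha> / 4 ^ l)) * emeasure \<mu> (ball y r)"
    if y: "y \<in> supp \<mu>" and r: "0 < r" and sub: "ball y (3 * r) \<subseteq> ball a T'" and \<rho>: "0 < \<rho>" and \<epsilon>: "0 < \<epsilon>"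
      and big: "\<exists>x\<in>ball y r. \<rho> \<le> \<bar>\<Sum>s\<in>UNIV. b $ s * \<Phi> s [] x\<bar>" for b y r \<rho> \<epsilon>
  proof -
    obtain b' :: "real^'n" where b':
      "\<And>x. x \<in> ball a T \<Longrightarrow> (\<Sum>s\<in>UNIV. b $ s * \<Phi> s [] x) = (\<Sum>s\<in>UNIV. b' $ s * \<Phi> s [] x)"
      "\<And>x. x \<in> ball a T1 \<Longrightarrow> \<exists>w. length w \<le> l \<and> \<kappa> * norm b' \<le> \<bar>\<Sum>s\<in>UNIV. b' $ s * \<Phi> s w x\<bar>"
      using nd(4) by blast
    define F where "F w x = (\<Sum>s\<in>UNIV. b' $ s * \<Phi> s w x)" for w x
    \<comment> \<open>Since \<open>T' \<le> 1\<close>, this yields \<open>r \<le> 1\<close>, needed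
      to compare powers of \<open>r\<close>.\<close>
    have "3 * r \<le> T'" using sub r by (simp add: ball_subset_ball_iff) (smt (verit) zero_le_dist)
    then have r1: "r \<le> 1" using T' r by simp
    have sub2: "ball y (2 * r) \<subseteq> ball a T'"
      using sub r by (intro order_trans[OF subset_ball sub]) auto
    have inT: "x \<in> ball a T" "x \<in> ball a T1" if "x \<in> ball y (2 * r)" for x
      using sub2 that T' by auto
    have inr: "x \<in> ball y (2 * r)" if "x \<in> ball y r" for x using that r by auto
    have eq: "(\<Sum>s\<in>UNIV. b $ s * \<Phi> s [] x) = F [] x" if "x \<in> ball y r" for x
      using b'(1)[OF inT(1)[OF inr[OF that]]] by (simp add: F_def)
    have big': "\<exists>x\<in>ball y r. \<rho> \<le> \<bar>F [] x\<bar>" using big eq by auto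
    have b'0: "b' \<noteq> 0" using big' \<rho> by (auto simp: F_def)
    have FA: "\<bar>F w x\<bar> \<le> ?A * norm b'" if "length w = Suc l" "x \<in> ball y (2 * r)" for w x
      unfolding F_def using A[of w x] inT[OF that(2)] that(1)
      by (intro linear_form_bound) auto
    have der: "(F w has_derivative (\<lambda>h. \<Sum>i\<in>UNIV. h $ i * F (i # w) x)) (at x)"
      if "x \<in> ball y (2 * r)" for w x
    proof -
      have "(F w has_derivative (\<lambda>h. \<Sum>s\<in>UNIV. b' $ s * (\<Sum>i\<in>UNIV. h $ i * \<Phi> s (i # w) x))) (at x)"
        unfolding F_def[abs_def] using sys inT[OF that]
        by (intro has_derivative_sum has_derivative_mult_right) (auto simp: deriv_system_def)
      moreover have "(\<Sum>s\<in>UNIV. b' $ s * (\<Sum>i\<in>UNIV. h $ i * \<Phi> s (i # w) x)) = (\<Sum>i\<in>UNIV. h $ i * F (i # w) x)" for h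
        unfolding F_def sum_distrib_left by (subst sum.swap) (simp add: mult_ac)
      ultimately show ?thesis by simp
    qed
    have U: "ball y (3 * r) \<subseteq> U" using sub T(2) subset_ball[OF T'(2), of a] by blast
    have "c = comparison_const CARD('d) l (?A * norm b' / (\<kappa> * norm b'))"
      using b'0 by (simp add: c_def)
    note system_good[OF sets fed D dec C y r r1 U _ _ der FA _ \<rho> \<epsilon> big' this N_def]
    then have "\<exists>E\<in>sets \<mu>. {x \<in> ball y r. \<bar>F [] x\<bar> < \<epsilon>} \<subseteq> E \<and>
        emeasure \<mu> E \<le> ennreal (good_const C \<alpha> D CARD('d) N l c * (\<epsilon> / \<rho>) powr (\<alpha> / 4 ^ l)) * emeasure \<mu> (ball y r)"
      using b'(2) inT nd(1) b'0 A0 by (auto simp: F_def)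
    moreover have "{x \<in> ball y r. \<bar>\<Sum>s\<in>UNIV. b $ s * \<Phi> s [] x\<bar> < \<epsilon>} = {x \<in> ball y r. \<bar>F [] x\<bar> < \<epsilon>}"
      using eq by auto
    ultimately show ?thesis by simp
  qed
  ultimately show ?thesis using that[of T' "good_const C \<alpha> D CARD('d) N l c" "\<alpha> / 4 ^ l"] T' by blast
qed

section \<open>Covolumes and short vectors\<close>

lemma norm_wedge_standard:
  assumes "sorted_wrt (<) js"
  shows "norm (wedge_list (map (\<lambda>j. axis j (1::real)) js)) = 1"
  by (simp add: wedge_list_standard_basis[OF assms])

text \<open>Only the absolute value of the determinant is needed, so it suffices to check elementary
  matrices; no signs of permutations enter.\<close>

lemma norm_wedge_list_det:
  fixes A :: "real^('m::{finite,linorder})^('m::{finite,linorder})"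
  assumes "length us = CARD('m)"
  shows "norm (wedge_list (map ((*v) A) us)) = \<bar>det A\<bar> * norm (wedge_list us)"
proof -
  define js where "js = sorted_list_of_set (UNIV :: 'm set)"
  have js: "sorted_wrt (<) js" "set js = UNIV" "length js = CARD('m)" "distinct js"
    by (auto simp: js_def)
  define std where "std = map (\<lambda>j. axis j (1::real)) js"
  have std: "norm (wedge_list std) = 1" unfolding std_def by (rule norm_wedge_standard[OF js(1)])
  have "wedge_list std \<noteq> 0" using std by (metis norm_zero zero_neq_one)
  then have "independent (set std)" "distinct std" using wedge_list_nonzero_imp by auto
  have "dim (set std) = CARD('m)"
    using \<open>independent (set std)\<close> distinct_card[OF \<open>distinct std\<close>] js(3)
    by (simp add: dim_eq_card_independent) (simp add: std_def)
  then have sp: "span (set std) = UNIV" using dim_eq_full[of "set std"] by simp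
  \<comment> \<open>One scalar relates the wedge of \<open>us\<close> to that of the standard basis
    both before and after \<open>A\<close>, so the standard basis decides.\<close>
  have reduce: "norm (wedge_list (map ((*v) A) us)) = \<bar>det A\<bar> * norm (wedge_list us)"
    if A: "norm (wedge_list (map (\<lambda>j. A *v axis j 1) js)) = \<bar>det A\<bar>" and us: "length us = CARD('m)"
    for A :: "((real, 'm) vec, 'm) vec" and us
  proof -
    have "\<exists>k\<in>UNIV. \<forall>A :: (real, 'm) vec \<Rightarrow> (real, 'm) vec. linear A \<longrightarrow>
        wedge_list (map A us) = k *\<^sub>R wedge_list (map A std)"
      using span_set_list[OF \<open>distinct std\<close>] sp us js
      by (intro wedge_list_combination_uniform) (auto simp: std_def)
    then obtain k where k: "\<And>A :: (real, 'm) vec \<Rightarrow> (real, 'm) vec. linear A \<Longrightarrow>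
        wedge_list (map A us) = k *\<^sub>R wedge_list (map A std)" by blast
    have "map ((*v) A) std = map (\<lambda>j. A *v axis j 1) js" by (simp add: std_def)
    then have "norm (wedge_list (map ((*v) A) us)) = \<bar>k\<bar> * \<bar>det A\<bar>"
      using k[OF matrix_vector_mul_linear[of A]] A by simp
    moreover have "norm (wedge_list us) = \<bar>k\<bar>"
      using k[OF linear_ident] std by simp
    ultimately show ?thesis by simp
  qed
  define P where "P A \<longleftrightarrow> (\<forall>us. length us = CARD('m) \<longrightarrow>
    norm (wedge_list (map ((*v) A) us)) = \<bar>det A\<bar> * norm (wedge_list us))" for A :: "((real, 'm) vec, 'm) vec"
  have reduce': "P A" if "norm (wedge_list (map (\<lambda>j. A *v axis j 1) js)) = \<bar>det A\<bar>" for A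
    using reduce[OF that] by (simp add: P_def)
  have "P A"
  proof (induction A rule: induct_matrix_elementary_alt)
    fix A B assume P: "P A" "P B"
    have "norm (wedge_list (map ((*v) (A ** B)) us)) = \<bar>det (A ** B)\<bar> * norm (wedge_list us)"
      if "length us = CARD('m)" for us
    proof -
      have e: "map ((*v) (A ** B)) us = map ((*v) A) (map ((*v) B) us)"
        by (simp add: matrix_vector_mul_assoc)
      have "norm (wedge_list (map ((*v) A) (map ((*v) B) us))) = \<bar>det A\<bar> * norm (wedge_list (map ((*v) B) us))"
        by (rule P(1)[unfolded P_def, rule_format]) (simp add: that)
      also have "norm (wedge_list (map ((*v) B) us)) = \<bar>det B\<bar> * norm (wedge_list us)"
        by (rule P(2)[unfolded P_def, rule_format, OF that])
      finally show ?thesis unfolding e det_mul abs_mult by simp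
    qed
    then show "P (A ** B)" by (simp add: P_def)
  next
    fix A :: "((real, 'm) vec, 'm) vec" and i assume i: "row i A = 0"
    have d: "det A = 0" by (rule det_zero_row(1)[OF i])
    \<comment> \<open>A non-zero wedge would make the images a basis and \<open>A\<close>
      invertible, against \<open>det A = 0\<close>.\<close>
    have "wedge_list (map ((*v) A) us) = 0" if us: "length us = CARD('m)" for us
    proof (rule ccontr)
      assume "wedge_list (map ((*v) A) us) \<noteq> 0"
      then have 1: "distinct (map ((*v) A) us)" "independent (set (map ((*v) A) us))"
        using wedge_list_nonzero_imp by blast+
      then have "dim (set (map ((*v) A) us)) = CARD('m)"
        using us distinct_card[OF 1(1)] by (simp add: dim_eq_card_independent)
      then have "span (set (map ((*v) A) us)) = UNIV" using dim_eq_full by fastforce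
      moreover have "span (set (map ((*v) A) us)) \<subseteq> range ((*v) A)"
        by (intro span_minimal linear_subspace_image) auto
      ultimately have "\<exists>B. A ** B = mat 1" unfolding matrix_right_invertible_surjective by blast
      then obtain B where "A ** B = mat 1" by blast
      then have "det A * det B = 1" by (metis det_I det_mul)
      then show False using d by simp
    qed
    then show "P A" using d by (simp add: P_def)
  next
    fix A :: "((real, 'm) vec, 'm) vec" assume A: "\<And>i j. i \<noteq> j \<Longrightarrow> A $ i $ j = 0"
    have col: "A *v axis j 1 = A $ j $ j *\<^sub>R axis j 1" for j
      unfolding matrix_vector_mult_basis using A by (auto simp: vec_eq_iff column_def axis_def)
    have "wedge_list (map (\<lambda>j. A $ j $ j *\<^sub>R axis j 1) ks)
        = (\<Prod>j\<leftarrow>ks. A $ j $ j) *\<^sub>R wedge_list (map (\<lambda>j. axis j 1) ks)" for ks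
      by (induction ks) (simp_all add: wedge_list_Cons linear_scale[OF linear_wedge_vec_left]
          linear_scale[OF linear_wedge_vec_right] mult.commute)
    then have "norm (wedge_list (map (\<lambda>j. A *v axis j 1) js)) = \<bar>\<Prod>j\<leftarrow>js. A $ j $ j\<bar>"
      using std by (simp add: col std_def)
    also have "(\<Prod>j\<leftarrow>js. A $ j $ j) = (\<Prod>j\<in>UNIV. A $ j $ j)"
      using js by (metis prod.distinct_set_conv_list)
    also have "\<dots> = det A" using A by (simp add: det_diagonal)
    finally show "P A" by (rule reduce')
  next
    fix m n :: 'm assume "m \<noteq> n"
    let ?p = "Transposition.transpose m n"
    let ?A = "(\<chi> i j. mat 1 $ i $ ?p j) :: ((real, 'm) vec, 'm) vec"
    have "?A *v axis j 1 = axis (?p j) 1" for j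
      unfolding matrix_vector_mult_basis by (auto simp: vec_eq_iff column_def axis_def mat_def)
    then have cols: "map (\<lambda>j. ?A *v axis j 1) js = map (\<lambda>j. axis j 1) (map ?p js)" by simp
    have "mset (map ?p js) = mset js"
    proof -
      have "set (map ?p js) = set js" using js(2) by (simp add: surj_transpose)
      moreover have "distinct (map ?p js)" using js(4) by (simp add: distinct_map inj_on_transpose)
      ultimately show ?thesis using js(4) set_eq_iff_mset_eq_distinct by blast
    qed
    then obtain s where s: "s \<in> {1, -1 :: real}"
      "\<And>f :: 'm \<Rightarrow> (real, 'm) vec. wedge_onto (map f (map ?p js)) (axis {} 1) = s *\<^sub>R wedge_onto (map f js) (axis {} 1)"
      using wedge_onto_perm by meson
    then have "norm (wedge_list (map (\<lambda>j. ?A *v axis j 1) js)) = norm (wedge_list std)"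
      unfolding cols wedge_list_eq std_def s(2) by auto
    moreover have "det ?A = of_int (sign ?p) * det (mat 1 :: ((real, 'm) vec, 'm) vec)"
      by (rule det_permute_columns) (simp add: permutes_swap_id)
    ultimately show "P ?A" using std by (intro reduce') (simp add: abs_mult sign_def)
  next
    fix m n :: 'm assume mn: "m \<noteq> n"
    let ?A = "(\<chi> i j. of_bool (i = m \<and> j = n \<or> i = j)) :: ((real, 'm) vec, 'm) vec"
    have col: "?A *v axis j 1 = (if j = n then axis m 1 + axis n 1 else axis j 1)" for j
      unfolding matrix_vector_mult_basis using mn by (auto simp: vec_eq_iff column_def axis_def)
    obtain a b where ab: "js = a @ n # b" using js(2) by (metis UNIV_I split_list)
    have nab: "n \<notin> set a" "n \<notin> set b" "m \<in> set a \<union> set b" using js(2,4) mn unfolding ab by auto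
    let ?f = "\<lambda>j. axis j (1::real)"
    have "map (\<lambda>j. ?A *v axis j 1) js = map ?f a @ (?f m + ?f n) # map ?f b"
      unfolding col ab using nab by auto
    \<comment> \<open>Slot \<open>n\<close> carries the sum of the basis vectors \<open>m\<close>
      and \<open>n\<close>; the former already occurs in another slot, so only the latter
      survives.\<close>
    moreover have "wedge_list (map ?f a @ ?f m # map ?f b) = 0"
    proof -
      have "\<not> distinct (map ?f a @ ?f m # map ?f b)" using nab(3) by auto
      then show ?thesis unfolding wedge_list_eq by (rule wedge_onto_not_distinct)
    qed
    ultimately have w: "wedge_list (map (\<lambda>j. ?A *v axis j 1) js) = wedge_list std"
      by (simp only: linear_add[OF linear_wedge_slot]) (simp add: std_def ab)
    have "?A = (\<chi> k. if k = m then row m (mat 1) + 1 *s row n (mat 1) else row k (mat 1))"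
      using mn by (auto simp: vec_eq_iff row_def mat_def)
    then have "det ?A = det (mat 1 :: ((real, 'm) vec, 'm) vec)"
      using det_row_operation[OF mn, of "mat 1 :: ((real, 'm) vec, 'm) vec" 1] by metis
    then have "det ?A = 1" by simp
    then show "P ?A" by (intro reduce') (simp only: w std abs_one)
  qed
  then show ?thesis using assms by (simp add: P_def)
qed

text \<open>A primitive sublattice is determined by its real span, so spans encode it and inclusion
  supplies the order. The bounds on the length exclude the zero lattice and, when
  \<open>CARD('m) = n + 1\<close>, the full one.\<close>

definition prim_spaces :: "nat \<Rightarrow> (real^('m::{finite,linorder})) set set" where
  "prim_spaces n = {span (set vs) | vs. primitive vs \<and> 1 \<le> length vs \<and> length vs \<le> n}"

definition prim_basis :: "(real^('m::{finite,linorder})) set \<Rightarrow> (real, 'm) vec list" where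
  "prim_basis S = (SOME vs. primitive vs \<and> span (set vs) = S)"

text \<open>The chosen basis does not affect the value: two primitive bases of one span differ by an
  integer matrix of determinant 1 or -1.\<close>

definition covol :: "real^('m::{finite,linorder})^('m::{finite,linorder}) \<Rightarrow> (real, 'm) vec set \<Rightarrow> real" where
  "covol A S = norm (wedge_list (map ((*v) A) (prim_basis S)))"

lemma primitive_dim:
  assumes "primitive vs"
  shows "dim (span (set vs)) = length vs"
  using assms by (simp add: primitive_def dim_eq_card_independent distinct_card)

lemma prim_basis:
  assumes "S \<in> prim_spaces n"
  shows "primitive (prim_basis S)" "span (set (prim_basis S)) = S"
    "1 \<le> length (prim_basis S)" "length (prim_basis S) \<le> n"
proof -
  obtain vs where vs: "primitive vs" "span (set vs) = S" "1 \<le> length vs" "length vs \<le> n"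
    using assms by (auto simp: prim_spaces_def)
  have *: "primitive (prim_basis S) \<and> span (set (prim_basis S)) = S"
    unfolding prim_basis_def by (rule someI_ex) (use vs in blast)
  then show "primitive (prim_basis S)" "span (set (prim_basis S)) = S" by auto
  have "length (prim_basis S) = length vs"
    using primitive_dim[of "prim_basis S"] primitive_dim[OF vs(1)] * vs(2) by simp
  then show "1 \<le> length (prim_basis S)" "length (prim_basis S) \<le> n" using vs by auto
qed

text \<open>Nested subspaces of equal dimension coincide, so a chain embeds into the dimensions from
  1 to \<open>n\<close>. This sets the depth of the induction.\<close>

lemma prim_spaces_chain:
  assumes "Q \<subseteq> prim_spaces n" "chain_set Q"
  shows "finite Q \<and> card Q \<le> n"
proof -
  have sub: "subspace S" "dim S \<in> {1..n}" if "S \<in> Q" for S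
  proof -
    have S: "S \<in> prim_spaces n" using that assms by blast
    show "subspace S" using prim_basis(2)[OF S] subspace_span by metis
    show "dim S \<in> {1..n}" using primitive_dim[OF prim_basis(1)[OF S]] prim_basis[OF S] by simp
  qed
  have inj: "inj_on dim Q"
  proof (rule inj_onI)
    fix S T assume ST: "S \<in> Q" "T \<in> Q" "dim S = dim T"
    then have "S \<subseteq> T \<or> T \<subseteq> S" using assms(2) by (auto simp: chain_set_def comparable_def)
    then show "S = T" using ST sub subspace_dim_equal by (metis order_refl)
  qed
  have "dim ` Q \<subseteq> {1..n}" using sub by blast
  then show ?thesis
    using inj inj_on_finite[OF inj] card_inj_on_le[OF inj, of "{1..n}"] by auto
qed

abbreviation wedge_bound :: "'m::finite itself \<Rightarrow> real" where
  "wedge_bound _ \<equiv> real (CARD('m set) * CARD('m))"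

lemma marked_no_short_vector:
  fixes h :: "'x \<Rightarrow> real^('m::{finite,linorder})^('m::{finite,linorder})"
  assumes n: "CARD('m) = n + 1" and det: "\<bar>det (h z)\<bar> = 1"
    and marked: "marked (prim_spaces n) (\<lambda>S z. covol (h z) S) \<epsilon> \<rho> z"
    and \<epsilon>: "\<epsilon> \<le> \<rho>" "\<rho> \<le> 1" and v: "v \<in> int_lattice" "v \<noteq> 0"
  shows "\<epsilon> \<le> wedge_bound TYPE('m) * norm (h z *v v)"
proof -
  let ?A = "(*v) (h z)"
  let ?P = "prim_spaces n :: (real, 'm) vec set set"
  have linA: "linear ?A" by (rule matrix_vector_mul_linear)
  have injA: "inj ?A"
    using det by (intro inj_matrix_vector_mult) (simp add: invertible_det_nz)
  obtain Q where Q: "Q \<subseteq> ?P" "chain_set Q" "\<And>S. S \<in> Q \<Longrightarrow> \<epsilon> \<le> covol (h z) S \<and> covol (h z) S < \<rho>"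
    "\<And>S. S \<in> ?P - Q \<Longrightarrow> (\<forall>T\<in>Q. comparable S T) \<Longrightarrow> \<rho> \<le> covol (h z) S"
    using marked unfolding marked_def by blast
  have subQ: "subspace S" if "S \<in> Q" for S
    using prim_basis(2)[of S n] that Q(1) by (metis subsetD subspace_span)
  have finQ: "finite Q" using prim_spaces_chain[OF Q(1,2)] by simp
  \<comment> \<open>\<open>us\<close> is a basis of the largest member of the flag without
    \<open>v\<close>, or the empty list if every member contains \<open>v\<close>; the empty wedge
    has norm 1. The last two conditions place the span of \<open>us\<close> within the flag.\<close>
  obtain us where us: "set us \<subseteq> int_lattice" "distinct us" "independent (set us)" "length us \<le> n"
    "v \<notin> span (set us)" "norm (wedge_list (map ?A us)) \<le> 1"
    "\<forall>T\<in>Q. v \<notin> T \<longrightarrow> T \<subseteq> span (set us)" "\<forall>T\<in>Q. v \<in> T \<longrightarrow> span (set us) \<subseteq> T"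
  proof (cases "\<exists>T\<in>Q. v \<notin> T")
    case False
    then show ?thesis using v subQ
      by (intro that[of "[]"]) (auto simp: wedge_list_eq subspace_0 independent_empty)
  next
    case True
    have "finite {T \<in> Q. v \<notin> T}" "{T \<in> Q. v \<notin> T} \<noteq> {}" using finQ True by auto
    then obtain S where S: "S \<in> Q" "v \<notin> S" "\<And>T. T \<in> Q \<Longrightarrow> v \<notin> T \<Longrightarrow> S \<subseteq> T \<Longrightarrow> S = T"
      using finite_has_maximal[of "{T \<in> Q. v \<notin> T}"] by auto
    have SP: "S \<in> ?P" using S(1) Q(1) by blast
    note pb = prim_basis[OF SP]
    have comp: "\<forall>T\<in>Q. S \<subseteq> T \<or> T \<subseteq> S"
      using Q(2) S(1) by (auto simp: chain_set_def comparable_def)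
    show ?thesis
    proof (rule that[of "prim_basis S"])
      show "norm (wedge_list (map ?A (prim_basis S))) \<le> 1"
        using Q(3)[OF S(1)] \<epsilon> by (simp add: covol_def)
    qed (use pb S comp in \<open>auto simp: primitive_def\<close>)
  qed
  have vus: "set (v # us) \<subseteq> int_lattice" "distinct (v # us)" "independent (set (v # us))"
    using us v by (auto simp: independent_insert intro: span_base)
  have "norm (wedge_list (map ?A (v # us))) \<le> wedge_bound TYPE('m) * norm (h z *v v) * norm (wedge_list (map ?A us))"
    by (simp add: wedge_list_Cons) (rule norm_wedge_vec_le[THEN order_trans], simp)
  also have "\<dots> \<le> wedge_bound TYPE('m) * norm (h z *v v) * 1"
    using us(6) by (intro mult_left_mono) auto
  finally have up: "norm (wedge_list (map ?A (v # us))) \<le> wedge_bound TYPE('m) * norm (h z *v v)" by simp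
  have "\<epsilon> \<le> norm (wedge_list (map ?A (v # us)))"
  \<comment> \<open>With \<open>n\<close> vectors, adding \<open>v\<close> gives full rank and
    leaves \<open>prim_spaces n\<close>. Integrality and the determinant then bound the wedge below
    by 1.\<close>
  proof (cases "length us = n")
    case True
    have "norm (wedge_list (map ?A (v # us))) = norm (wedge_list (v # us))"
      using norm_wedge_list_det[of "v # us" "h z"] det n True by simp
    moreover have "norm (wedge_list (v # us)) \<ge> 1"
    proof -
      obtain N where N: "(norm (wedge_list (v # us)))\<^sup>2 = real N"
        using norm_wedge_list_sq_integral[OF vus(1)] by (rule Nats_cases)
      have "N \<noteq> 0" using N wedge_list_nonzero[OF vus(2,3)]
        by (metis norm_eq_zero of_nat_0 power_eq_0_iff)
      then have "1\<^sup>2 \<le> (norm (wedge_list (v # us)))\<^sup>2" unfolding N by simp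
      then show ?thesis by (rule power2_le_imp_le) simp
    qed
    ultimately show ?thesis using \<epsilon> by simp
  next
    case False
    obtain vs where vs: "primitive vs" "length vs = length (v # us)" "span (set vs) = span (set (v # us))"
      by (rule primitive_basis_exists[OF vus])
    define S where "S = span (set (v # us))"
    have "S \<in> ?P" using vs us(4) False unfolding S_def prim_spaces_def by (intro CollectI exI[of _ vs]) auto
    note pb = prim_basis[OF this]
    have "comparable S T" if T: "T \<in> Q" for T
    proof (cases "v \<in> T")
      case True
      have "set us \<subseteq> T" using us(8) T True span_superset by blast
      then have "S \<subseteq> T" unfolding S_def using True subQ[OF T] by (intro span_minimal) auto
      then show ?thesis by (simp add: comparable_def)
    next
      case False
      have "span (set us) \<subseteq> S" unfolding S_def by (intro span_mono) auto
      then have "T \<subseteq> S" using us(7) T False by blast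
      then show ?thesis by (simp add: comparable_def)
    qed
    \<comment> \<open>\<open>S\<close> either belongs to the flag, with covolume at least
      \<epsilon>, or is compatible with it, with covolume at least \<rho>.\<close>
    then have "\<epsilon> \<le> covol (h z) S" using Q(3,4) \<epsilon> \<open>S \<in> ?P\<close> by fastforce
    also have "covol (h z) S \<le> norm (wedge_list (map ?A (v # us)))"
      unfolding covol_def
    proof (rule primitive_minimal_norm[OF pb(1) _ vus(2,3) _ linA injA])
      have "set (v # us) \<subseteq> S" unfolding S_def by (rule span_superset)
      then show "set (v # us) \<subseteq> int_lattice \<inter> span (set (prim_basis S))"
        using vus(1) unfolding pb(2) by (rule Int_greatest[rotated])
      have "length (prim_basis S) = dim S" using primitive_dim[OF pb(1)] unfolding pb(2) by simp
      moreover have "length vs = dim S"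
        using primitive_dim[OF vs(1)] unfolding vs(3) S_def[symmetric] by simp
      ultimately show "length (v # us) = length (prim_basis S)" using vs(2) by simp
    qed
    finally show ?thesis .
  qed
  then show ?thesis using up by (rule order_trans)
qed

lemma marked_in_K_set:
  fixes h :: "'x \<Rightarrow> real^('m::{finite,linorder})^('m::{finite,linorder})"
  assumes "CARD('m) = n + 1" "\<bar>det (h z)\<bar> = 1" "marked (prim_spaces n) (\<lambda>S z. covol (h z) S) \<epsilon> \<rho> z"
    and "\<epsilon> \<le> \<rho>" "\<rho> \<le> 1"
  shows "(*v) (h z) ` int_lattice \<in> K_set (\<epsilon> / wedge_bound TYPE('m))"
proof -
  have "(*v) (h z) ` int_lattice \<in> unimodular_lattices"
    using assms(2) by (auto simp: unimodular_lattices_def)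
  moreover have "\<epsilon> / wedge_bound TYPE('m) \<le> norm (h z *v v)" if "v \<in> int_lattice" "h z *v v \<noteq> 0" for v
  proof -
    have "v \<noteq> 0" using that(2) by auto
    then have "\<epsilon> \<le> wedge_bound TYPE('m) * norm (h z *v v)"
      using marked_no_short_vector[OF assms(1-5) that(1)] by simp
    then show ?thesis by (simp add: field_simps)
  qed
  ultimately show ?thesis unfolding K_set_def by force
qed

section \<open>Products of matrix entries and the main estimate\<close>

definition entry_or_one :: "('x \<Rightarrow> real^'m^'m) \<Rightarrow> ('m \<times> 'm) option \<Rightarrow> 'x \<Rightarrow> real" where
  "entry_or_one h e x = (case e of None \<Rightarrow> 1 | Some (i, j) \<Rightarrow> h x $ i $ j)"

text \<open>Products of at most \<open>CARD('m)\<close> matrix entries are indexed by the finite type of functions from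
  slots, themselves named by \<open>'m\<close>, to optional entries.\<close>

definition entry_prod :: "('x \<Rightarrow> real^'m^'m) \<Rightarrow> ('m::finite \<Rightarrow> ('m \<times> 'm) option) \<Rightarrow> 'x \<Rightarrow> real" where
  "entry_prod h \<sigma> x = (\<Prod>k\<in>UNIV. entry_or_one h (\<sigma> k) x)"

text \<open>\<open>S\<close> lists the slots that may be occupied, so multiplication by a further
  matrix entry can claim a slot outside \<open>S\<close>.\<close>

inductive_set entry_span :: "('x \<Rightarrow> real^'m^'m) \<Rightarrow> 'm::finite set \<Rightarrow> ('x \<Rightarrow> real) set" for h S where
  base: "(\<And>k. k \<notin> S \<Longrightarrow> \<sigma> k = None) \<Longrightarrow> entry_prod h \<sigma> \<in> entry_span h S"
| zero: "(\<lambda>_. 0) \<in> entry_span h S"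
| add: "p \<in> entry_span h S \<Longrightarrow> q \<in> entry_span h S \<Longrightarrow> (\<lambda>x. p x + q x) \<in> entry_span h S"
| scale: "p \<in> entry_span h S \<Longrightarrow> (\<lambda>x. t * p x) \<in> entry_span h S"

lemma entry_span_sum:
  assumes "\<And>i. i \<in> I \<Longrightarrow> p i \<in> entry_span h S"
  shows "(\<lambda>x. \<Sum>i\<in>I. p i x) \<in> entry_span h S"
  using assms
  by (induction I rule: infinite_finite_induct) (auto intro: entry_span.zero entry_span.add)

lemma entry_span_mult:
  assumes "p \<in> entry_span h S" "k \<notin> S"
  shows "(\<lambda>x. h x $ i $ j * p x) \<in> entry_span h (insert k S)"
  using assms
proof (induction rule: entry_span.induct)
  case (base \<sigma>)
  have eq: "(\<lambda>x. h x $ i $ j * entry_prod h \<sigma> x) = entry_prod h (\<sigma>(k := Some (i, j)))"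
  proof
    fix x
    have "entry_or_one h (\<sigma> k) x = 1" using base by (simp add: entry_or_one_def)
    then have "entry_prod h \<sigma> x = (\<Prod>k\<in>UNIV - {k}. entry_or_one h (\<sigma> k) x)"
      unfolding entry_prod_def by (subst prod.remove[of _ k]) auto
    also have "\<dots> = (\<Prod>l\<in>UNIV - {k}. entry_or_one h ((\<sigma>(k := Some (i, j))) l) x)"
      by (intro prod.cong) auto
    finally show "h x $ i $ j * entry_prod h \<sigma> x = entry_prod h (\<sigma>(k := Some (i, j))) x"
      unfolding entry_prod_def[of h "\<sigma>(k := Some (i, j))"]
      by (subst prod.remove[of _ k]) (auto simp: entry_or_one_def)
  qed
  show ?case unfolding eq by (rule entry_span.base) (use base in auto)
next
  case (add p q)
  then show ?case using entry_span.add by (fastforce simp: distrib_left)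
next
  case (scale p t)
  then show ?case using entry_span.scale[of _ h "insert k S" t] by (simp add: mult.left_commute)
qed (simp add: entry_span.zero)

lemma entry_span_coeffs:
  assumes "p \<in> entry_span h S"
  shows "\<exists>b :: real^('m::finite \<Rightarrow> ('m \<times> 'm) option). \<forall>x. p x = (\<Sum>\<sigma>\<in>UNIV. b $ \<sigma> * entry_prod h \<sigma> x)"
  using assms
proof (induction rule: entry_span.induct)
  case (base \<sigma>)
  have "entry_prod h \<sigma> x = (\<Sum>\<tau>\<in>UNIV. axis \<sigma> 1 $ \<tau> * entry_prod h \<tau> x)" for x
    by (simp add: axis_def if_distrib[of "\<lambda>t. t * _"] cong: if_cong)
  then show ?case by blast
next
  case zero
  then show ?case by (intro exI[of _ 0]) simp
next
  case (add p q)
  then obtain b b' where b: "\<forall>x. p x = (\<Sum>\<sigma>\<in>UNIV. b $ \<sigma> * entry_prod h \<sigma> x)"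
    "\<forall>x. q x = (\<Sum>\<sigma>\<in>UNIV. b' $ \<sigma> * entry_prod h \<sigma> x)" by blast
  show ?case
    by (intro exI[of _ "b + b'"]) (simp add: b distrib_right sum.distrib)
next
  case (scale p t)
  then obtain b where b: "\<forall>x. p x = (\<Sum>\<sigma>\<in>UNIV. b $ \<sigma> * entry_prod h \<sigma> x)" by blast
  show ?case
    by (intro exI[of _ "t *\<^sub>R b"]) (simp add: b sum_distrib_left mult.assoc)
qed

text \<open>The entries of \<open>g\<close> and the coordinates of \<open>vs\<close> are constants
  in \<open>x\<close> and become scalars; each vector uses up one slot. Hence a single
  finite-dimensional space serves all \<open>g\<close> and all \<open>vs\<close>.\<close>

lemma wedge_coordinate_entry_span:
  fixes h :: "'x \<Rightarrow> real^('m::{finite,linorder})^('m::{finite,linorder})"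
  assumes "length vs \<le> card S"
  shows "(\<lambda>x. wedge_list (map ((*v) (g ** h x)) vs) $ K) \<in> entry_span h S"
  using assms
proof (induction vs arbitrary: S K)
  case Nil
  have "entry_prod h (\<lambda>_. None) \<in> entry_span h S" by (rule entry_span.base) simp
  from entry_span.scale[OF this, of "axis {} 1 $ K"] show ?case
    by (simp add: wedge_list_eq entry_prod_def entry_or_one_def)
next
  case (Cons v vs)
  then have "S \<noteq> {}" by auto
  then obtain k where k: "k \<in> S" by blast
  then have S: "S = insert k (S - {k})" "k \<notin> S - {k}" by auto
  have IH: "(\<lambda>x. wedge_list (map ((*v) (g ** h x)) vs) $ K) \<in> entry_span h (S - {k})" for K
    using Cons.prems k by (intro Cons.IH) simp
  define w where "w x = wedge_list (map ((*v) (g ** h x)) vs)" for x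
  have "(\<lambda>x. wedge_list (map ((*v) (g ** h x)) (v # vs)) $ K) =
      (\<lambda>x. \<Sum>i\<in>K. \<Sum>l\<in>UNIV. \<Sum>a\<in>UNIV. (ins_sign i K * g $ i $ a * v $ l) * (h x $ a $ l * w x $ (K - {i})))"
    by (simp add: fun_eq_iff wedge_list_Cons wedge_vec_nth w_def matrix_vector_mult_def
        matrix_matrix_mult_def sum_distrib_left sum_distrib_right mult_ac)
  also have "\<dots> \<in> entry_span h (insert k (S - {k}))"
    unfolding w_def by (intro entry_span_sum entry_span.scale entry_span_mult IH S(2))
  finally show ?case using S(1) by simp
qed

lemma entry_prod_pow_series:
  fixes h :: "real^'d \<Rightarrow> real^'m^'m"
  assumes an: "\<And>i j. real_analytic_on (\<lambda>x. h x $ i $ j) U" and a: "a \<in> U"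
  obtains R c where "R > 0" "\<And>\<sigma>. pow_series a R (c \<sigma>) (entry_prod h \<sigma>)"
proof -
  have "\<exists>R c. R > 0 \<and> pow_series a R c (\<lambda>x. h x $ i $ j)" for i j
    using real_analytic_pow_series[OF an a] by metis
  then obtain R c where Rc: "\<And>i j. R i j > 0" "\<And>i j. pow_series a (R i j) (c i j) (\<lambda>x. h x $ i $ j)"
    by metis
  define R0 where "R0 = Min (range (\<lambda>(i, j). R i j))"
  have R0: "R0 > 0" unfolding R0_def using Rc(1) by (subst Min_gr_iff) auto
  have "R0 \<le> R i j" for i j unfolding R0_def by (rule Min_le) (auto intro: rev_image_eqI[of "(i, j)"])
  then have "pow_series a R0 (c i j) (\<lambda>x. h x $ i $ j)" for i j using Rc(2) pow_series_mono by blast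
  then have "\<exists>c. pow_series a R0 c (entry_or_one h e)" for e
    unfolding entry_or_one_def[abs_def]
    using pow_series_const[of a R0 1] by (cases e) auto
  then have "\<exists>c. pow_series a R0 c (entry_prod h \<sigma>)" for \<sigma>
    unfolding entry_prod_def[abs_def] by (intro pow_series_prod) auto
  then show ?thesis using that[OF R0] by metis
qed

theorem theorem5p11:
  fixes n :: nat and D :: real
    and U :: "(real^'d) set"
    and h0 :: "real^'d \<Rightarrow> real^('m::{finite,linorder})^('m::{finite,linorder})"
    and \<mu> :: "(real^'d) measure"
  assumes "n \<ge> 1" and "CARD('m) = n + 1"
    and "D > 0"
    and "open U"
    and "\<And>x. x \<in> U \<Longrightarrow> det (h0 x) = 1"
    and "\<And>i j. real_analytic_on (\<lambda>x. h0 x $ i $ j) U"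
    and "sets \<mu> = sets borel"
    and "locally_finite_measure \<mu>"
    and "absolutely_decaying_on \<mu> U"
    and "federer_on D \<mu> U"
  shows "\<forall>x0 \<in> supp \<mu> \<inter> U. \<exists>r0>0. ball x0 r0 \<subseteq> U \<and> (\<exists>C0>0. \<exists>\<alpha>0>0.
    \<forall>x1 r. r > 0 \<and> ball x1 r \<subseteq> ball x0 r0 \<longrightarrow>
    (\<forall>g. diagonal_matrix g \<and> det g = 1 \<longrightarrow>
    (\<forall>\<rho>. 0 < \<rho> \<and> \<rho> \<le> 1 \<longrightarrow>
      (let h = (\<lambda>x. g ** h0 x) in
        (\<forall>\<epsilon>>0. emeasure \<mu> {x \<in> ball x1 r. (*v) (h x) ` int_lattice \<notin> K_set \<epsilon>}
            \<le> ennreal (C0 * (\<epsilon> / \<rho>) powr \<alpha>0) * emeasure \<mu> (ball x1 (3 * r)))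
      \<or> (\<exists>vs. primitive vs \<and> 1 \<le> length vs \<and> length vs \<le> n \<and>
            (SUP x\<in>ball x1 r. ennreal (norm (wedge_list (map ((*v) (h x)) vs)))) < ennreal \<rho>)))))"
proof
  fix x0 assume "x0 \<in> supp \<mu> \<inter> U"
  then have x0: "x0 \<in> U" by simp
  note sets = assms(7) and fed = assms(10) and D = assms(3)
  obtain C \<alpha> where dec: "C > 0" "\<alpha> > 0" "decaying_on C \<alpha> \<mu> U"
    using assms(9) by (auto simp: absolutely_decaying_on_def)
  obtain R c where R: "R > 0" and c: "\<And>\<sigma>. pow_series x0 R (c \<sigma>) (entry_prod h0 \<sigma>)"
    by (rule entry_prod_pow_series[OF assms(6) x0]) blast
  obtain rU where rU: "rU > 0" "ball x0 rU \<subseteq> U" using assms(4) x0 open_contains_ball by blast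
  define T where "T = min (R / 2) rU"
  have T: "0 < T" "T < R" "ball x0 T \<subseteq> U"
    using R rU subset_ball[of T rU x0] by (auto simp: T_def)
  have "\<exists>F. deriv_system (ball x0 T) F \<and> (\<forall>x\<in>ball x0 T. F [] x = entry_prod h0 \<sigma> x) \<and>
      (\<forall>w. F w x0 = c \<sigma> (count_list w) * dmon w (count_list w) 0)" for \<sigma>
    using pow_series_deriv_system[OF c[of \<sigma>] T(1,2)] by metis
  then obtain \<Phi> where sys: "\<And>\<sigma>. deriv_system (ball x0 T) (\<Phi> \<sigma>)"
    and \<Phi>: "\<And>\<sigma> x. x \<in> ball x0 T \<Longrightarrow> \<Phi> \<sigma> [] x = entry_prod h0 \<sigma> x"
    and \<Phi>0: "\<And>\<sigma> w. \<Phi> \<sigma> w x0 = c \<sigma> (count_list w) * dmon w (count_list w) 0"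
    by metis
  have uc: "\<forall>x\<in>ball x0 T. (\<Sum>\<sigma>\<in>UNIV. b $ \<sigma> * \<Phi> \<sigma> [] x) = 0"
    if "\<And>w. (\<Sum>\<sigma>\<in>UNIV. b $ \<sigma> * \<Phi> \<sigma> w x0) = 0" for b :: "real^('m \<Rightarrow> ('m \<times> 'm) option)"
  proof
    fix x assume x: "x \<in> ball x0 T"
    then have "x \<in> ball x0 R" using T by auto
    then have "(\<Sum>\<sigma>\<in>UNIV. b $ \<sigma> * entry_prod h0 \<sigma> x) = 0"
      by (rule pow_series_unique_continuation[OF c that[unfolded \<Phi>0]])
    then show "(\<Sum>\<sigma>\<in>UNIV. b $ \<sigma> * \<Phi> \<sigma> [] x) = 0" using \<Phi>[OF x] by simp
  qed
  obtain T' G \<beta> where T': "0 < T'" "T' \<le> T" and G: "G > 0" and \<beta>: "\<beta> > 0" and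
    good: "\<forall>(b :: real^('m \<Rightarrow> ('m \<times> 'm) option)) y r \<rho> \<epsilon>. y \<in> supp \<mu> \<longrightarrow> 0 < r \<longrightarrow> ball y (3 * r) \<subseteq> ball x0 T' \<longrightarrow>
      0 < \<rho> \<longrightarrow> 0 < \<epsilon> \<longrightarrow> (\<exists>x\<in>ball y r. \<rho> \<le> \<bar>\<Sum>\<sigma>\<in>UNIV. b $ \<sigma> * \<Phi> \<sigma> [] x\<bar>) \<longrightarrow>
      (\<exists>E\<in>sets \<mu>. {x \<in> ball y r. \<bar>\<Sum>\<sigma>\<in>UNIV. b $ \<sigma> * \<Phi> \<sigma> [] x\<bar> < \<epsilon>} \<subseteq> E \<and>
        emeasure \<mu> E \<le> ennreal (G * (\<epsilon> / \<rho>) powr \<beta>) * emeasure \<mu> (ball y r))"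
    by (rule good_family[OF sets fed D dec(3,1,2) T(1,3) sys uc])
  let ?V = "ball x0 T'"
  have VT: "?V \<subseteq> ball x0 T" using T' by (intro subset_ball) auto
  have VU: "?V \<subseteq> U" using VT T(3) by blast
  define N where "N = real CARD('m set)"
  have N: "N > 0" by (simp add: N_def)
  \<comment> \<open>Passing from a norm to one of its \<open>N\<close> coordinates divides the
    threshold \<open>\<rho> / 2\<close> by \<open>N\<close>.\<close>
  define C1 where "C1 = G * N powr \<beta>"
  have C1: "C1 \<ge> 0" using G by (simp add: C1_def)
  define M where "M = nd_const D C1 n"
  have M: "M \<ge> 0" unfolding M_def by (rule nd_const_nonneg[OF D C1])
  define wb where "wb = wedge_bound TYPE('m)"
  have wb: "wb > 0" by (simp add: wb_def)
  \<comment> \<open>The centre \<open>x1\<close> is within \<open>r0\<close> of \<open>x0\<close>,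
    and the induction needs the ball of radius \<open>nd_scale n * r\<close> around it inside
    \<open>ball x0 T'\<close>.\<close>
  define r0 where "r0 = T' / (nd_scale n + 1)"
  \<comment> \<open>Vectors of length \<epsilon> correspond to covolumes
    \<open>wb * \<epsilon>\<close>, compared with \<open>\<rho> / 2\<close>; the added 1 covers the
    range where the bound is trivial.\<close>
  define C0 where "C0 = (M + 1) * (2 * wb) powr \<beta>"
  have \<kappa>: "nd_scale n \<ge> 3" by (rule nd_scale_ge)
  have r0: "r0 > 0" "(nd_scale n + 1) * r0 = T'" using T' \<kappa> by (auto simp: r0_def)
  have r0T: "r0 \<le> T'" using r0 \<kappa> mult_right_mono[of 1 "nd_scale n + 1" r0] by simp
  have C0: "C0 > 0" using M wb by (simp add: C0_def)
  have claim: "(\<forall>\<epsilon>>0. emeasure \<mu> {x \<in> ball x1 r. (*v) (g ** h0 x) ` int_lattice \<notin> K_set \<epsilon>}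
            \<le> ennreal (C0 * (\<epsilon> / \<rho>) powr \<beta>) * emeasure \<mu> (ball x1 (3 * r)))
      \<or> (\<exists>vs. primitive vs \<and> 1 \<le> length vs \<and> length vs \<le> n \<and>
            (SUP x\<in>ball x1 r. ennreal (norm (wedge_list (map ((*v) (g ** h0 x)) vs)))) < ennreal \<rho>)"
    if r: "r > 0" and sub: "ball x1 r \<subseteq> ball x0 r0" and g: "det g = 1" and \<rho>: "0 < \<rho>" "\<rho> \<le> 1"
    for x1 r \<rho> and g :: "((real, 'm) vec, 'm) vec"
  proof (rule disjCI)
    assume no: "\<not> (\<exists>vs. primitive vs \<and> 1 \<le> length vs \<and> length vs \<le> n \<and>
            (SUP x\<in>ball x1 r. ennreal (norm (wedge_list (map ((*v) (g ** h0 x)) vs)))) < ennreal \<rho>)"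
    define h where "h x = g ** h0 x" for x
    let ?P = "prim_spaces n :: (real, 'm) vec set set"
    define \<psi> where "\<psi> S x = covol (h x) S" for S x
    have detz: "\<bar>det (h z)\<bar> = 1" if "z \<in> U" for z
      using g assms(5)[OF that] by (simp add: h_def det_mul)
    have x1r: "dist x0 x1 + r \<le> r0" using sub r by (simp add: ball_subset_ball_iff dist_commute)
    have V1: "ball x1 (nd_scale n * r) \<subseteq> ?V"
    proof -
      have "nd_scale n * r \<le> nd_scale n * r0"
        using order_trans[OF _ x1r, of r] \<kappa> by (intro mult_left_mono) auto
      moreover have "dist x0 x1 \<le> r0" using x1r r by linarith
      ultimately have "dist x1 x0 + nd_scale n * r \<le> T'"
        using r0(2) by (simp add: dist_commute algebra_simps)
      then show ?thesis by (simp add: ball_subset_ball_iff)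
    qed
    have x1V: "ball x1 r \<subseteq> U" using sub r0T VU subset_ball[of r0 T' x0] by blast
    have big: "\<exists>x\<in>ball x1 r. \<rho> / 2 \<le> \<psi> S x" if S: "S \<in> ?P" for S
    proof -
      note pb = prim_basis[OF S]
      have "\<not> (SUP x\<in>ball x1 r. ennreal (norm (wedge_list (map ((*v) (g ** h0 x)) (prim_basis S))))) < ennreal \<rho>"
        using no pb by blast
      then have "ennreal \<rho> \<le> (SUP x\<in>ball x1 r. ennreal (\<psi> S x))"
        by (simp add: \<psi>_def covol_def h_def not_less)
      moreover have "ennreal (\<rho> / 2) < ennreal \<rho>" using \<rho> by (intro ennreal_lessI) auto
      ultimately have "ennreal (\<rho> / 2) < (SUP x\<in>ball x1 r. ennreal (\<psi> S x))" by (rule less_le_trans[rotated])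
      then obtain x where "x \<in> ball x1 r" "ennreal (\<rho> / 2) < ennreal (\<psi> S x)"
        unfolding less_SUP_iff by blast
      then show ?thesis using \<rho> by (intro bexI[of _ x]) (auto simp: ennreal_less_iff)
    qed
    have coord: "\<exists>b. \<forall>J. \<forall>x\<in>?V. wedge_list (map ((*v) (h x)) (prim_basis S)) $ J = (\<Sum>\<sigma>\<in>UNIV. b J $ \<sigma> * \<Phi> \<sigma> [] x)"
      if S: "S \<in> ?P" for S
    proof -
      have "length (prim_basis S) \<le> card (UNIV :: 'm set)" using prim_basis(4)[OF S] assms(2) by simp
      then have "\<exists>b :: real^('m \<Rightarrow> ('m \<times> 'm) option). \<forall>x. wedge_list (map ((*v) (h x)) (prim_basis S)) $ J
          = (\<Sum>\<sigma>\<in>UNIV. b $ \<sigma> * entry_prod h0 \<sigma> x)" for J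
        unfolding h_def by (intro entry_span_coeffs wedge_coordinate_entry_span)
      then obtain b :: "'m set \<Rightarrow> real^('m \<Rightarrow> ('m \<times> 'm) option)" where
        "\<And>J x. wedge_list (map ((*v) (h x)) (prim_basis S)) $ J = (\<Sum>\<sigma>\<in>UNIV. b J $ \<sigma> * entry_prod h0 \<sigma> x)"
        by metis
      then show ?thesis using \<Phi> VT by (intro exI[of _ b]) auto
    qed
    have cont: "continuous (at x) (\<psi> S)" if S: "S \<in> ?P" and x: "x \<in> ?V" for S x
    proof -
      obtain b :: "'m set \<Rightarrow> real^('m \<Rightarrow> ('m \<times> 'm) option)" where b: "\<And>J x. x \<in> ?V \<Longrightarrow>
          wedge_list (map ((*v) (h x)) (prim_basis S)) $ J = (\<Sum>\<sigma>\<in>UNIV. b J $ \<sigma> * \<Phi> \<sigma> [] x)"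
        using coord[OF S] by blast
      have c\<Phi>: "isCont (\<Phi> \<sigma> []) x" for \<sigma>
      proof -
        have "(\<Phi> \<sigma> [] has_derivative (\<lambda>h. \<Sum>i\<in>UNIV. h $ i * \<Phi> \<sigma> [i] x)) (at x)"
          using sys[of \<sigma>] x VT by (auto simp: deriv_system_def)
        then show ?thesis by (rule has_derivative_continuous)
      qed
      have "isCont (\<lambda>x. \<chi> J. \<Sum>\<sigma>\<in>UNIV. b J $ \<sigma> * \<Phi> \<sigma> [] x) x"
        unfolding isCont_def
        by (rule vec_tendstoI) (use c\<Phi> in \<open>auto simp: isCont_def intro!: tendsto_intros\<close>)
      then have "isCont (\<lambda>x. norm (\<chi> J. \<Sum>\<sigma>\<in>UNIV. b J $ \<sigma> * \<Phi> \<sigma> [] x)) x"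
        by (rule continuous_norm)
      moreover have ev: "\<forall>\<^sub>F y in nhds x. norm (\<chi> J. \<Sum>\<sigma>\<in>UNIV. b J $ \<sigma> * \<Phi> \<sigma> [] y) = \<psi> S y"
        using eventually_nhds_in_open[OF open_ball x]
        by eventually_elim (auto simp: \<psi>_def covol_def vec_eq_iff b intro!: arg_cong[where f = norm])
      ultimately show ?thesis by (simp only: isCont_cong[OF ev])
    qed
    show "\<forall>\<epsilon>>0. emeasure \<mu> {x \<in> ball x1 r. (*v) (g ** h0 x) ` int_lattice \<notin> K_set \<epsilon>}
            \<le> ennreal (C0 * (\<epsilon> / \<rho>) powr \<beta>) * emeasure \<mu> (ball x1 (3 * r))"
    proof (intro allI impI)
      fix \<epsilon> :: real assume \<epsilon>: "\<epsilon> > 0"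
      define bad where "bad = {x \<in> ball x1 r. (*v) (g ** h0 x) ` int_lattice \<notin> K_set \<epsilon>}"
      define \<epsilon>' where "\<epsilon>' = wb * \<epsilon>"
      have \<epsilon>': "\<epsilon>' > 0" using wb \<epsilon> by (simp add: \<epsilon>'_def)
      define q where "q = (\<epsilon>' / (\<rho> / 2)) powr \<beta>"
      have q: "q \<ge> 0" by (simp add: q_def)
      have q_eq: "q = (2 * wb) powr \<beta> * (\<epsilon> / \<rho>) powr \<beta>"
        unfolding q_def \<epsilon>'_def powr_mult[symmetric] by (simp add: mult_ac)
      have C0q: "C0 * (\<epsilon> / \<rho>) powr \<beta> = (M + 1) * q" by (simp add: C0_def q_eq)
      show "emeasure \<mu> bad \<le> ennreal (C0 * (\<epsilon> / \<rho>) powr \<beta>) * emeasure \<mu> (ball x1 (3 * r))"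
        unfolding C0q
      proof (cases "\<epsilon>' \<le> \<rho> / 2")
        case False
        then have "1 \<le> q" unfolding q_def using \<rho> \<beta> by (intro ge_one_powr_ge_zero) (auto simp: field_simps)
        then have "1 * 1 \<le> (M + 1) * q" using M by (intro mult_mono) auto
        then have "1 \<le> ennreal ((M + 1) * q)" by (metis ennreal_1 ennreal_leI mult_1)
        then have "1 * emeasure \<mu> (ball x1 (3 * r)) \<le> ennreal ((M + 1) * q) * emeasure \<mu> (ball x1 (3 * r))"
          by (rule mult_right_mono) simp
        moreover have "emeasure \<mu> bad \<le> emeasure \<mu> (ball x1 (3 * r))"
          using sets r by (intro emeasure_mono) (auto simp: bad_def)
        ultimately show "emeasure \<mu> bad \<le> ennreal ((M + 1) * q) * emeasure \<mu> (ball x1 (3 * r))" by simp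
      next
        case True
        have "\<exists>E\<in>sets \<mu>. {z \<in> ball x1 r \<inter> supp \<mu>. \<not> marked ?P \<psi> \<epsilon>' (\<rho> / 2) z} \<subseteq> E \<and>
            emeasure \<mu> E \<le> ennreal (nd_const D C1 n * q) * emeasure \<mu> (ball x1 (3 * r))"
        proof (rule nondivergence_poset[OF sets fed D C1 VU cont _ q prim_spaces_chain r V1 big])
          fix S y s assume S: "S \<in> ?P" and y: "y \<in> supp \<mu>" and s: "0 < s" "ball y (3 * s) \<subseteq> ?V"
            and ex: "\<exists>x\<in>ball y s. \<rho> / 2 \<le> \<psi> S x"
          obtain b :: "'m set \<Rightarrow> real^('m \<Rightarrow> ('m \<times> 'm) option)" where b: "\<And>J x. x \<in> ?V \<Longrightarrow>
              wedge_list (map ((*v) (h x)) (prim_basis S)) $ J = (\<Sum>\<sigma>\<in>UNIV. b J $ \<sigma> * \<Phi> \<sigma> [] x)"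
            using coord[OF S] by blast
          have yV: "ball y s \<subseteq> ?V" using s by (intro order_trans[OF subset_ball s(2)]) auto
          obtain x where x: "x \<in> ball y s" "\<rho> / 2 \<le> \<psi> S x" using ex by blast
          define W where "W x = wedge_list (map ((*v) (h x)) (prim_basis S))" for x
          \<comment> \<open>One coordinate is large where the covolume reaches
            \<open>\<rho> / 2\<close>. The same coordinate controls the whole ball, because a small
            covolume makes every coordinate small.\<close>
          have "\<exists>J. \<rho> / 2 / N \<le> \<bar>W x $ J\<bar>"
          proof (rule ccontr)
            assume "\<not> (\<exists>J. \<rho> / 2 / N \<le> \<bar>W x $ J\<bar>)"
            then have "(\<Sum>J\<in>UNIV. \<bar>W x $ J\<bar>) < real (card (UNIV :: 'm set set)) * (\<rho> / 2 / N)"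
              by (intro sum_bounded_above_strict) (auto simp: not_le)
            also have "\<dots> = \<rho> / 2" using N by (simp add: N_def)
            finally show False using norm_le_l1_cart[of "W x"] x(2) by (simp add: \<psi>_def covol_def W_def)
          qed
          then obtain J where J: "\<rho> / 2 / N \<le> \<bar>W x $ J\<bar>" by blast
          have WJ: "W x $ J = (\<Sum>\<sigma>\<in>UNIV. b J $ \<sigma> * \<Phi> \<sigma> [] x)" if "x \<in> ball y s" for x
            using b that yV by (auto simp: W_def)
          have "\<exists>E\<in>sets \<mu>. {x \<in> ball y s. \<bar>\<Sum>\<sigma>\<in>UNIV. b J $ \<sigma> * \<Phi> \<sigma> [] x\<bar> < \<epsilon>'} \<subseteq> E \<and>
              emeasure \<mu> E \<le> ennreal (G * (\<epsilon>' / (\<rho> / 2 / N)) powr \<beta>) * emeasure \<mu> (ball y s)"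
            using J x(1) WJ[OF x(1)] \<rho> N \<epsilon>' by (intro good[rule_format, OF y s]) auto
          then obtain E where E: "E \<in> sets \<mu>" "{x \<in> ball y s. \<bar>\<Sum>\<sigma>\<in>UNIV. b J $ \<sigma> * \<Phi> \<sigma> [] x\<bar> < \<epsilon>'} \<subseteq> E"
            "emeasure \<mu> E \<le> ennreal (G * (\<epsilon>' / (\<rho> / 2 / N)) powr \<beta>) * emeasure \<mu> (ball y s)" by blast
          have "{x \<in> ball y s. \<psi> S x < \<epsilon>'} \<subseteq> {x \<in> ball y s. \<bar>\<Sum>\<sigma>\<in>UNIV. b J $ \<sigma> * \<Phi> \<sigma> [] x\<bar> < \<epsilon>'}"
          proof
            fix x assume x: "x \<in> {x \<in> ball y s. \<psi> S x < \<epsilon>'}"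
            then have "\<bar>W x $ J\<bar> < \<epsilon>'"
              using component_le_norm_cart[of "W x" J] by (simp add: \<psi>_def covol_def W_def)
            then show "x \<in> {x \<in> ball y s. \<bar>\<Sum>\<sigma>\<in>UNIV. b J $ \<sigma> * \<Phi> \<sigma> [] x\<bar> < \<epsilon>'}"
              using x WJ[of x] by simp
          qed
          moreover have "G * (\<epsilon>' / (\<rho> / 2 / N)) powr \<beta> = C1 * q"
          proof -
            have "\<epsilon>' / (\<rho> / 2 / N) = N * (\<epsilon>' / (\<rho> / 2))" by simp
            then show ?thesis unfolding C1_def q_def by (simp only: powr_mult mult.assoc)
          qed
          ultimately show "\<exists>E\<in>sets \<mu>. {x \<in> ball y s. \<psi> S x < \<epsilon>'} \<subseteq> E \<and>
              emeasure \<mu> E \<le> ennreal (C1 * q) * emeasure \<mu> (ball y s)"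
            using E by (intro bexI[of _ E]) auto
        qed
        then obtain E where E: "E \<in> sets \<mu>" "{z \<in> ball x1 r \<inter> supp \<mu>. \<not> marked ?P \<psi> \<epsilon>' (\<rho> / 2) z} \<subseteq> E"
            "emeasure \<mu> E \<le> ennreal (M * q) * emeasure \<mu> (ball x1 (3 * r))"
          unfolding M_def by blast
        have "bad \<subseteq> E \<union> - supp \<mu>"
        proof
          fix z assume z: "z \<in> bad"
          have "\<not> marked ?P \<psi> \<epsilon>' (\<rho> / 2) z"
          proof
            assume "marked ?P \<psi> \<epsilon>' (\<rho> / 2) z"
            then have "marked ?P (\<lambda>S z. covol (h z) S) \<epsilon>' (\<rho> / 2) z" by (simp add: \<psi>_def[abs_def])
            moreover have "z \<in> U" using z x1V by (auto simp: bad_def)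
            ultimately have "(*v) (h z) ` int_lattice \<in> K_set (\<epsilon>' / wb)"
              unfolding wb_def using True \<rho> by (intro marked_in_K_set[where h = h and z = z and \<rho> = "\<rho> / 2", OF assms(2) detz]) auto
            then show False using z wb by (simp add: bad_def h_def \<epsilon>'_def)
          qed
          then show "z \<in> E \<union> - supp \<mu>" using z E(2) by (auto simp: bad_def)
        qed
        moreover have null: "- supp \<mu> \<in> null_sets \<mu>" by (rule null_complement_supp[OF sets])
        ultimately have "emeasure \<mu> bad \<le> emeasure \<mu> (E \<union> - supp \<mu>)"
          using E(1) by (intro emeasure_mono) auto
        also have "\<dots> = emeasure \<mu> E" by (rule emeasure_Un_null_set[OF E(1) null])
        also have "\<dots> \<le> ennreal (M * q) * emeasure \<mu> (ball x1 (3 * r))" by (rule E(3))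
        also have "\<dots> \<le> ennreal ((M + 1) * q) * emeasure \<mu> (ball x1 (3 * r))"
          using q by (intro mult_right_mono ennreal_leI) auto
        finally show "emeasure \<mu> bad \<le> ennreal ((M + 1) * q) * emeasure \<mu> (ball x1 (3 * r))" .
      qed
    qed
  qed
  show "\<exists>r0>0. ball x0 r0 \<subseteq> U \<and> (\<exists>C0>0. \<exists>\<alpha>0>0.
    \<forall>x1 r. r > 0 \<and> ball x1 r \<subseteq> ball x0 r0 \<longrightarrow>
    (\<forall>g. diagonal_matrix g \<and> det g = 1 \<longrightarrow>
    (\<forall>\<rho>. 0 < \<rho> \<and> \<rho> \<le> 1 \<longrightarrow>
      (let h = (\<lambda>x. g ** h0 x) in
        (\<forall>\<epsilon>>0. emeasure \<mu> {x \<in> ball x1 r. (*v) (h x) ` int_lattice \<notin> K_set \<epsilon>}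
            \<le> ennreal (C0 * (\<epsilon> / \<rho>) powr \<alpha>0) * emeasure \<mu> (ball x1 (3 * r)))
      \<or> (\<exists>vs. primitive vs \<and> 1 \<le> length vs \<and> length vs \<le> n \<and>
            (SUP x\<in>ball x1 r. ennreal (norm (wedge_list (map ((*v) (h x)) vs)))) < ennreal \<rho>)))))"
    unfolding Let_def
  proof (rule exI[of _ r0], intro conjI r0(1), goal_cases)
    case 1
    show ?case using subset_ball[OF r0T, of x0] VU by blast
  next
    case 2
    show ?case
      by (rule exI[of _ C0], intro conjI C0, rule exI[of _ \<beta>], intro conjI \<beta> allI impI, rule claim) auto
  qed
qed

end
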